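(* Let $n\ge2$, let $\Omega\subset\mathbb{R}^n$ be open and bounded with Lipschitz boundary $S:=\partial\Omega$, let $p\in S$ and $r>0$, and abbreviate $y=x-p$. Then for any $1\le i,j\le n$ we have $$m_i(p)=\frac{1}{n+1}\int_{S\cap B_r(p)}(y_i\,y-r^2e_i)\cdot\nu\,dS(x)$$ and $$c_{ij}(p)=\frac{r^2}{n+2}\,V_{S,r}(p)\,\delta_{ij}+\frac{1}{2n+4}\int_{S\cap B_r(p)}\bigl(2y_iy_j\,y-r^2(y_je_i+y_ie_j)\bigr)\cdot\nu\,dS(x).$$
   Context: $B_r(p)$ is the Euclidean ball of radius $r$ centered at $p$, $dS$ is surface measure on $S$, and $\nu=\nu(x)$ is the unit outward normal to $\Omega$ along $S$ (defined almost everywhere on $S$). $e_1,\dots,e_n$ are the standard basis vectors of $\mathbb{R}^n$ and $\delta_{ij}$ is the Kronecker delta. $V_{S,r}(p)$ is the $n$-dimensional Lebesgue measure of $\Omega\cap B_r(p)$, and the moments are $$m_i(p):=\int_{\Omega\cap B_r(p)}(x_i-p_i)\,dx,\qquad c_{ij}(p):=\int_{\Omega\cap B_r(p)}(x_i-p_i)(x_j-p_j)\,dx.$$ *)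

theory Defs
  imports "HOL-Analysis.Analysis"
begin

(* A real function of the coordinates orthogonal to the unit vector e is encoded as a function g
   on the whole space that is constant along e; its gradient then lies in the hyperplane
   orthogonal to e.  A chart says that, inside U, the set \<Omega> is the region strictly below the graph
   {x. x \<bullet> e = g x}; consequently frontier \<Omega> \<inter> U is the part of the graph lying in U. *)
definition lipschitz_chart ::
    "'a::euclidean_space set \<Rightarrow> 'a set \<Rightarrow> 'a \<Rightarrow> ('a \<Rightarrow> real) \<Rightarrow> bool" where
  "lipschitz_chart \<Omega> U e g \<longleftrightarrow>
     open U \<and> norm e = 1 \<and> (\<exists>L. L-lipschitz_on UNIV g) \<and>
     (\<forall>x t. g (x + t *\<^sub>R e) = g x) \<and>
     \<Omega> \<inter> U = {x \<in> U. x \<bullet> e < g x}"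

definition lipschitz_boundary :: "'a::euclidean_space set \<Rightarrow> bool" where
  "lipschitz_boundary \<Omega> \<longleftrightarrow>
     (\<forall>q\<in>frontier \<Omega>. \<exists>U e g. q \<in> U \<and> lipschitz_chart \<Omega> U e g)"

definition gradient :: "('a::real_inner \<Rightarrow> real) \<Rightarrow> 'a \<Rightarrow> 'a" where
  "gradient g x = (THE D. GDERIV g x :> D)"

(* The measure sqrt (1 + |grad g|^2) dx' on the graph of g.  Lebesgue measure dx' on the hyperplane
   orthogonal to e is obtained from the slab 0 \<le> x \<bullet> e \<le> 1 of unit thickness; the map sends x to the
   point of the graph lying on the line through x in direction e. *)
definition graph_measure :: "'a::euclidean_space \<Rightarrow> ('a \<Rightarrow> real) \<Rightarrow> 'a measure" where
  "graph_measure e g =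
     distr
       (density lebesgue
         (\<lambda>x. indicator {x. 0 \<le> x \<bullet> e \<and> x \<bullet> e \<le> 1} x * ennreal (sqrt (1 + (norm (gradient g x))\<^sup>2))))
       borel
       (\<lambda>x. x + (g x - x \<bullet> e) *\<^sub>R e)"

definition is_surface_measure :: "'a::euclidean_space set \<Rightarrow> 'a measure \<Rightarrow> bool" where
  "is_surface_measure \<Omega> \<sigma> \<longleftrightarrow>
     sets \<sigma> = sets borel \<and>
     emeasure \<sigma> (- frontier \<Omega>) = 0 \<and>
     (\<forall>U e g. lipschitz_chart \<Omega> U e g \<longrightarrow>
        (\<forall>A\<in>sets borel. A \<subseteq> U \<longrightarrow> emeasure \<sigma> A = emeasure (graph_measure e g) A))"

(* Surface measure on the frontier of \<Omega>, as a measure on the whole space; it is completed because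
   the normal is only determined almost everywhere. *)
definition surface_measure :: "'a::euclidean_space set \<Rightarrow> 'a measure" where
  "surface_measure \<Omega> = completion (THE \<sigma>. is_surface_measure \<Omega> \<sigma>)"

(* At a point where some (equivalently, every) local graph function is differentiable, this is the
   unit normal (e - grad g) / sqrt (1 + |grad g|^2), which does not depend on the chart; at the
   remaining points, which form a null set, the value is unspecified. *)
definition outward_normal :: "'a::euclidean_space set \<Rightarrow> 'a \<Rightarrow> 'a" where
  "outward_normal \<Omega> x =
     (THE v. \<exists>U e g D. lipschitz_chart \<Omega> U e g \<and> x \<in> frontier \<Omega> \<inter> U \<and> (GDERIV g x :> D) \<and>
        v = (1 / sqrt (1 + (norm D)\<^sup>2)) *\<^sub>R (e - D))"

definition ball_volume :: "(real^'n) set \<Rightarrow> real \<Rightarrow> real^'n \<Rightarrow> real" where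
  "ball_volume \<Omega> r p = measure lebesgue (\<Omega> \<inter> ball p r)"

definition first_moment :: "(real^'n) set \<Rightarrow> real \<Rightarrow> 'n \<Rightarrow> real^'n \<Rightarrow> real" where
  "first_moment \<Omega> r i p = (LINT x:(\<Omega> \<inter> ball p r)|lebesgue. (x - p) $ i)"

definition second_moment :: "(real^'n) set \<Rightarrow> real \<Rightarrow> 'n \<Rightarrow> 'n \<Rightarrow> real^'n \<Rightarrow> real" where
  "second_moment \<Omega> r i j p = (LINT x:(\<Omega> \<inter> ball p r)|lebesgue. (x - p) $ i * (x - p) $ j)"

end

theory Submission
  imports Defs
begin

text \<open>
  Both identities are the divergence theorem on \<Omega> \<inter> B for a polynomial vector field that is tangential
  to the sphere \<partial>B: with y = x - p, the field y_i y - r^2 e_i has divergence (n + 1) y_i, the field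
  2 y_i y_j y - r^2 (y_j e_i + y_i e_j) has divergence (2n + 4) y_i y_j - 2 r^2 \<delta>_ij, and the scalar
  products of these fields with y are (|y|^2 - r^2) y_i and 2 (|y|^2 - r^2) y_i y_j. So only the part
  of the boundary on S contributes. Technically, the fields are multiplied by the cutoff
  functions 1 - (|y|/r)^(2k), k \<rightarrow> \<infinity>, and only the divergence theorem on \<Omega> is needed.

  For the latter, the test functions are Lipschitz and differentiable almost everywhere by
  Rademacher's theorem. Below a Lipschitz graph, the divergence identity follows by translating
  difference quotients; a partition of unity makes it global. The identity also shows
  that the surface measure is well defined: the normal component of the measure of a graph in a
  fixed direction is determined by \<Omega>, and at points of differentiability so is the normal.
\<close>

text \<open>\<open>\<Omega> \<inter> ball p r\<close> need not have a Lipschitz boundary: the sphere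
  may touch \<open>frontier \<Omega>\<close> or follow it along a set of positive surface measure.
  This is why the ball enters only through cutoffs that vanish on the sphere. Their gradients
  concentrate there, and the terms with \<open>r\<^sup>2\<close> in the two fields are chosen to
  remove the radial component on the sphere. In the first field this term is constant and free of
  divergence; in the second it is linear and produces the volume term. The other obstacle is that
  \<open>surface_measure\<close> and \<open>outward_normal\<close> are definite descriptions over
  all charts, so existence and uniqueness have to be settled first, for charts with unrelated
  directions. No change of variables between charts is used: two charts are compared through
  integrals over \<open>\<Omega>\<close>, which know nothing of either. The hyperplane of a chart is
  replaced throughout by a slab of thickness one, so that graph measures are images of measures on
  the whole space.\<close>

subsection \<open>Differentiability almost everywhere of Lipschitz functions on the line\<close>

text \<open>A Vitali covering by disjoint small balls of mean density above \<open>b\<close>, all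
  inside an open \<open>T\<close> close to \<open>E\<close>, catches almost every point of the set.
  Their union \<open>U\<close> satisfies b |U| <= q |U| + |T - E|, so |U| is small. The balls only
  have to contain the point, not to be centred at it, which admits one-sided intervals
  later.\<close>

lemma negligible_vitali_density:
  fixes \<mu> :: "'a::euclidean_space measure" and q b :: real
  assumes sets: "sets \<mu> = sets borel"
    and le: "\<And>A. A \<in> sets borel \<Longrightarrow> emeasure \<mu> A \<le> emeasure lborel A"
    and E: "E \<in> sets borel"
    and q: "\<And>A. A \<in> sets borel \<Longrightarrow> A \<subseteq> E \<Longrightarrow> emeasure \<mu> A \<le> ennreal q * emeasure lborel A"
    and "0 \<le> q" "q < b"
  shows "negligible {x \<in> E. \<forall>d>0. \<exists>c \<rho>. 0 < \<rho> \<and> \<rho> < d \<and> x \<in> cball c \<rho> \<and>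
            ennreal b * emeasure lborel (cball c \<rho>) < emeasure \<mu> (cball c \<rho>)}" (is "negligible ?S")
proof -
  have "negligible (?S \<inter> ball 0 (real n))" for n
    unfolding negligible_outer_le
  proof (intro allI impI)
    fix \<epsilon> :: real assume "\<epsilon> > 0"
    \<comment> \<open>Division by \<open>b - q\<close> at the end turns this tolerance into
      \<open>\<epsilon>\<close>.\<close>
    then have e': "\<epsilon> * (b - q) > 0" using assms by simp
    have "E \<in> sets lebesgue" using E by simp
    then obtain T where T: "open T" "E \<subseteq> T" "T - E \<in> lmeasurable" "emeasure lebesgue (T - E) < ennreal (\<epsilon> * (b - q))"
      using sets_lebesgue_outer_open e' by blast
    \<comment> \<open>Boundedness gives the union of the balls finite measure, so that its multiple
      by \<open>q\<close> can be subtracted.\<close>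
    define W where "W = T \<inter> ball 0 (real n)"
    have "open W" using T by (auto simp: W_def)
    let ?K = "{(c,\<rho>). 0 < \<rho> \<and> cball c \<rho> \<subseteq> W \<and> ennreal b * emeasure lborel (cball c \<rho>) < emeasure \<mu> (cball c \<rho>)}"
    obtain C where C: "countable C" "C \<subseteq> ?K"
      and disj: "pairwise (\<lambda>i j. disjnt (cball (fst i) (snd i)) (cball (fst j) (snd j))) C"
      and neg: "negligible ((?S \<inter> ball 0 (real n)) - (\<Union>i \<in> C. cball (fst i) (snd i)))"
    proof (rule Vitali_covering_theorem_cballs[of ?K snd "?S \<inter> ball 0 (real n)" fst])
      show "0 < snd i" if "i \<in> ?K" for i using that by auto
      show "\<exists>i. i \<in> ?K \<and> x \<in> cball (fst i) (snd i) \<and> snd i < d" if "x \<in> ?S \<inter> ball 0 (real n)" "0 < d" for x d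
      proof -
        have "x \<in> W" using that T by (auto simp: W_def)
        then obtain \<delta> where d: "\<delta> > 0" "ball x \<delta> \<subseteq> W" using \<open>open W\<close> open_contains_ball by blast
        have "min d (\<delta>/2) > 0" using d that by auto
        moreover have "\<forall>d>0. \<exists>c \<rho>. 0 < \<rho> \<and> \<rho> < d \<and> x \<in> cball c \<rho> \<and>
            ennreal b * emeasure lborel (cball c \<rho>) < emeasure \<mu> (cball c \<rho>)" using that(1) by simp
        ultimately obtain c \<rho> where c: "0 < \<rho>" "\<rho> < min d (\<delta>/2)" "x \<in> cball c \<rho>"
            "ennreal b * emeasure lborel (cball c \<rho>) < emeasure \<mu> (cball c \<rho>)"
          by meson
        have "cball c \<rho> \<subseteq> ball x \<delta>"
        proof
          fix y assume "y \<in> cball c \<rho>"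
          then have "dist x c + dist c y \<le> \<rho> + \<rho>" using c(3) by (intro add_mono) (auto simp: dist_commute)
          then have "dist x y < \<delta>" using c(2) dist_triangle[of x y c] by linarith
          then show "y \<in> ball x \<delta>" by simp
        qed
        then show ?thesis using c d by (intro exI[of _ "(c,\<rho>)"]) auto
      qed
    qed (rule that)
    define U where "U = (\<Union>i \<in> C. cball (fst i) (snd i))"
    have Ub: "U \<in> sets borel" unfolding U_def using C by (intro sets.countable_UN') auto
    have UO: "U \<subseteq> W" unfolding U_def using C by fastforce
    have "U \<subseteq> ball 0 (real n)" using UO by (auto simp: W_def)
    then have fin: "emeasure lborel U < \<infinity>"
      by (meson bounded_ball bounded_subset emeasure_bounded_finite)
    have dj: "disjoint_family_on (\<lambda>i. cball (fst i) (snd i)) C"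
      using disj by (auto simp: pairwise_def disjoint_family_on_def disjnt_def)
    have "ennreal b * emeasure lborel U = ennreal b * (\<integral>\<^sup>+i. emeasure lborel (cball (fst i) (snd i)) \<partial>count_space C)"
      unfolding U_def by (subst emeasure_UN_countable) (use C dj in auto)
    also have "\<dots> = (\<integral>\<^sup>+i. ennreal b * emeasure lborel (cball (fst i) (snd i)) \<partial>count_space C)"
      by (rule nn_integral_cmult[symmetric]) auto
    also have "\<dots> \<le> (\<integral>\<^sup>+i. emeasure \<mu> (cball (fst i) (snd i)) \<partial>count_space C)"
      by (rule nn_integral_mono) (use C in fastforce)
    also have "\<dots> = emeasure \<mu> U"
      unfolding U_def by (subst emeasure_UN_countable) (use C dj sets in auto)
    also have "\<dots> = emeasure \<mu> (U \<inter> E) + emeasure \<mu> (U - E)"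
      by (subst plus_emeasure) (use Ub E sets in \<open>auto intro!: arg_cong[where f="emeasure \<mu>"]\<close>)
    also have "\<dots> \<le> ennreal q * emeasure lborel U + ennreal (\<epsilon> * (b - q))"
    proof (rule add_mono)
      have "emeasure \<mu> (U \<inter> E) \<le> ennreal q * emeasure lborel (U \<inter> E)" using q Ub E by auto
      also have "\<dots> \<le> ennreal q * emeasure lborel U" using Ub by (intro mult_left_mono emeasure_mono) auto
      finally show "emeasure \<mu> (U \<inter> E) \<le> ennreal q * emeasure lborel U" .
      have "emeasure \<mu> (U - E) \<le> emeasure lborel (U - E)" using le Ub E by auto
      also have "\<dots> \<le> emeasure lborel (T - E)"
        using UO T E by (intro emeasure_mono) (auto simp: W_def)
      also have "\<dots> = emeasure lebesgue (T - E)" using T E by simp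
      finally show "emeasure \<mu> (U - E) \<le> ennreal (\<epsilon> * (b - q))" using T(4) by simp
    qed
    finally have main: "ennreal b * emeasure lborel U \<le> ennreal q * emeasure lborel U + ennreal (\<epsilon> * (b - q))" .
    define m where "m = measure lborel U"
    have m: "emeasure lborel U = ennreal m" "0 \<le> m"
      using fin by (auto simp: m_def emeasure_eq_ennreal_measure top.not_eq_extremum)
    have "ennreal (b * m) \<le> ennreal (q * m + \<epsilon> * (b - q))"
      using main assms e' m by (simp add: ennreal_mult ennreal_plus)
    then have "b * m \<le> q * m + \<epsilon> * (b - q)"
      using assms e' m by (subst (asm) ennreal_le_iff) auto
    then have "(b - q) * m \<le> (b - q) * \<epsilon>" by (simp add: algebra_simps)
    then have "m \<le> \<epsilon>" using assms by simp
    let ?N = "(?S \<inter> ball 0 (real n)) - U"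
    have N: "?N \<in> null_sets lebesgue" using neg unfolding U_def negligible_iff_null_sets .
    have Ul: "U \<in> lmeasurable" using fin Ub by (auto simp: fmeasurable_def)
    show "\<exists>T. ?S \<inter> ball 0 (real n) \<subseteq> T \<and> T \<in> lmeasurable \<and> measure lebesgue T \<le> \<epsilon>"
    proof (intro exI[of _ "U \<union> ?N"] conjI)
      show "?S \<inter> ball 0 (real n) \<subseteq> U \<union> ?N" by auto
      show "U \<union> ?N \<in> lmeasurable" using Ul N by (meson fmeasurable.Un fmeasurableI_null_sets)
      have "measure lebesgue (U \<union> ?N) = measure lebesgue U" by (rule measure_Un_null_set[OF fmeasurableD[OF Ul] N])
      also have "\<dots> = m" using Ub by (simp add: m_def)
      finally show "measure lebesgue (U \<union> ?N) \<le> \<epsilon>" using \<open>m \<le> \<epsilon>\<close> by simp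
    qed
  qed
  then have "negligible (\<Union>n. ?S \<inter> ball 0 (real n))" by (intro negligible_countable_Union) auto
  moreover have "?S \<subseteq> (\<Union>n. ?S \<inter> ball 0 (real n))"
    using reals_Archimedean2 by (auto simp: mem_ball_0)
  ultimately show ?thesis by (rule negligible_subset)
qed

text \<open>If f is (1/2)-Lipschitz, then x/2 + f x and x/2 - f x are both increasing, and their
  Stieltjes measures add up to Lebesgue measure; so each has a density with values in [0, 1].\<close>

lemma interval_measure_split_lborel:
  fixes f :: "real \<Rightarrow> real"
  assumes f: "(1/2)-lipschitz_on UNIV f"
  defines "\<nu> \<equiv> \<lambda>s. interval_measure (\<lambda>x. x/2 + s * f x)"
  shows "s \<in> {1,-1} \<Longrightarrow> 0 \<le> \<rho> \<Longrightarrow> emeasure (\<nu> s) (cball c \<rho>) = ennreal (\<rho> + s * (f (c+\<rho>) - f (c-\<rho>)))"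
    and "A \<in> sets borel \<Longrightarrow> emeasure (\<nu> 1) A + emeasure (\<nu> (-1)) A = emeasure lborel A"
proof -
  have lip: "\<bar>f x - f y\<bar> \<le> \<bar>x - y\<bar> / 2" for x y
    using lipschitz_onD[OF f, of x y] by (simp add: dist_real_def)
  have mono: "x/2 + s * f x \<le> y/2 + s * f y" if "x \<le> y" "s \<in> {1,-1}" for x y s
    using lip[of x y] that by (auto simp: abs_real_def split: if_splits)
  have cf: "continuous_on UNIV f" using f lipschitz_on_continuous_on by blast
  have cont: "continuous_on UNIV (\<lambda>x. x/2 + s * f x)" for s :: real
    by (intro continuous_intros cf) auto
  have Icc: "emeasure (\<nu> s) {a..b} = ennreal ((b/2 + s * f b) - (a/2 + s * f a))" if "a \<le> b" "s \<in> {1,-1}" for a b s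
    unfolding \<nu>_def using that mono cont by (intro emeasure_interval_measure_Icc) auto
  have Ioo: "emeasure (\<nu> s) {a<..<b} = ennreal ((b/2 + s * f b) - (a/2 + s * f a))" if "a \<le> b" "s \<in> {1,-1}" for a b s
  proof -
    have sing: "emeasure (\<nu> s) {x} = 0" for x using Icc[of x x s] that by simp
    have "{a..b} = {a<..<b} \<union> {a,b}" using that by auto
    have "emeasure (\<nu> s) {a<..<b} = emeasure (\<nu> s) ({a<..<b} \<union> {a,b})"
    proof (rule emeasure_Un_null_set[symmetric])
      show "{a,b} \<in> null_sets (\<nu> s)"
      proof -
        have "{a} \<in> null_sets (\<nu> s)" "{b} \<in> null_sets (\<nu> s)" using sing by (auto simp: null_sets_def \<nu>_def)
        then show ?thesis using null_sets.Un by (metis insert_is_Un)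
      qed
    qed (simp add: \<nu>_def)
    also have "{a<..<b} \<union> {a,b} = {a..b}" using that by auto
    finally show ?thesis using Icc that by simp
  qed
  show "emeasure (\<nu> s) (cball c \<rho>) = ennreal (\<rho> + s * (f (c+\<rho>) - f (c-\<rho>)))" if "s \<in> {1,-1}" "0 \<le> \<rho>"
    using Icc[of "c-\<rho>" "c+\<rho>" s] that by (simp add: cball_eq_atLeastAtMost algebra_simps add_divide_distrib diff_divide_distrib)
  define M where "M = measure_of UNIV (sets borel) (\<lambda>A. emeasure (\<nu> 1) A + emeasure (\<nu> (-1)) A)"
  have sM: "sets M = sets borel" unfolding M_def using sets.sigma_sets_eq[of borel] by simp
  have eM: "emeasure M A = emeasure (\<nu> 1) A + emeasure (\<nu> (-1)) A" if "A \<in> sets borel" for A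
  proof (rule emeasure_measure_of[OF M_def])
    show "countably_additive (sets M) (\<lambda>A. emeasure (\<nu> 1) A + emeasure (\<nu> (-1)) A)"
      unfolding countably_additive_def sM
    proof (intro allI impI)
      fix B :: "nat \<Rightarrow> real set" assume B: "range B \<subseteq> sets borel" "disjoint_family B" "\<Union> (range B) \<in> sets borel"
      have "(\<Sum>i. emeasure (\<nu> s) (B i)) = emeasure (\<nu> s) (\<Union> (range B))" for s
        using B by (intro suminf_emeasure) (auto simp: \<nu>_def)
      then show "(\<Sum>i. emeasure (\<nu> 1) (B i) + emeasure (\<nu> (-1)) (B i)) = emeasure (\<nu> 1) (\<Union> (range B)) + emeasure (\<nu> (-1)) (\<Union> (range B))"
        by (subst suminf_add[symmetric]) auto
    qed
  qed (use that sM in \<open>auto simp: positive_def\<close>)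
  \<comment> \<open>On a box the increments of \<open>s * f\<close> for \<open>s = 1\<close> and
    \<open>s = -1\<close> cancel and leave the length.\<close>
  have "lborel = M"
  proof (rule lborel_eqI)
    fix l u :: real assume lu: "\<And>b. b \<in> Basis \<Longrightarrow> l \<bullet> b \<le> u \<bullet> b"
    then have "l \<le> u" by simp
    then show "emeasure M (box l u) = ennreal (\<Prod>b\<in>Basis. (u - l) \<bullet> b)"
      using lip[of l u] by (auto simp: eM Ioo box_real abs_real_def simp flip: ennreal_plus split: if_splits)
  qed (fact sM)
  then show "A \<in> sets borel \<Longrightarrow> emeasure (\<nu> 1) A + emeasure (\<nu> (-1)) A = emeasure lborel A"
    using eM by simp
qed

text \<open>At each rational \<open>q\<close> the upper limit is at most \<open>q\<close> or the
  lower limit at least \<open>q\<close>, so the two limits cannot enclose a rational. Thresholds and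
  bounds are rational because each of them will cost a null set.\<close>

lemma tendsto_real_dichotomy:
  fixes Q :: "real \<Rightarrow> real"
  assumes bnd: "eventually (\<lambda>t. l \<le> Q t \<and> Q t \<le> u) F" and F: "F \<noteq> bot"
    and dich: "\<And>q. q \<in> \<rat> \<Longrightarrow> l < q \<Longrightarrow> q < u \<Longrightarrow>
        (\<forall>b\<in>\<rat>. q < b \<longrightarrow> eventually (\<lambda>t. Q t \<le> b) F) \<or> (\<forall>b\<in>\<rat>. b < q \<longrightarrow> eventually (\<lambda>t. b \<le> Q t) F)"
  shows "\<exists>d. (Q \<longlongrightarrow> d) F"
proof -
  let ?S = "{b. eventually (\<lambda>t. b \<le> Q t) F}"
  define d where "d = Sup ?S"
  have l: "l \<in> ?S" using bnd by (auto elim: eventually_mono)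
  have up: "b \<le> u" if "b \<in> ?S" for b
  proof -
    have "eventually (\<lambda>t. b \<le> Q t \<and> Q t \<le> u) F" using that bnd by (auto elim: eventually_elim2)
    then obtain t where "b \<le> Q t \<and> Q t \<le> u" using F eventually_happens by blast
    then show ?thesis by linarith
  qed
  have bdd: "bdd_above ?S" using up by (auto simp: bdd_above_def)
  have ld: "l \<le> d" unfolding d_def using l bdd by (rule cSup_upper)
  have "(Q \<longlongrightarrow> d) F"
  proof (rule order_tendstoI)
    fix a assume "a < d"
    then obtain b where b: "b \<in> ?S" "a < b" unfolding d_def using l bdd less_cSup_iff by (metis (no_types, lifting) empty_iff)
    then show "eventually (\<lambda>t. a < Q t) F" by (auto elim: eventually_mono)
  next
    fix a assume a: "d < a"
    show "eventually (\<lambda>t. Q t < a) F"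
    proof (cases "u < a")
      case True then show ?thesis using bnd by (auto elim: eventually_mono)
    next
      case False
      obtain q where q: "q \<in> \<rat>" "d < q" "q < a" using a Rats_dense_in_real by blast
      have *: "l < q" "q < u" using ld q False by auto
      from dich[OF q(1) *] show ?thesis
      proof
        assume "\<forall>b\<in>\<rat>. q < b \<longrightarrow> eventually (\<lambda>t. Q t \<le> b) F"
        moreover obtain b where "b \<in> \<rat>" "q < b" "b < a" using q Rats_dense_in_real by blast
        ultimately have "eventually (\<lambda>t. Q t \<le> b) F" "b < a" by auto
        then show ?thesis by (auto elim: eventually_mono)
      next
        assume h: "\<forall>b\<in>\<rat>. b < q \<longrightarrow> eventually (\<lambda>t. b \<le> Q t) F"
        obtain b where b: "b \<in> \<rat>" "d < b" "b < q" using q Rats_dense_in_real by blast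
        then have "b \<in> ?S" using h by auto
        then have "b \<le> d" unfolding d_def by (rule cSup_upper[OF _ bdd])
        then show ?thesis using b by simp
      qed
    qed
  qed
  then show ?thesis ..
qed

text \<open>Let \<open>h\<close> be the density of \<open>\<nu> 1\<close>. On
  \<open>h \<le> q\<close> the measure \<open>\<nu> 1\<close> is at most \<open>q\<close> times
  Lebesgue measure, and off this set \<open>\<nu> (-1)\<close> is at most \<open>1 - q\<close> times
  it. The covering lemma turns either case into a bound on mean densities over small intervals, that
  is, on difference quotients; the dichotomy over rational \<open>q\<close> then gives the
  limit.\<close>

lemma lipschitz_half_negligible_nondifferentiable:
  fixes f :: "real \<Rightarrow> real"
  assumes f: "(1/2)-lipschitz_on UNIV f"
  shows "negligible {x. \<not> (\<exists>d. ((\<lambda>t. (f (x + t) - f x) / t) \<longlongrightarrow> d) (at 0))}"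
proof -
  define \<nu> where "\<nu> = (\<lambda>s. interval_measure (\<lambda>x. x/2 + s * f x))"
  have sets\<nu>: "sets (\<nu> s) = sets borel" for s by (simp add: \<nu>_def)
  have cb: "emeasure (\<nu> s) (cball c \<rho>) = ennreal (\<rho> + s * (f (c+\<rho>) - f (c-\<rho>)))" if "s \<in> {1,-1}" "0 \<le> \<rho>" for s c \<rho>
    unfolding \<nu>_def using that by (rule interval_measure_split_lborel[OF f])
  have sum: "emeasure (\<nu> 1) A + emeasure (\<nu> (-1)) A = emeasure lborel A" if "A \<in> sets borel" for A
    unfolding \<nu>_def using that by (rule interval_measure_split_lborel[OF f])
  have le: "emeasure (\<nu> s) A \<le> emeasure lborel A" if "A \<in> sets borel" "s \<in> {1,-1}" for A s
    using sum[OF that(1)] that(2) by (metis add_increasing2 add_increasing insertE order_refl singletonD zero_le)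
  have "absolutely_continuous lborel (\<nu> 1)"
    unfolding absolutely_continuous_def
  proof
    fix A assume "A \<in> null_sets (lborel :: real measure)"
    then have "A \<in> sets borel" "emeasure lborel A = 0" by (auto simp: null_sets_def)
    then show "A \<in> null_sets (\<nu> 1)" using le[of A 1] sets\<nu> by (auto simp: null_sets_def)
  qed
  then obtain h where h[measurable]: "h \<in> borel_measurable lborel" and hd: "density lborel h = \<nu> 1"
    using sigma_finite_measure.Radon_Nikodym[OF sigma_finite_lborel, of "\<nu> 1"] sets\<nu> by auto
  have hA: "emeasure (\<nu> 1) A = (\<integral>\<^sup>+x. h x * indicator A x \<partial>lborel)" if "A \<in> sets borel" for A
    unfolding hd[symmetric] using that by (subst emeasure_density) auto
  define E where "E q = {x. h x \<le> ennreal q}" for q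
  have E[measurable]: "E q \<in> sets borel" for q unfolding E_def by measurable
  have E1: "emeasure (\<nu> 1) A \<le> ennreal q * emeasure lborel A" if "A \<in> sets borel" "A \<subseteq> E q" for A q
  proof -
    have "emeasure (\<nu> 1) A \<le> (\<integral>\<^sup>+x. ennreal q * indicator A x \<partial>lborel)"
      unfolding hA[OF that(1)] using that by (intro nn_integral_mono) (auto simp: E_def indicator_def)
    also have "\<dots> = ennreal q * emeasure lborel A" using that by (simp add: nn_integral_cmult)
    finally show ?thesis .
  qed
  have E2: "emeasure (\<nu> (-1)) A \<le> ennreal (1 - q) * emeasure lborel A"
    if "A \<in> sets borel" "A \<subseteq> - E q" "0 < q" "q < 1" for A q
  proof (cases "emeasure lborel A = \<infinity>")
    case True then show ?thesis using that by (simp add: ennreal_mult_top)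
  next
    case False
    have "ennreal q * emeasure lborel A = (\<integral>\<^sup>+x. ennreal q * indicator A x \<partial>lborel)" using that by (simp add: nn_integral_cmult)
    also have "\<dots> \<le> emeasure (\<nu> 1) A"
      unfolding hA[OF that(1)] using that by (intro nn_integral_mono) (auto simp: E_def indicator_def)
    finally have 1: "ennreal q * emeasure lborel A \<le> emeasure (\<nu> 1) A" .
    obtain m where m: "emeasure lborel A = ennreal m" "0 \<le> m" using False by (cases "emeasure lborel A") auto
    have "emeasure (\<nu> 1) A \<le> ennreal m" "emeasure (\<nu> (-1)) A \<le> ennreal m" using le[OF that(1)] m by auto
    then obtain a b where ab: "emeasure (\<nu> 1) A = ennreal a" "0 \<le> a" "emeasure (\<nu> (-1)) A = ennreal b" "0 \<le> b"
      by (metis ennreal_cases ennreal_less_top leD)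
    have "ennreal (a + b) = ennreal m" using sum[OF that(1)] ab m by (simp add: ennreal_plus)
    then have "a + b = m" using ab m by (metis add_nonneg_nonneg ennreal_inj)
    moreover have "q * m \<le> a" using 1 ab m that by (simp flip: ennreal_mult)
    ultimately have "b \<le> (1 - q) * m" by (simp add: algebra_simps)
    then show ?thesis using ab m that by (simp flip: ennreal_mult)
  qed
  let ?B = "\<lambda>\<mu> E b. {x \<in> E. \<forall>d>0. \<exists>c \<rho>. 0 < \<rho> \<and> \<rho> < d \<and> x \<in> cball c \<rho> \<and>
            ennreal b * emeasure lborel (cball c \<rho>) < emeasure \<mu> (cball c \<rho>)}"
  define N where "N = (\<Union>q\<in>{q\<in>\<rat>. 0 < q \<and> q < 1}. (\<Union>b\<in>{b\<in>\<rat>. q < b}. ?B (\<nu> 1) (E q) b) \<union> (\<Union>b\<in>{b\<in>\<rat>. 1 - q < b}. ?B (\<nu> (-1)) (- E q) b))"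
  have "negligible N"
    unfolding N_def negligible_iff_null_sets
  proof (intro null_sets_UN' countable_subset[OF _ countable_rat] null_sets.Un)
    fix q b :: real assume "q \<in> {q\<in>\<rat>. 0 < q \<and> q < 1}" "b \<in> {b\<in>\<rat>. q < b}"
    then show "(?B (\<nu> 1) (E q) b) \<in> null_sets lebesgue"
      unfolding negligible_iff_null_sets[symmetric] using le E1 sets\<nu> by (intro negligible_vitali_density[where q=q]) auto
  next
    fix q b :: real assume "q \<in> {q\<in>\<rat>. 0 < q \<and> q < 1}" "b \<in> {b\<in>\<rat>. 1 - q < b}"
    then show "(?B (\<nu> (-1)) (- E q) b) \<in> null_sets lebesgue"
      unfolding negligible_iff_null_sets[symmetric] using le E2 sets\<nu> by (intro negligible_vitali_density[where q="1-q"]) auto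
  qed auto
  moreover have "\<exists>d. ((\<lambda>t. (f (x + t) - f x) / t) \<longlongrightarrow> d) (at 0)" if "x \<notin> N" for x
  proof (rule tendsto_real_dichotomy[where l="-1/2" and u="1/2"])
    have lip: "\<bar>f x - f y\<bar> \<le> \<bar>x - y\<bar> / 2" for x y
      using lipschitz_onD[OF f, of x y] by (simp add: dist_real_def)
    show "\<forall>\<^sub>F t in at 0. - 1 / 2 \<le> (f (x + t) - f x) / t \<and> (f (x + t) - f x) / t \<le> 1 / 2"
    proof (rule eventually_at_filter[THEN iffD2, OF always_eventually], intro allI impI)
      fix t :: real assume "t \<noteq> 0"
      then have "\<bar>(f (x + t) - f x) / t\<bar> \<le> 1/2" using lip[of "x+t" x] by (simp add: field_simps abs_divide)
      then show "- 1 / 2 \<le> (f (x + t) - f x) / t \<and> (f (x + t) - f x) / t \<le> 1 / 2" by linarith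
    qed
    \<comment> \<open>The mean density of \<open>\<nu> s\<close> on the interval between
      \<open>x\<close> and \<open>x + t\<close> is \<open>1/2 + s * ((f (x + t) - f x) / t)\<close>,
      hence the shift by \<open>1/2\<close>.\<close>
    have key: "\<forall>\<^sub>F t in at 0. s * ((f (x + t) - f x) / t) \<le> b - 1/2"
      if nb: "\<not> (\<forall>d>0. \<exists>c \<rho>. 0 < \<rho> \<and> \<rho> < d \<and> x \<in> cball c \<rho> \<and>
            ennreal b * emeasure lborel (cball c \<rho>) < emeasure (\<nu> s) (cball c \<rho>))" and s: "s \<in> {1,-1}" and b: "0 < b" for b s
    proof -
      obtain d where d: "d > 0" "\<And>c \<rho>. 0 < \<rho> \<Longrightarrow> \<rho> < d \<Longrightarrow> x \<in> cball c \<rho> \<Longrightarrow>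
         emeasure (\<nu> s) (cball c \<rho>) \<le> ennreal b * emeasure lborel (cball c \<rho>)"
        using nb by (metis not_le)
      show ?thesis
        unfolding eventually_at
      proof (intro exI[of _ d] conjI ballI impI)
        fix t :: real assume t: "t \<noteq> 0 \<and> dist t 0 < d"
        \<comment> \<open>The ball is exactly the interval between \<open>x\<close> and
          \<open>x + t\<close>, with \<open>x\<close> as an end point, for either sign of
          \<open>t\<close>.\<close>
        define \<rho> where "\<rho> = \<bar>t\<bar>/2"
        define c where "c = x + t/2"
        have \<rho>: "0 < \<rho>" "\<rho> < d" using t by (auto simp: \<rho>_def)
        have "x \<in> cball c \<rho>" by (simp add: c_def \<rho>_def dist_real_def)
        then have "emeasure (\<nu> s) (cball c \<rho>) \<le> ennreal b * emeasure lborel (cball c \<rho>)" using d \<rho> by auto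
        also have "emeasure lborel (cball c \<rho>) = ennreal (2*\<rho>)"
          using \<rho> by (simp add: cball_eq_atLeastAtMost)
        finally have "ennreal (\<rho> + s * (f (c+\<rho>) - f (c-\<rho>))) \<le> ennreal (b * (2*\<rho>))"
          using \<rho> b s by (simp add: cb ennreal_mult)
        then have *: "\<rho> + s * (f (c+\<rho>) - f (c-\<rho>)) \<le> b * (2*\<rho>)"
          using \<rho> b by (subst (asm) ennreal_le_iff) auto
        show "s * ((f (x + t) - f x) / t) \<le> b - 1/2"
        proof (cases "t > 0")
          case True
          then have eqs: "c + \<rho> = x + t" "c - \<rho> = x" "\<rho> = t/2" by (auto simp: c_def \<rho>_def)
          show ?thesis using *[unfolded eqs(1,2), unfolded eqs(3)] True by (simp add: field_simps)
        next
          case False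
          then have "t < 0" using t by auto
          then have eqs: "c + \<rho> = x" "c - \<rho> = x + t" "\<rho> = - t/2" by (auto simp: c_def \<rho>_def)
          show ?thesis using *[unfolded eqs(1,2), unfolded eqs(3)] \<open>t < 0\<close> by (simp add: field_simps)
        qed
      qed (use d in auto)
    qed
    fix q' :: real assume q': "q' \<in> \<rat>" "-1/2 < q'" "q' < 1/2"
    define q where "q = q' + 1/2"
    have q: "q \<in> \<rat>" "0 < q" "q < 1" using q' by (auto simp: q_def)
    show "(\<forall>b\<in>\<rat>. q' < b \<longrightarrow> (\<forall>\<^sub>F t in at 0. (f (x + t) - f x) / t \<le> b)) \<or>
          (\<forall>b\<in>\<rat>. b < q' \<longrightarrow> (\<forall>\<^sub>F t in at 0. b \<le> (f (x + t) - f x) / t))"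
    proof (cases "x \<in> E q")
      case True
      have "\<forall>\<^sub>F t in at 0. (f (x + t) - f x) / t \<le> b'" if "b' \<in> \<rat>" "q' < b'" for b'
      proof -
        have b: "b' + 1/2 \<in> \<rat>" "q < b' + 1/2" "0 < b' + 1/2" using that q by (auto simp: q_def)
        then have "x \<notin> ?B (\<nu> 1) (E q) (b' + 1/2)" using \<open>x \<notin> N\<close> q unfolding N_def by blast
        then show ?thesis using key[of "b'+1/2" 1] True b by simp
      qed
      then show ?thesis by blast
    next
      case False
      have "\<forall>\<^sub>F t in at 0. b' \<le> (f (x + t) - f x) / t" if "b' \<in> \<rat>" "b' < q'" for b'
      proof -
        have b: "1/2 - b' \<in> \<rat>" "1 - q < 1/2 - b'" "0 < 1/2 - b'" using that q by (auto simp: q_def)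
        then have "x \<notin> ?B (\<nu> (-1)) (- E q) (1/2 - b')" using \<open>x \<notin> N\<close> q unfolding N_def by blast
        then have "\<forall>\<^sub>F t in at 0. (-1) * ((f (x + t) - f x) / t) \<le> (1/2 - b') - 1/2"
          using False b by (intro key) auto
        then show ?thesis by (rule eventually_mono) linarith
      qed
      then show ?thesis by blast
    qed
  qed auto
  ultimately show ?thesis by (elim negligible_subset) blast
qed

lemma lipschitz_AE_differentiable_real:
  fixes f :: "real \<Rightarrow> real"
  assumes f: "L-lipschitz_on UNIV f"
  shows "AE x in lebesgue. \<exists>d. ((\<lambda>t. (f (x + t) - f x) / t) \<longlongrightarrow> d) (at 0)"
proof -
  \<comment> \<open>\<open>L / c < 1/2\<close>, and the summand 1 keeps \<open>c\<close> positive
    when \<open>L = 0\<close>.\<close>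
  define c where "c = 2 * L + 1"
  have c: "c > 0" using lipschitz_on_nonneg[OF f] by (simp add: c_def)
  define g where "g x = f x / c" for x
  have "(1/2)-lipschitz_on UNIV g"
  proof (rule lipschitz_onI)
    fix x y :: real
    have "\<bar>f x - f y\<bar> \<le> L * \<bar>x - y\<bar>" using lipschitz_onD[OF f, of x y] by (simp add: dist_real_def)
    also have "\<dots> \<le> (c/2) * \<bar>x - y\<bar>" by (intro mult_right_mono) (auto simp: c_def)
    finally show "dist (g x) (g y) \<le> 1 / 2 * dist x y"
      using c by (simp add: g_def dist_real_def field_simps flip: diff_divide_distrib)
  qed auto
  then have "negligible {x. \<not> (\<exists>d. ((\<lambda>t. (g (x + t) - g x) / t) \<longlongrightarrow> d) (at 0))}"
    by (rule lipschitz_half_negligible_nondifferentiable)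
  moreover have "\<exists>d. ((\<lambda>t. (f (x + t) - f x) / t) \<longlongrightarrow> d) (at 0)"
    if "((\<lambda>t. (g (x + t) - g x) / t) \<longlongrightarrow> d) (at 0)" for x d
  proof -
    have "((\<lambda>t. c * ((g (x + t) - g x) / t)) \<longlongrightarrow> c * d) (at 0)" by (intro tendsto_intros that)
    moreover have "(\<lambda>t. c * ((g (x + t) - g x) / t)) = (\<lambda>t. (f (x + t) - f x) / t)"
      using c by (intro ext) (simp add: g_def flip: diff_divide_distrib)
    ultimately show ?thesis by (intro exI[of _ "c * d"]) simp
  qed
  ultimately have "negligible {x. \<not> (\<exists>d. ((\<lambda>t. (f (x + t) - f x) / t) \<longlongrightarrow> d) (at 0))}"
    by (elim negligible_subset) blast
  then show ?thesis unfolding negligible_iff_null_sets by (intro AE_I'[of _ lebesgue]) auto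
qed

subsection \<open>Integration along lines and Lipschitz test functions\<close>

lemma lipschitz_on_borel:
  fixes f :: "'a::metric_space \<Rightarrow> real"
  shows "L-lipschitz_on UNIV f \<Longrightarrow> f \<in> borel_measurable borel"
  by (intro borel_measurable_continuous_onI lipschitz_on_continuous_on)

lemma integrable_indicator_ball:
  fixes c :: "'a::euclidean_space" and C :: real
  shows "integrable lborel (\<lambda>x. C * indicator (ball c R) x)"
  by (intro integrable_mult_right integrable_real_indicator)
    (use emeasure_bounded_finite[OF bounded_ball] in auto)

lemma nn_integral_lborel_translate:
  fixes f :: "'a::euclidean_space \<Rightarrow> ennreal"
  assumes [measurable]: "f \<in> borel_measurable borel"
  shows "(\<integral>\<^sup>+x. f (x + c) \<partial>lborel) = (\<integral>\<^sup>+x. f x \<partial>lborel)"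
proof -
  have "(\<integral>\<^sup>+x. f x \<partial>lborel) = (\<integral>\<^sup>+x. f x \<partial>distr lborel borel ((+) c))" by (simp add: lborel_distr_plus)
  also have "\<dots> = (\<integral>\<^sup>+x. f (c + x) \<partial>lborel)" by (rule nn_integral_distr) auto
  finally show ?thesis by (simp add: add.commute)
qed

lemma lborel_integral_translate:
  fixes f :: "'a::euclidean_space \<Rightarrow> real"
  assumes [measurable]: "f \<in> borel_measurable borel"
  shows "(\<integral>x. f (x + c) \<partial>lborel) = (\<integral>x. f x \<partial>lborel)"
    and "integrable lborel (\<lambda>x. f (x + c)) \<longleftrightarrow> integrable lborel f"
proof -
  have "(\<integral>x. f x \<partial>lborel) = (\<integral>x. f x \<partial>distr lborel borel ((+) c))" by (simp add: lborel_distr_plus)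
  also have "\<dots> = (\<integral>x. f (c + x) \<partial>lborel)" by (rule integral_distr) auto
  finally show "(\<integral>x. f (x + c) \<partial>lborel) = (\<integral>x. f x \<partial>lborel)" by (simp add: add.commute)
  have "integrable lborel f \<longleftrightarrow> integrable (distr lborel borel ((+) c)) f" by (simp add: lborel_distr_plus)
  also have "\<dots> \<longleftrightarrow> integrable lborel (\<lambda>x. f (c + x))" by (rule integrable_distr_eq) auto
  finally show "integrable lborel (\<lambda>x. f (x + c)) \<longleftrightarrow> integrable lborel f" by (simp add: add.commute)
qed

definition unit_slab :: "'a::euclidean_space \<Rightarrow> 'a set" where
  "unit_slab e = {x. 0 \<le> x \<bullet> e \<and> x \<bullet> e \<le> 1}"

lemma unit_slab_borel[measurable]: "unit_slab e \<in> sets borel"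
  unfolding unit_slab_def by measurable

text \<open>Multiply the integrand by the indicator of 0 \<le> x \<bullet> e - s \<le> 1, whose integral in s is 1, and
  translate by s e: this gives the integral over lines without splitting off a hyperplane.\<close>

lemma nn_integral_unit_slab:
  fixes e :: "'a::euclidean_space"
  assumes e: "norm e = 1" and f[measurable]: "f \<in> borel_measurable borel"
  shows "(\<integral>\<^sup>+x. f x \<partial>lborel) = (\<integral>\<^sup>+x. indicator (unit_slab e) x * (\<integral>\<^sup>+s. f (x + s *\<^sub>R e) \<partial>lborel) \<partial>lborel)"
proof -
  have ee: "e \<bullet> e = 1" using e by (simp add: norm_eq_1)
  let ?w = "\<lambda>u::real. indicator {0..1} u :: ennreal"
  have w1: "(\<integral>\<^sup>+s. ?w (x \<bullet> e - s) \<partial>lborel) = 1" for x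
  proof -
    have "(\<integral>\<^sup>+s. ?w (x \<bullet> e - s) \<partial>lborel) = (\<integral>\<^sup>+s. indicator {x \<bullet> e - 1..x \<bullet> e} s \<partial>lborel)"
      by (intro nn_integral_cong) (auto simp: indicator_def)
    then show ?thesis by simp
  qed
  have "(\<integral>\<^sup>+x. f x \<partial>lborel) = (\<integral>\<^sup>+x. (\<integral>\<^sup>+s. f x * ?w (x \<bullet> e - s) \<partial>lborel) \<partial>lborel)"
    by (simp add: nn_integral_cmult w1)
  also have "\<dots> = (\<integral>\<^sup>+s. (\<integral>\<^sup>+x. f x * ?w (x \<bullet> e - s) \<partial>lborel) \<partial>lborel)"
    by (rule lborel_pair.Fubini') measurable
  also have "\<dots> = (\<integral>\<^sup>+s. (\<integral>\<^sup>+x. f (x + s *\<^sub>R e) * ?w (x \<bullet> e) \<partial>lborel) \<partial>lborel)"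
  proof (rule nn_integral_cong)
    fix s :: real
    have "(\<integral>\<^sup>+x. f (x + s *\<^sub>R e) * ?w ((x + s *\<^sub>R e) \<bullet> e - s) \<partial>lborel) = (\<integral>\<^sup>+x. f x * ?w (x \<bullet> e - s) \<partial>lborel)"
      by (rule nn_integral_lborel_translate) measurable
    then show "(\<integral>\<^sup>+x. f x * ?w (x \<bullet> e - s) \<partial>lborel) = (\<integral>\<^sup>+x. f (x + s *\<^sub>R e) * ?w (x \<bullet> e) \<partial>lborel)"
      by (simp add: inner_add_left ee)
  qed
  also have "\<dots> = (\<integral>\<^sup>+x. (\<integral>\<^sup>+s. f (x + s *\<^sub>R e) * ?w (x \<bullet> e) \<partial>lborel) \<partial>lborel)"
    by (rule lborel_pair.Fubini'[symmetric]) measurable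
  also have "\<dots> = (\<integral>\<^sup>+x. indicator (unit_slab e) x * (\<integral>\<^sup>+s. f (x + s *\<^sub>R e) \<partial>lborel) \<partial>lborel)"
    by (intro nn_integral_cong) (auto simp: indicator_def unit_slab_def)
  finally show ?thesis .
qed

text \<open>The line formula in the form of an image measure: Bochner integrals of functions of
  either sign then follow from \<open>integral_distr\<close> and Fubini.\<close>

lemma lborel_eq_distr_unit_slab:
  fixes e :: "'a::euclidean_space"
  assumes e: "norm e = 1"
  shows "lborel = distr (density (lborel \<Otimes>\<^sub>M lborel) (\<lambda>(x, s). indicator (unit_slab e) x)) borel (\<lambda>(x, s::real). x + s *\<^sub>R e)"
    (is "_ = distr ?D _ ?T")
proof (rule measure_eqI)
  fix A :: "'a set" assume "A \<in> sets lborel"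
  then have A[measurable]: "A \<in> sets borel" by simp
  have [measurable]: "?T \<in> measurable (lborel \<Otimes>\<^sub>M lborel) borel" by measurable
  have "emeasure (distr ?D borel ?T) A = (\<integral>\<^sup>+z. indicator A z \<partial>distr ?D borel ?T)"
    by simp
  also have "\<dots> = (\<integral>\<^sup>+z. indicator A (?T z) \<partial>?D)"
    by (rule nn_integral_distr) auto
  also have "\<dots> = (\<integral>\<^sup>+z. (case z of (x,s) \<Rightarrow> indicator (unit_slab e) x) * indicator A (?T z) \<partial>(lborel \<Otimes>\<^sub>M lborel))"
    by (rule nn_integral_density) auto
  also have "\<dots> = (\<integral>\<^sup>+x. (\<integral>\<^sup>+s. indicator (unit_slab e) x * indicator A (x + s *\<^sub>R e) \<partial>lborel) \<partial>lborel)"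
    by (subst lborel.nn_integral_fst[symmetric]) auto
  also have "\<dots> = (\<integral>\<^sup>+x. indicator (unit_slab e) x * (\<integral>\<^sup>+s. indicator A (x + s *\<^sub>R e) \<partial>lborel) \<partial>lborel)"
    by (simp add: nn_integral_cmult)
  also have "\<dots> = (\<integral>\<^sup>+x. indicator A x \<partial>lborel)"
    by (rule nn_integral_unit_slab[OF e, symmetric]) auto
  finally show "emeasure lborel A = emeasure (distr ?D borel ?T) A" by simp
qed simp

lemma integral_unit_slab:
  fixes e :: "'a::euclidean_space" and f :: "'a \<Rightarrow> real"
  assumes e: "norm e = 1" and int: "integrable lborel f"
  shows "(\<integral>x. f x \<partial>lborel) = (\<integral>x. indicator (unit_slab e) x * (\<integral>s. f (x + s *\<^sub>R e) \<partial>lborel) \<partial>lborel)"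
proof -
  have [measurable]: "f \<in> borel_measurable borel" using int by auto
  let ?T = "\<lambda>(x::'a, s::real). x + s *\<^sub>R e"
  let ?D = "density (lborel \<Otimes>\<^sub>M lborel) (\<lambda>z::'a \<times> real. ennreal (indicator (unit_slab e) (fst z)))"
  have L: "lborel = distr ?D borel ?T" using lborel_eq_distr_unit_slab[OF e] by (simp add: ennreal_indicator case_prod_unfold)
  have D: "integrable ?D (\<lambda>z. f (?T z))"
    using int by (subst (asm) L, subst (asm) integrable_distr_eq) auto
  then have I: "integrable (lborel \<Otimes>\<^sub>M lborel) (\<lambda>(x,s). indicator (unit_slab e) x * f (x + s *\<^sub>R e))"
    by (subst (asm) integrable_density) (auto simp: case_prod_unfold)
  have "(\<integral>x. f x \<partial>lborel) = (\<integral>z. f (?T z) \<partial>?D)"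
    by (subst L, rule integral_distr) auto
  also have "\<dots> = (\<integral>z. (case z of (x,s) \<Rightarrow> indicator (unit_slab e) x * f (x + s *\<^sub>R e)) \<partial>(lborel \<Otimes>\<^sub>M lborel))"
    by (subst integral_density) (auto simp: case_prod_unfold)
  also have "\<dots> = (\<integral>x. (\<integral>s. indicator (unit_slab e) x * f (x + s *\<^sub>R e) \<partial>lborel) \<partial>lborel)"
    using lborel_pair.integral_fst'[OF I] by (simp add: case_prod_unfold)
  finally show ?thesis by simp
qed

text \<open>The slab formula for the indicator of the exceptional set, which meets each line in
  direction \<open>e\<close> in a null set. This reduces differentiability in a direction to the
  real line.\<close>

lemma AE_lborel_lines:
  fixes e :: "'a::euclidean_space"
  assumes e: "norm e = 1" and [measurable]: "Measurable.pred borel P"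
    and lines: "\<And>x. AE s in lborel. P (x + s *\<^sub>R e)"
  shows "AE x in lborel. P x"
proof -
  have "(\<integral>\<^sup>+x. indicator {x. \<not> P x} x \<partial>lborel) = (\<integral>\<^sup>+x. indicator (unit_slab e) x * (\<integral>\<^sup>+s. indicator {x. \<not> P x} (x + s *\<^sub>R e) \<partial>lborel) \<partial>lborel)"
    by (rule nn_integral_unit_slab[OF e]) measurable
  also have "(\<lambda>x. \<integral>\<^sup>+s. indicator {x. \<not> P x} (x + s *\<^sub>R e) \<partial>lborel) = (\<lambda>x. 0)"
    using lines by (intro ext, subst nn_integral_0_iff_AE) (auto simp: indicator_def)
  finally have "emeasure lborel {x. \<not> P x} = 0" by simp
  then show ?thesis by (intro AE_I[of _ _ "{x. \<not> P x}"]) auto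
qed

text \<open>For open \<open>X\<close> inside \<open>W\<close> the functions
  \<open>min 1 (k * infdist x (- X))\<close> are Lipschitz and increase to the indicator of
  \<open>X\<close>. The open sets generate the Borel sets and are closed under intersection, and
  finiteness on \<open>W\<close> gives uniqueness. Equality is asked only for Lipschitz functions
  because the divergence identities will provide no others.\<close>

lemma measure_eqI_Lipschitz_tests:
  fixes M N :: "'a::euclidean_space measure"
  assumes M: "sets M = sets borel" and N: "sets N = sets borel"
    and W: "open W" "bounded W" and fin: "emeasure M W < \<infinity>"
    and eq: "\<And>\<phi> L. L-lipschitz_on UNIV \<phi> \<Longrightarrow> (\<And>x. 0 \<le> \<phi> x \<and> \<phi> x \<le> 1) \<Longrightarrow> (\<And>x. x \<notin> W \<Longrightarrow> \<phi> x = 0) \<Longrightarrow>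
        (\<integral>\<^sup>+x. ennreal (\<phi> x) \<partial>M) = (\<integral>\<^sup>+x. ennreal (\<phi> x) \<partial>N)"
  shows "density M (indicator W) = density N (indicator W)"
proof -
  have [measurable]: "W \<in> sets borel" using W by simp
  have op: "emeasure M X = emeasure N X" if X: "open X" "X \<subseteq> W" for X
  proof -
    define \<phi> where "\<phi> k x = min 1 (real k * infdist x (- X))" for k x
    \<comment> \<open>\<open>infdist\<close> to the empty set is 0 by convention, so the complement
      of \<open>X\<close> has to be nonempty.\<close>
    have "bounded X" using X W bounded_subset by blast
    then have ne: "- X \<noteq> {}" by (metis Compl_empty_eq compl_bot_eq double_complement not_bounded_UNIV)
    have inf0: "infdist x (- X) = 0 \<longleftrightarrow> x \<notin> X" for x
      using in_closed_iff_infdist_zero[of "- X" x] X ne by auto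
    have "(real k)-lipschitz_on UNIV (\<phi> k)" for k
    proof (rule lipschitz_onI)
      fix x y
      have "\<bar>infdist x (-X) - infdist y (-X)\<bar> \<le> dist x y" by (rule infdist_triangle_abs)
      then have "real k * \<bar>infdist x (-X) - infdist y (-X)\<bar> \<le> real k * dist x y" by (rule mult_left_mono) simp
      moreover have "dist (\<phi> k x) (\<phi> k y) \<le> \<bar>real k * infdist x (-X) - real k * infdist y (-X)\<bar>"
        unfolding \<phi>_def dist_real_def by linarith
      ultimately show "dist (\<phi> k x) (\<phi> k y) \<le> real k * dist x y"
        by (simp add: abs_mult flip: right_diff_distrib)
    qed simp
    moreover have "0 \<le> \<phi> k x \<and> \<phi> k x \<le> 1" for k x by (simp add: \<phi>_def infdist_nonneg)
    moreover have "\<phi> k x = 0" if "x \<notin> W" for k x using that X inf0[of x] by (auto simp: \<phi>_def)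
    ultimately have eq': "(\<integral>\<^sup>+x. ennreal (\<phi> k x) \<partial>M) = (\<integral>\<^sup>+x. ennreal (\<phi> k x) \<partial>N)" for k by (intro eq) auto
    have lim: "(\<lambda>k. \<integral>\<^sup>+x. ennreal (\<phi> k x) \<partial>Q) \<longlonglongrightarrow> (\<integral>\<^sup>+x. indicator X x \<partial>Q)" if Q: "sets Q = sets borel" for Q
    proof (rule nn_integral_LIMSEQ)
      show "incseq (\<lambda>k x. ennreal (\<phi> k x))"
        unfolding \<phi>_def by (intro incseq_SucI le_funI ennreal_leI min.mono order_refl mult_right_mono infdist_nonneg) auto
      have [measurable]: "\<phi> k \<in> borel_measurable borel" for k
        unfolding \<phi>_def by (intro borel_measurable_continuous_onI continuous_intros)
      show "(\<lambda>x. ennreal (\<phi> k x)) \<in> borel_measurable Q" for k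
        by (subst measurable_cong_sets[OF Q refl]) measurable
      show "(\<lambda>k. ennreal (\<phi> k x)) \<longlonglongrightarrow> indicator X x" for x
      proof (cases "x \<in> X")
        case True
        then have d: "infdist x (-X) > 0" using inf0[of x] infdist_nonneg[of x "-X"] by (simp add: less_le)
        obtain n where n: "real n * infdist x (-X) > 1" using reals_Archimedean3[OF d] by blast
        have "eventually (\<lambda>k. ennreal (\<phi> k x) = indicator X x) sequentially"
          unfolding eventually_sequentially
        proof (intro exI allI impI)
          fix k assume "n \<le> k"
          then have "real n * infdist x (-X) \<le> real k * infdist x (-X)" by (intro mult_right_mono infdist_nonneg) auto
          then show "ennreal (\<phi> k x) = indicator X x" using n True by (simp add: \<phi>_def)
        qed
        then show ?thesis by (rule tendsto_eventually)
      next
        case False then show ?thesis using inf0[of x] by (simp add: \<phi>_def)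
      qed
    qed
    have "(\<integral>\<^sup>+x. indicator X x \<partial>M) = (\<integral>\<^sup>+x. indicator X x \<partial>N)"
      using lim[OF M] lim[OF N] LIMSEQ_unique unfolding eq' by blast
    then show ?thesis using X M N by simp
  qed
  have d: "emeasure (density Q (indicator W)) X = emeasure Q (W \<inter> X)" if "sets Q = sets borel" "X \<in> sets borel" for Q X
    using that by (subst emeasure_density) (auto simp: measurable_cong_sets[OF that(1) refl] simp flip: indicator_inter_arith)
  show ?thesis
  proof (rule measure_eqI_generator_eq[where E="{S. open S}" and \<Omega>=UNIV and A="\<lambda>_. UNIV"])
    show "Int_stable {S. open S}" by (auto simp: Int_stable_def)
    show "emeasure (density M (indicator W)) X = emeasure (density N (indicator W)) X" if "X \<in> {S. open S}" for X
      using that W op[of "W \<inter> X"] d M N by auto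
    show "emeasure (density M (indicator W)) UNIV \<noteq> \<infinity>" using fin d[OF M] by auto
  qed (auto simp: M N borel_def)
qed

subsection \<open>The theorem of Rademacher\<close>

definition has_dir_deriv :: "('a::real_normed_vector \<Rightarrow> real) \<Rightarrow> 'a \<Rightarrow> 'a \<Rightarrow> real \<Rightarrow> bool" where
  "has_dir_deriv f v x d \<longleftrightarrow> ((\<lambda>t. (f (x + t *\<^sub>R v) - f x) / t) \<longlongrightarrow> d) (at 0)"

text \<open>The limit is taken along the sequence 1/(k+1) so that the function is Borel measurable
  everywhere; it is arbitrary where that limit does not exist.\<close>

definition dir_deriv :: "('a::real_normed_vector \<Rightarrow> real) \<Rightarrow> 'a \<Rightarrow> 'a \<Rightarrow> real" where
  "dir_deriv f v x = lim (\<lambda>k. real (Suc k) * (f (x + (1 / real (Suc k)) *\<^sub>R v) - f x))"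

lemma has_derivative_has_dir_deriv:
  assumes "(f has_derivative f') (at x)" shows "has_dir_deriv f v x (f' v)"
proof -
  interpret f': bounded_linear f' using assms by (rule has_derivative_bounded_linear)
  have "((\<lambda>t. f (x + t *\<^sub>R v)) has_derivative (\<lambda>t. f' (t *\<^sub>R v))) (at 0)"
    by (rule has_derivative_compose[where f="\<lambda>t. x + t *\<^sub>R v" and g=f and g'=f'])
      (use assms in \<open>auto intro!: derivative_eq_intros\<close>)
  then have "((\<lambda>t. f (x + t *\<^sub>R v)) has_real_derivative (f' v)) (at 0)"
    unfolding has_field_derivative_def by (simp add: f'.scaleR mult_commute_abs)
  then show ?thesis unfolding has_dir_deriv_def DERIV_def by simp
qed

lemma GDERIV_has_dir_deriv: "GDERIV f x :> D \<Longrightarrow> has_dir_deriv f v x (v \<bullet> D)"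
  unfolding gderiv_def by (rule has_derivative_has_dir_deriv)

lemma inverse_Suc_filterlim_at: "filterlim (\<lambda>k. c / real (Suc k)) (at 0) sequentially" if "c \<noteq> 0" for c :: real
proof -
  have "(\<lambda>k. c * (1 / real (Suc k))) \<longlonglongrightarrow> c * 0"
    by (intro tendsto_intros LIMSEQ_Suc[OF lim_1_over_n])
  then show ?thesis using that unfolding filterlim_at by auto
qed

lemma has_dir_deriv_LIMSEQ:
  assumes "has_dir_deriv f v x d"
  shows "(\<lambda>k. real (Suc k) * (f (x + (1 / real (Suc k)) *\<^sub>R v) - f x)) \<longlonglongrightarrow> d"
    and "(\<lambda>k. real (Suc k) * (f x - f (x - (1 / real (Suc k)) *\<^sub>R v))) \<longlonglongrightarrow> d"
proof -
  have "(\<lambda>k. (f (x + (1 / real (Suc k)) *\<^sub>R v) - f x) / (1 / real (Suc k))) \<longlonglongrightarrow> d"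
    using filterlim_compose[OF assms[unfolded has_dir_deriv_def] inverse_Suc_filterlim_at[of 1]] by simp
  then show "(\<lambda>k. real (Suc k) * (f (x + (1 / real (Suc k)) *\<^sub>R v) - f x)) \<longlonglongrightarrow> d"
    by (simp add: mult.commute)
  have "(\<lambda>k. (f (x + (-1 / real (Suc k)) *\<^sub>R v) - f x) / (-1 / real (Suc k))) \<longlonglongrightarrow> d"
    using filterlim_compose[OF assms[unfolded has_dir_deriv_def] inverse_Suc_filterlim_at[of "-1"]] by simp
  moreover have "(f (x + (-1 / real (Suc k)) *\<^sub>R v) - f x) / (-1 / real (Suc k)) =
      real (Suc k) * (f x - f (x - (1 / real (Suc k)) *\<^sub>R v))" for k
    by (simp add: algebra_simps del: of_nat_Suc)
  ultimately show "(\<lambda>k. real (Suc k) * (f x - f (x - (1 / real (Suc k)) *\<^sub>R v))) \<longlonglongrightarrow> d" by simp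
qed

lemma dir_deriv_eq: "has_dir_deriv f v x d \<Longrightarrow> dir_deriv f v x = d"
  unfolding dir_deriv_def by (intro limI has_dir_deriv_LIMSEQ)

lemma dir_deriv_LIMSEQ:
  assumes "\<exists>d. has_dir_deriv f v x d"
  shows "(\<lambda>k. real (Suc k) * (f (x + (1 / real (Suc k)) *\<^sub>R v) - f x)) \<longlonglongrightarrow> dir_deriv f v x"
    and "(\<lambda>k. real (Suc k) * (f x - f (x - (1 / real (Suc k)) *\<^sub>R v))) \<longlonglongrightarrow> dir_deriv f v x"
  using assms has_dir_deriv_LIMSEQ dir_deriv_eq by blast+

lemma has_dir_deriv_dir_deriv: "(\<exists>d. has_dir_deriv f v x d) \<Longrightarrow> has_dir_deriv f v x (dir_deriv f v x)"
  using dir_deriv_eq by blast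

lemma dir_deriv_borel[measurable]:
  fixes f :: "'a::euclidean_space \<Rightarrow> real"
  assumes [measurable]: "f \<in> borel_measurable borel"
  shows "dir_deriv f v \<in> borel_measurable borel"
  unfolding dir_deriv_def by (rule borel_measurable_lim_metric) measurable

lemma lipschitz_diff_quotient_bound:
  fixes f :: "'a::real_normed_vector \<Rightarrow> real"
  assumes f: "L-lipschitz_on UNIV f"
  shows "\<bar>(f (x + t *\<^sub>R v) - f x) / t\<bar> \<le> L * norm v"
proof (cases "t = 0")
  case True then show ?thesis using lipschitz_on_nonneg[OF f] by simp
next
  case False
  have "\<bar>f (x + t *\<^sub>R v) - f x\<bar> \<le> L * (\<bar>t\<bar> * norm v)"
    using lipschitz_onD[OF f, of "x + t *\<^sub>R v" x] by (simp add: dist_norm)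
  then show ?thesis using False by (simp add: abs_divide field_simps)
qed

lemma lipschitz_diff_quotient_Suc_bound:
  fixes f :: "'a::real_normed_vector \<Rightarrow> real"
  assumes f: "L-lipschitz_on UNIV f"
  shows "\<bar>real (Suc k) * (f (x + (1 / real (Suc k)) *\<^sub>R v) - f x)\<bar> \<le> L * norm v"
    and "\<bar>real (Suc k) * (f x - f (x - (1 / real (Suc k)) *\<^sub>R v))\<bar> \<le> L * norm v"
  using lipschitz_diff_quotient_bound[OF f, of x "1/real (Suc k)" v]
    lipschitz_diff_quotient_bound[OF f, of x "-1/real (Suc k)" v]
  by (simp_all add: mult.commute abs_minus_commute abs_mult del: of_nat_Suc)

lemma dir_deriv_bound:
  fixes f :: "'a::real_normed_vector \<Rightarrow> real"
  assumes f: "L-lipschitz_on UNIV f" and "\<exists>d. has_dir_deriv f v x d"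
  shows "\<bar>dir_deriv f v x\<bar> \<le> L * norm v"
  using tendsto_rabs[OF dir_deriv_LIMSEQ(1)[OF assms(2)]]
  by (rule tendsto_upperbound) (use lipschitz_diff_quotient_Suc_bound[OF f] in auto)

text \<open>By the Cauchy criterion the set is a countable intersection of countable unions of the
  sets \<open>C n m\<close>. These are closed, since for fixed \<open>t\<close> the difference
  quotient is continuous in \<open>x\<close>.\<close>

lemma sets_has_dir_deriv[measurable]:
  fixes f :: "'a::euclidean_space \<Rightarrow> real"
  assumes f: "L-lipschitz_on UNIV f"
  shows "Measurable.pred borel (\<lambda>x. \<exists>d. has_dir_deriv f v x d)"
proof -
  have cf: "continuous_on UNIV f" using f lipschitz_on_continuous_on by blast
  let ?q = "\<lambda>x t. (f (x + t *\<^sub>R v) - f x) / t"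
  define C where "C n m = {x. \<forall>s t. s \<noteq> 0 \<and> \<bar>s\<bar> < 1 / real (Suc m) \<and> t \<noteq> 0 \<and> \<bar>t\<bar> < 1 / real (Suc m) \<longrightarrow> \<bar>?q x s - ?q x t\<bar> \<le> 1 / real (Suc n)}" for n m
  have cq: "continuous_on UNIV (\<lambda>x. ?q x t)" for t
    by (cases "t = 0") (auto intro!: continuous_intros continuous_on_compose2[OF cf])
  have clo: "closed (C n m)" for n m
    unfolding C_def
    by (intro closed_Collect_all closed_Collect_imp open_Collect_const closed_Collect_le
        continuous_on_rabs continuous_on_diff continuous_on_const cq)
  have eq: "(\<exists>d. has_dir_deriv f v x d) \<longleftrightarrow> (\<forall>n. \<exists>m. x \<in> C n m)" for x
  proof -
    have "(\<exists>d. has_dir_deriv f v x d) \<longleftrightarrow> cauchy_filter (filtermap (?q x) (at 0))"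
      unfolding has_dir_deriv_def filterlim_def
      using cauchy_filter_complete_converges[OF _ complete_UNIV, of "filtermap (?q x) (at 0)"]
      by (auto intro: nhds_imp_cauchy_filter simp: filtermap_bot_iff)
    also have "\<dots> \<longleftrightarrow> (\<forall>e>0. \<exists>P. eventually P (at 0) \<and> (\<forall>s t. P s \<and> P t \<longrightarrow> dist (?q x s) (?q x t) < e))"
      by (rule cauchy_filter_metric_filtermap)
    also have "\<dots> \<longleftrightarrow> (\<forall>n. \<exists>m. x \<in> C n m)"
    proof (intro iffI allI impI)
      fix n assume H: "\<forall>e>0. \<exists>P. eventually P (at 0) \<and> (\<forall>s t. P s \<and> P t \<longrightarrow> dist (?q x s) (?q x t) < e)"
      have "1 / real (Suc n) > 0" by simp
      then obtain P where P: "eventually P (at 0)" "\<And>s t. P s \<Longrightarrow> P t \<Longrightarrow> dist (?q x s) (?q x t) < 1 / real (Suc n)"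
        using H by blast
      obtain \<delta> where \<delta>: "\<delta> > 0" "\<And>t. t \<noteq> 0 \<Longrightarrow> \<bar>t\<bar> < \<delta> \<Longrightarrow> P t"
        using P(1) unfolding eventually_at by (auto simp: dist_real_def)
      obtain m where "1 / real (Suc m) < \<delta>" using nat_approx_posE[OF \<delta>(1)] .
      then have "x \<in> C n m"
        using P(2) \<delta>(2) unfolding C_def dist_real_def by (force intro: less_imp_le)
      then show "\<exists>m. x \<in> C n m" ..
    next
      fix e :: real assume H: "\<forall>n. \<exists>m. x \<in> C n m" and "e > 0"
      obtain n where n: "1 / real (Suc n) < e" using nat_approx_posE[OF \<open>e > 0\<close>] .
      obtain m where m: "x \<in> C n m" using H by blast
      let ?P = "\<lambda>t. t \<noteq> 0 \<and> \<bar>t\<bar> < 1 / real (Suc m)"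
      have "eventually ?P (at 0)"
        unfolding eventually_at by (intro exI[of _ "1 / real (Suc m)"]) (simp add: dist_real_def)
      moreover have "dist (?q x s) (?q x t) < e" if "?P s" "?P t" for s t
        using m n that unfolding C_def dist_real_def by force
      ultimately show "\<exists>P. eventually P (at 0) \<and> (\<forall>s t. P s \<and> P t \<longrightarrow> dist (?q x s) (?q x t) < e)"
        by blast
    qed
    finally show ?thesis .
  qed
  have "{x. \<exists>d. has_dir_deriv f v x d} = (\<Inter>n. \<Union>m. C n m)" using eq by auto
  also have "\<dots> \<in> sets borel" using clo by (intro sets.countable_INT sets.countable_UN) (auto intro: borel_closed)
  finally show ?thesis by (simp add: pred_def)
qed

lemma has_dir_deriv_scale:
  assumes "has_dir_deriv f v x d" shows "has_dir_deriv f (c *\<^sub>R v) x (c * d)"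
proof (cases "c = 0")
  case True then show ?thesis by (simp add: has_dir_deriv_def)
next
  case False
  have "filterlim (\<lambda>t::real. t * c) (at 0) (at 0)"
    unfolding filterlim_at using False
    by (auto simp: eventually_at_filter intro!: tendsto_eq_intros)
  from filterlim_compose[OF assms[unfolded has_dir_deriv_def] this]
  have "((\<lambda>t. c * ((f (x + (t * c) *\<^sub>R v) - f x) / (t * c))) \<longlongrightarrow> c * d) (at 0)" by (intro tendsto_intros)
  then show ?thesis using False by (simp add: has_dir_deriv_def)
qed

text \<open>On every line in direction \<open>v\<close> the function is Lipschitz in one real
  variable; Fubini applies because the set where the derivative exists is Borel. Normalizing
  \<open>v\<close> gives the unit speed that the line formula expects.\<close>

lemma lipschitz_AE_has_dir_deriv:
  fixes f :: "'a::euclidean_space \<Rightarrow> real"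
  assumes f: "L-lipschitz_on UNIV f"
  shows "AE x in lborel. \<exists>d. has_dir_deriv f v x d"
proof (cases "v = 0")
  case True
  then have "has_dir_deriv f v x 0" for x by (simp add: has_dir_deriv_def)
  then show ?thesis by blast
next
  case False
  define e where "e = v /\<^sub>R norm v"
  have e: "norm e = 1" "v = norm v *\<^sub>R e" using False by (auto simp: e_def)
  have "AE x in lborel. \<exists>d. has_dir_deriv f e x d"
  proof (rule AE_lborel_lines[OF e(1)])
    show "AE s in lborel. \<exists>d. has_dir_deriv f e (x + s *\<^sub>R e) d" for x
    proof -
      have "L-lipschitz_on UNIV (\<lambda>s. f (x + s *\<^sub>R e))"
      proof (rule lipschitz_onI)
        fix s t :: real
        have "dist (f (x + s *\<^sub>R e)) (f (x + t *\<^sub>R e)) \<le> L * dist (x + s *\<^sub>R e) (x + t *\<^sub>R e)"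
          using lipschitz_onD[OF f] by blast
        also have "dist (x + s *\<^sub>R e) (x + t *\<^sub>R e) = dist s t"
          using e by (simp add: dist_norm flip: scaleR_diff_left)
        finally show "dist (f (x + s *\<^sub>R e)) (f (x + t *\<^sub>R e)) \<le> L * dist s t" .
      qed (use lipschitz_on_nonneg[OF f] in auto)
      from lipschitz_AE_differentiable_real[OF this] show ?thesis
        by (simp add: AE_completion_iff has_dir_deriv_def scaleR_add_left add.assoc)
    qed
  qed (rule sets_has_dir_deriv[OF f])
  then show ?thesis by (rule AE_mp) (use has_dir_deriv_scale[of f e _ _ "norm v"] e(2) in auto)
qed

lemma integrable_bounded_support:
  fixes f :: "'a::euclidean_space \<Rightarrow> real"
  assumes [measurable]: "f \<in> borel_measurable borel" and "\<And>x. \<bar>f x\<bar> \<le> C" and "\<And>x. x \<notin> ball 0 R \<Longrightarrow> f x = 0"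
  shows "integrable lborel f"
proof (rule Bochner_Integration.integrable_bound[where f="\<lambda>x. C * indicator (ball 0 R) x"])
  show "integrable lborel (\<lambda>x. C * indicator (ball 0 R) x :: real)"
    by (rule integrable_indicator_ball)
  show "AE x in lborel. norm (f x) \<le> norm (C * indicator (ball 0 R) x)"
  proof (rule AE_I2)
    fix x show "norm (f x) \<le> norm (C * indicator (ball 0 R) x)"
      using assms(2)[of x] assms(3)[of x] by (cases "x \<in> ball 0 R") (auto simp del: mem_ball)
  qed
qed auto

text \<open>Adding the bound \<open>C\<close> makes \<open>u\<close> a nonnegative density. The
  measures with densities \<open>u + C\<close> and \<open>C\<close> agree on test functions, hence
  on every ball, and densities are unique almost everywhere.\<close>

lemma AE_eq_0_Lipschitz_tests:
  fixes u :: "'a::euclidean_space \<Rightarrow> real"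
  assumes u[measurable]: "u \<in> borel_measurable borel" and bnd: "AE x in lborel. \<bar>u x\<bar> \<le> C"
    and test: "\<And>\<phi> L R. L-lipschitz_on UNIV \<phi> \<Longrightarrow> (\<And>x. 0 \<le> \<phi> x \<and> \<phi> x \<le> 1) \<Longrightarrow> (\<And>x. x \<notin> ball 0 R \<Longrightarrow> \<phi> x = 0) \<Longrightarrow>
       (\<integral>x. \<phi> x * u x \<partial>lborel) = 0"
  shows "AE x in lborel. u x = 0"
proof -
  define M where "M = density lborel (\<lambda>x. ennreal (u x + C))"
  define N where "N = density lborel (\<lambda>x::'a. ennreal C)"
  have "AE x in lborel. x \<in> ball 0 (real n) \<longrightarrow> u x = 0" for n
  proof -
    let ?W = "ball 0 (real n) :: 'a set"
    have "density M (indicator ?W) = density N (indicator ?W)"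
    proof (rule measure_eqI_Lipschitz_tests)
      have "emeasure M ?W = (\<integral>\<^sup>+x. ennreal (u x + C) * indicator ?W x \<partial>lborel)"
        unfolding M_def by (rule emeasure_density) auto
      also have "\<dots> \<le> (\<integral>\<^sup>+x. ennreal (2 * C) * indicator ?W x \<partial>lborel)"
        using bnd by (intro nn_integral_mono_AE) (auto elim!: eventually_mono simp: indicator_def intro!: ennreal_leI)
      also have "\<dots> = ennreal (2 * C) * emeasure lborel ?W" by (rule nn_integral_cmult_indicator) auto
      also have "\<dots> < \<infinity>" using emeasure_bounded_finite[of ?W] by (simp add: ennreal_mult_less_top)
      finally show "emeasure M ?W < \<infinity>" .
      fix \<phi> :: "'a \<Rightarrow> real" and L
      assume \<phi>: "L-lipschitz_on UNIV \<phi>" "\<And>x. 0 \<le> \<phi> x \<and> \<phi> x \<le> 1" "\<And>x. x \<notin> ?W \<Longrightarrow> \<phi> x = 0"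
      have [measurable]: "\<phi> \<in> borel_measurable borel"
        using \<phi>(1) by (intro lipschitz_on_borel)
      have i\<phi>: "integrable lborel \<phi>" using \<phi> by (intro integrable_bounded_support[of _ 1 "real n"]) auto
      have iu: "integrable lborel (\<lambda>x. \<phi> x * u x)"
      proof (rule Bochner_Integration.integrable_bound[where f="\<lambda>x. C * \<phi> x"])
        show "AE x in lborel. norm (\<phi> x * u x) \<le> norm (C * \<phi> x)"
          using bnd
        proof eventually_elim
          case (elim x)
          then have "0 \<le> C" by linarith
          moreover have "\<phi> x * \<bar>u x\<bar> \<le> \<phi> x * C" using \<phi>(2) elim by (intro mult_left_mono) auto
          ultimately show ?case using \<phi>(2)[of x] by (simp add: abs_mult mult.commute)
        qed
      qed (use i\<phi> in auto)
      have nn: "AE x in lborel. 0 \<le> \<phi> x * (u x + C)"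
        using bnd by eventually_elim (use \<phi>(2) in \<open>auto intro!: mult_nonneg_nonneg\<close>)
      have "(\<integral>\<^sup>+x. ennreal (\<phi> x) \<partial>M) = (\<integral>\<^sup>+x. ennreal (u x + C) * ennreal (\<phi> x) \<partial>lborel)"
        unfolding M_def by (rule nn_integral_density) auto
      also have "\<dots> = (\<integral>\<^sup>+x. ennreal (\<phi> x * (u x + C)) \<partial>lborel)"
        using \<phi>(2) by (intro nn_integral_cong, subst mult.commute) (simp add: ennreal_mult')
      also have "\<dots> = ennreal (\<integral>x. \<phi> x * (u x + C) \<partial>lborel)"
        using iu i\<phi> nn by (intro nn_integral_eq_integral) (auto simp: distrib_left)
      also have "(\<integral>x. \<phi> x * (u x + C) \<partial>lborel) = (\<integral>x. \<phi> x * u x \<partial>lborel) + (\<integral>x. \<phi> x * C \<partial>lborel)"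
        using iu i\<phi> by (simp add: distrib_left)
      also have "(\<integral>x. \<phi> x * u x \<partial>lborel) = 0" using \<phi> by (intro test) auto
      also have "ennreal (0 + (\<integral>x. \<phi> x * C \<partial>lborel)) = (\<integral>\<^sup>+x. ennreal (\<phi> x * C) \<partial>lborel)"
      proof -
        have "AE x in lborel. 0 \<le> \<phi> x * C" using bnd by eventually_elim (use \<phi>(2) in auto)
        then show ?thesis using i\<phi> by (subst nn_integral_eq_integral) auto
      qed
      also have "\<dots> = (\<integral>\<^sup>+x. ennreal C * ennreal (\<phi> x) \<partial>lborel)"
        using \<phi>(2) by (intro nn_integral_cong, subst mult.commute) (simp add: ennreal_mult'')
      also have "\<dots> = (\<integral>\<^sup>+x. ennreal (\<phi> x) \<partial>N)"
        unfolding N_def by (rule nn_integral_density[symmetric]) auto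
      finally show "(\<integral>\<^sup>+x. ennreal (\<phi> x) \<partial>M) = (\<integral>\<^sup>+x. ennreal (\<phi> x) \<partial>N)" .
    qed (auto simp: M_def N_def)
    then have "density lborel (\<lambda>x. ennreal (u x + C) * indicator ?W x) = density lborel (\<lambda>x. ennreal C * indicator ?W x)"
      unfolding M_def N_def by (subst (asm) (1 2) density_density_eq) (auto intro!: borel_measurable_indicator)
    then have "AE x in lborel. ennreal (u x + C) * indicator ?W x = ennreal C * indicator ?W x"
      by (intro sigma_finite_measure.density_unique[OF sigma_finite_lborel])
        (auto intro!: borel_measurable_times_ennreal borel_measurable_indicator)
    then show ?thesis using bnd
    proof eventually_elim
      case (elim x)
      then show ?case by (auto simp: indicator_def)
    qed
  qed
  then have "AE x in lborel. \<forall>n. x \<in> ball 0 (real n) \<longrightarrow> u x = 0" unfolding AE_all_countable by blast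
  then show ?thesis
  proof eventually_elim
    case (elim x)
    obtain n where "norm x < real n" using reals_Archimedean2 by blast
    then show ?case using elim by auto
  qed
qed

text \<open>The difference quotient of f in direction v + w at x is the sum of the one in direction w at x
  and the one in direction v at a shifted point; tested against a Lipschitz function, the shift
  moves to the test function and disappears in the limit.\<close>

lemma dir_deriv_add_AE:
  fixes f :: "'a::euclidean_space \<Rightarrow> real"
  assumes f: "L-lipschitz_on UNIV f"
  shows "AE x in lborel. dir_deriv f (v + w) x = dir_deriv f v x + dir_deriv f w x"
proof -
  have [measurable]: "f \<in> borel_measurable borel"
    using f by (intro lipschitz_on_borel)
  define u where "u x = dir_deriv f (v + w) x - (dir_deriv f v x + dir_deriv f w x)" for x
  have [measurable]: "u \<in> borel_measurable borel" unfolding u_def by measurable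
  note ex = lipschitz_AE_has_dir_deriv[OF f]
  have dd: "AE x in lborel. \<bar>dir_deriv f z x\<bar> \<le> L * norm z" for z
    using ex[of z] by eventually_elim (rule dir_deriv_bound[OF f])
  have "AE x in lborel. u x = 0"
  proof (rule AE_eq_0_Lipschitz_tests)
    show "AE x in lborel. \<bar>u x\<bar> \<le> L * norm (v + w) + (L * norm v + L * norm w)"
      using dd[of "v+w"] dd[of v] dd[of w] by eventually_elim (auto simp: u_def)
    fix \<phi> :: "'a \<Rightarrow> real" and K R
    assume \<phi>: "K-lipschitz_on UNIV \<phi>" "\<And>x. 0 \<le> \<phi> x \<and> \<phi> x \<le> 1" "\<And>x. x \<notin> ball 0 R \<Longrightarrow> \<phi> x = 0"
    have c\<phi>: "continuous_on UNIV \<phi>" using \<phi>(1) by (intro lipschitz_on_continuous_on)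
    then have [measurable]: "\<phi> \<in> borel_measurable borel" by (intro borel_measurable_continuous_onI)
    define q where "q z k x = real (Suc k) * (f (x + (1 / real (Suc k)) *\<^sub>R z) - f x)" for z k x
    have q[measurable]: "q z k \<in> borel_measurable borel" for z k unfolding q_def by measurable
    have qb: "\<bar>q z k x\<bar> \<le> L * norm z" for z k x unfolding q_def by (rule lipschitz_diff_quotient_Suc_bound[OF f])
    define a where "a k = (1 / real (Suc k)) *\<^sub>R w" for k
    have "a \<longlonglongrightarrow> 0 *\<^sub>R w" unfolding a_def by (intro tendsto_intros LIMSEQ_Suc[OF lim_1_over_n])
    then have a0: "a \<longlonglongrightarrow> 0" by simp
    have ab: "norm (a k) \<le> norm w" for k unfolding a_def by (simp add: field_simps)
    \<comment> \<open>The ball contains the supports of all translates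
      \<open>\<phi> (x - b k)\<close>, since the shifts have norm at most
      \<open>norm w\<close>.\<close>
    define w0 :: "'a \<Rightarrow> real" where "w0 = indicator (ball 0 (R + norm w))"
    have iw: "integrable lborel (\<lambda>x. c * w0 x)" for c
      unfolding w0_def by (rule integrable_indicator_ball)
    have L0: "L \<ge> 0" using lipschitz_on_nonneg[OF f] .
    have lim: "integrable lborel (\<lambda>x. \<phi> x * dir_deriv f z x)"
         "\<forall>k. integrable lborel (\<lambda>x. \<phi> (x - b k) * q z k x)"
         "(\<lambda>k. \<integral>x. \<phi> (x - b k) * q z k x \<partial>lborel) \<longlonglongrightarrow> (\<integral>x. \<phi> x * dir_deriv f z x \<partial>lborel)"
       if b: "b \<longlonglongrightarrow> 0" "\<And>k. norm (b k) \<le> norm w" for z b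
    proof -
      have bound: "AE x in lborel. norm (\<phi> (x - b k) * q z k x) \<le> (L * norm z) * w0 x" for k
      proof (rule AE_I2)
        fix x :: 'a
        show "norm (\<phi> (x - b k) * q z k x) \<le> (L * norm z) * w0 x"
        proof (cases "x \<in> ball 0 (R + norm w)")
          case True
          have "\<bar>\<phi> (x - b k)\<bar> * \<bar>q z k x\<bar> \<le> 1 * (L * norm z)"
            using \<phi>(2)[of "x - b k"] qb by (intro mult_mono) auto
          then show ?thesis using True by (simp add: w0_def abs_mult)
        next
          case False
          have "norm x \<le> norm (x - b k) + norm (b k)" using norm_triangle_ineq[of "x - b k" "b k"] by simp
          then have "x - b k \<notin> ball 0 R" using False b(2)[of k] by auto
          then show ?thesis using \<phi>(3) L0 by (simp add: w0_def)
        qed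
      qed
      have limit: "AE x in lborel. (\<lambda>k. \<phi> (x - b k) * q z k x) \<longlonglongrightarrow> \<phi> x * dir_deriv f z x"
        using ex[of z]
      proof eventually_elim
        case (elim x)
        have "(\<lambda>k. x - b k) \<longlonglongrightarrow> x - 0" by (intro tendsto_intros b)
        then have "(\<lambda>k. \<phi> (x - b k)) \<longlonglongrightarrow> \<phi> x"
          by (intro continuous_on_tendsto_compose[OF c\<phi>]) auto
        moreover have "(\<lambda>k. q z k x) \<longlonglongrightarrow> dir_deriv f z x" unfolding q_def by (rule dir_deriv_LIMSEQ(1)[OF elim])
        ultimately show ?case by (rule tendsto_mult)
      qed
      show "integrable lborel (\<lambda>x. \<phi> x * dir_deriv f z x)"
        by (rule integrable_dominated_convergence[OF _ _ iw limit bound]) measurable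
      show "\<forall>k. integrable lborel (\<lambda>x. \<phi> (x - b k) * q z k x)"
        by (rule allI, rule integrable_dominated_convergence2[OF _ _ iw limit bound]) measurable
      show "(\<lambda>k. \<integral>x. \<phi> (x - b k) * q z k x \<partial>lborel) \<longlonglongrightarrow> (\<integral>x. \<phi> x * dir_deriv f z x \<partial>lborel)"
        by (rule integral_dominated_convergence[OF _ _ iw limit bound]) measurable
    qed
    have b0: "(\<lambda>k. 0::'a) \<longlonglongrightarrow> 0" "\<And>k::nat. norm (0::'a) \<le> norm w" by auto
    note l1 = lim[where z="v + w", OF b0] and l2 = lim[where z=v, OF a0 ab] and l3 = lim[where z=w, OF b0]
    have step: "(\<integral>x. \<phi> (x - 0) * q (v + w) k x \<partial>lborel) = (\<integral>x. \<phi> (x - a k) * q v k x \<partial>lborel) + (\<integral>x. \<phi> (x - 0) * q w k x \<partial>lborel)" for k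
    proof -
      have "(\<integral>x. \<phi> (x - a k) * q v k x \<partial>lborel) = (\<integral>x. \<phi> (x + a k - a k) * q v k (x + a k) \<partial>lborel)"
        "integrable lborel (\<lambda>x. \<phi> (x + a k - a k) * q v k (x + a k))"
        using lborel_integral_translate[of "\<lambda>x. \<phi> (x - a k) * q v k x" "a k"] l2(2)[rule_format, of k] by auto
      moreover have "\<phi> (x - 0) * q (v + w) k x = \<phi> (x + a k - a k) * q v k (x + a k) + \<phi> (x - 0) * q w k x" for x
        by (simp add: q_def a_def scaleR_add_right algebra_simps del: of_nat_Suc)
      ultimately show ?thesis using l3(2)[rule_format, of k] by simp
    qed
    have "(\<integral>x. \<phi> x * dir_deriv f (v + w) x \<partial>lborel) = (\<integral>x. \<phi> x * dir_deriv f v x \<partial>lborel) + (\<integral>x. \<phi> x * dir_deriv f w x \<partial>lborel)"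
      using l1(3) tendsto_add[OF l2(3) l3(3)] unfolding step by (rule LIMSEQ_unique)
    then show "(\<integral>x. \<phi> x * u x \<partial>lborel) = 0"
      using l1(1) l2(1) l3(1) by (simp add: u_def right_diff_distrib distrib_left)
  qed simp
  then show ?thesis by eventually_elim (simp add: u_def)
qed

text \<open>Unlike \<open>gradient\<close>, which is a definite description, this is a Borel
  function on the whole space. Both agree at points of differentiability.\<close>

definition dgrad :: "('a::euclidean_space \<Rightarrow> real) \<Rightarrow> 'a \<Rightarrow> 'a" where
  "dgrad f x = (\<Sum>b\<in>Basis. dir_deriv f b x *\<^sub>R b)"

lemma dgrad_borel[measurable]:
  fixes f :: "'a::euclidean_space \<Rightarrow> real"
  assumes [measurable]: "f \<in> borel_measurable borel"
  shows "dgrad f \<in> borel_measurable borel"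
  unfolding dgrad_def by measurable

text \<open>Additivity almost everywhere is summed over the basis. The exceptional null set still
  depends on \<open>v\<close>, so only countably many directions can be combined.\<close>

lemma dir_deriv_dgrad_AE:
  fixes f :: "'a::euclidean_space \<Rightarrow> real"
  assumes f: "L-lipschitz_on UNIV f"
  shows "AE x in lborel. has_dir_deriv f v x (v \<bullet> dgrad f x)"
proof -
  have sc: "AE x in lborel. dir_deriv f (c *\<^sub>R b) x = c * dir_deriv f b x" for c b
    using lipschitz_AE_has_dir_deriv[OF f, of b]
    by eventually_elim (metis dir_deriv_eq has_dir_deriv_scale)
  have "AE x in lborel. dir_deriv f (\<Sum>b\<in>B. (v \<bullet> b) *\<^sub>R b) x = (\<Sum>b\<in>B. (v \<bullet> b) * dir_deriv f b x)" if "finite B" for B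
    using that
  proof induction
    case empty
    have "dir_deriv f 0 x = 0" for x by (rule dir_deriv_eq) (simp add: has_dir_deriv_def)
    then show ?case by simp
  next
    case (insert b B)
    from dir_deriv_add_AE[OF f, of "(v \<bullet> b) *\<^sub>R b" "\<Sum>b\<in>B. (v \<bullet> b) *\<^sub>R b"] sc[of "v \<bullet> b" b] insert.IH
    show ?case by eventually_elim (simp add: insert.hyps)
  qed
  from this[OF finite_Basis] lipschitz_AE_has_dir_deriv[OF f, of v]
  show ?thesis
  proof eventually_elim
    case (elim x)
    have "dir_deriv f v x = v \<bullet> dgrad f x"
      using elim(1) by (simp add: euclidean_representation dgrad_def inner_sum_right mult.commute)
    then show ?case using has_dir_deriv_dir_deriv[OF elim(2)] by simp
  qed
qed

text \<open>By compactness finitely many directions of \<open>Q\<close> are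
  \<open>\<eta>\<close>-close to every unit vector, so one radius \<open>d\<close> serves them all.
  The Lipschitz condition carries the estimate from such a direction to its neighbours, which makes
  the expansion uniform in the direction.\<close>

lemma GDERIV_if_dense_dir_deriv:
  fixes f :: "'a::euclidean_space \<Rightarrow> real"
  assumes f: "L-lipschitz_on UNIV f"
    and Q: "\<And>X. open X \<Longrightarrow> X \<noteq> {} \<Longrightarrow> \<exists>d\<in>Q. d \<in> X"
    and dir: "\<forall>v\<in>Q. has_dir_deriv f v x (v \<bullet> G)"
  shows "GDERIV f x :> G"
proof -
  have L0: "L \<ge> 0" using lipschitz_on_nonneg[OF f] .
  show ?thesis
    unfolding gderiv_def has_derivative_at_alt
  proof (intro conjI allI impI)
    show "bounded_linear (\<lambda>h. h \<bullet> G)" by (rule bounded_linear_inner_left)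
    fix e :: real assume e: "e > 0"
    \<comment> \<open>The three errors, from moving the point, from the difference quotient and from
      moving the direction in the linear term, are \<open>L * \<eta>\<close>, \<open>\<eta>\<close>
      and \<open>norm G * \<eta>\<close> per unit of distance; they add up to
      \<open>e\<close>.\<close>
    define \<eta> where "\<eta> = e / (L + 1 + norm G)"
    have den: "L + 1 + norm G > 0" using L0 by (intro add_nonneg_pos add_pos_nonneg) auto
    have \<eta>: "\<eta> > 0" "\<eta> * (L + 1 + norm G) = e" using e den by (auto simp: \<eta>_def)
    have cov: "sphere 0 1 \<subseteq> (\<Union>v\<in>Q. ball v \<eta>)"
    proof
      fix u :: 'a
      have "ball u \<eta> \<noteq> {}" using \<eta> by auto
      then obtain d where "d \<in> Q" "d \<in> ball u \<eta>" using Q[of "ball u \<eta>"] by auto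
      then show "u \<in> (\<Union>v\<in>Q. ball v \<eta>)" by (auto simp: dist_commute)
    qed
    obtain Q' where Q': "Q' \<subseteq> Q" "finite Q'" "sphere 0 1 \<subseteq> (\<Union>v\<in>Q'. ball v \<eta>)"
      by (rule compactE_image[OF _ _ cov]) auto
    have "\<forall>v\<in>Q'. eventually (\<lambda>t. dist ((f (x + t *\<^sub>R v) - f x) / t) (v \<bullet> G) < \<eta>) (at 0)"
      using dir Q' \<eta> unfolding has_dir_deriv_def by (auto dest: tendstoD)
    then have "eventually (\<lambda>t. \<forall>v\<in>Q'. dist ((f (x + t *\<^sub>R v) - f x) / t) (v \<bullet> G) < \<eta>) (at 0)"
      using Q' by (intro eventually_ball_finite)
    then obtain d where d: "d > 0" "\<And>t v. t \<noteq> 0 \<Longrightarrow> \<bar>t\<bar> < d \<Longrightarrow> v \<in> Q' \<Longrightarrow> \<bar>(f (x + t *\<^sub>R v) - f x) / t - v \<bullet> G\<bar> < \<eta>"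
      unfolding eventually_at by (auto simp: dist_real_def)
    show "\<exists>d>0. \<forall>y. norm (y - x) < d \<longrightarrow> norm (f y - f x - (y - x) \<bullet> G) \<le> e * norm (y - x)"
    proof (intro exI[of _ d] conjI allI impI)
      fix y assume y: "norm (y - x) < d"
      show "norm (f y - f x - (y - x) \<bullet> G) \<le> e * norm (y - x)"
      proof (cases "y = x")
        case False
        define t where "t = norm (y - x)"
        define u where "u = (y - x) /\<^sub>R t"
        have t: "t > 0" using False by (simp add: t_def)
        have u: "norm u = 1" "y = x + t *\<^sub>R u" using t by (auto simp: u_def t_def)
        obtain v where v: "v \<in> Q'" "norm (u - v) < \<eta>"
          using Q'(3) u(1) by (force simp: dist_norm norm_minus_commute)
        have "\<bar>(f (x + t *\<^sub>R v) - f x) / t - v \<bullet> G\<bar> < \<eta>" using t y v by (intro d) (auto simp: t_def)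
        then have 1: "\<bar>f (x + t *\<^sub>R v) - f x - t * (v \<bullet> G)\<bar> \<le> t * \<eta>"
          using t by (simp add: abs_if field_simps split: if_splits)
        have "\<bar>f y - f (x + t *\<^sub>R v)\<bar> \<le> L * norm (t *\<^sub>R (u - v))"
          using lipschitz_onD[OF f, of y "x + t *\<^sub>R v"] by (simp add: u dist_norm scaleR_diff_right)
        also have "\<dots> \<le> L * (t * \<eta>)"
          using v t L0 by (intro mult_left_mono) auto
        finally have 2: "\<bar>f y - f (x + t *\<^sub>R v)\<bar> \<le> L * (t * \<eta>)" .
        have "\<bar>t * ((u - v) \<bullet> G)\<bar> \<le> t * (norm (u - v) * norm G)"
          using t Cauchy_Schwarz_ineq2[of "u - v" G] by (simp add: abs_mult)
        also have "\<dots> \<le> t * (\<eta> * norm G)" using v t by (intro mult_left_mono mult_right_mono) auto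
        finally have 3: "\<bar>t * ((u - v) \<bullet> G)\<bar> \<le> t * (\<eta> * norm G)" .
        have "f y - f x - (y - x) \<bullet> G = (f y - f (x + t *\<^sub>R v)) + (f (x + t *\<^sub>R v) - f x - t * (v \<bullet> G)) - t * ((u - v) \<bullet> G)"
          by (simp add: u inner_diff_left algebra_simps)
        then have "\<bar>f y - f x - (y - x) \<bullet> G\<bar> \<le> L * (t * \<eta>) + t * \<eta> + t * (\<eta> * norm G)"
          using 1 2 3 by linarith
        also have "\<dots> = (\<eta> * (L + 1 + norm G)) * t" by (simp add: algebra_simps)
        finally show ?thesis unfolding \<eta>(2) by (simp add: t_def)
      qed simp
    qed (fact d)
  qed
qed

theorem rademacher:
  fixes f :: "'a::euclidean_space \<Rightarrow> real"
  assumes f: "L-lipschitz_on UNIV f"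
  shows "AE x in lborel. GDERIV f x :> dgrad f x"
proof -
  obtain Q :: "'a set" where Q: "countable Q" "\<And>X. open X \<Longrightarrow> X \<noteq> {} \<Longrightarrow> \<exists>d\<in>Q. d \<in> X"
    using countable_dense_exists by blast
  have "AE x in lborel. \<forall>v\<in>Q. has_dir_deriv f v x (v \<bullet> dgrad f x)"
    using dir_deriv_dgrad_AE[OF f] Q(1) by (simp add: AE_ball_countable)
  then show ?thesis by eventually_elim (rule GDERIV_if_dense_dir_deriv[OF f Q(2)])
qed

text \<open>Differentiability with a given gradient amounts to conditions on the directional
  derivatives in countably many dense directions, and each of these is Borel.\<close>

lemma sets_GDERIV:
  fixes f :: "'a::euclidean_space \<Rightarrow> real"
  assumes f: "L-lipschitz_on UNIV f" and G[measurable]: "G \<in> borel_measurable borel"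
  shows "Measurable.pred borel (\<lambda>x. GDERIV f x :> G x)"
proof -
  obtain Q :: "'a set" where Q: "countable Q" "\<And>X. open X \<Longrightarrow> X \<noteq> {} \<Longrightarrow> \<exists>d\<in>Q. d \<in> X"
    using countable_dense_exists by blast
  have [measurable]: "f \<in> borel_measurable borel" by (rule lipschitz_on_borel[OF f])
  note [measurable] = sets_has_dir_deriv[OF f]
  have "GDERIV f x :> G x \<longleftrightarrow> (\<forall>v\<in>Q. (\<exists>d. has_dir_deriv f v x d) \<and> dir_deriv f v x = v \<bullet> G x)" for x
    using GDERIV_has_dir_deriv[of f x "G x"] GDERIV_if_dense_dir_deriv[OF f Q(2), of x "G x"]
      dir_deriv_eq has_dir_deriv_dir_deriv by metis
  moreover have "Measurable.pred borel (\<lambda>x. \<forall>v\<in>Q. (\<exists>d. has_dir_deriv f v x d) \<and> dir_deriv f v x = v \<bullet> G x)"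
    using Q(1) by measurable
  ultimately show ?thesis by simp
qed

subsection \<open>The divergence identity below a Lipschitz graph\<close>

text \<open>The weight \<open>w\<close> is 1 or -1 between the two thresholds and 0 elsewhere. The
  half-line indicators are kept as a difference because neither is integrable alone.\<close>

lemma step_difference_integral:
  fixes \<alpha> \<beta> :: real and \<eta> :: "real \<Rightarrow> real"
  defines "w \<equiv> \<lambda>s. indicator {..<\<beta>} s - indicator {..<\<alpha>} s :: real"
  assumes [measurable]: "\<eta> \<in> borel_measurable borel"
    and bnd: "\<And>s. s \<in> {min \<alpha> \<beta>..max \<alpha> \<beta>} \<Longrightarrow> \<bar>\<eta> s\<bar> \<le> C"
  shows "integrable lborel (\<lambda>s. w s * \<eta> s)" and "\<bar>\<integral>s. w s * \<eta> s \<partial>lborel\<bar> \<le> C * \<bar>\<beta> - \<alpha>\<bar>"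
proof -
  have i: "integrable lborel (\<lambda>s. C * indicator {min \<alpha> \<beta>..max \<alpha> \<beta>} s)"
    by (intro integrable_mult_right integrable_real_indicator) auto
  have C0: "0 \<le> C" using bnd[of \<alpha>] by (auto intro: order_trans[OF abs_ge_zero])
  have le: "norm (w s * \<eta> s) \<le> C * indicator {min \<alpha> \<beta>..max \<alpha> \<beta>} s" for s
    using bnd[of s] C0 by (auto simp: w_def indicator_def abs_mult)
  have [measurable]: "w \<in> borel_measurable borel" unfolding w_def by measurable
  show int: "integrable lborel (\<lambda>s. w s * \<eta> s)"
    by (rule Bochner_Integration.integrable_bound[OF i]) (auto intro!: AE_I2 order_trans[OF le[unfolded real_norm_def] abs_ge_self])
  have "norm (\<integral>s. w s * \<eta> s \<partial>lborel) \<le> (\<integral>s. C * indicator {min \<alpha> \<beta>..max \<alpha> \<beta>} s \<partial>lborel)"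
    by (rule Bochner_Integration.integral_norm_bound_integral[OF int i le])
  also have "\<dots> = C * \<bar>\<beta> - \<alpha>\<bar>" by (auto simp: min_def max_def)
  finally show "\<bar>\<integral>s. w s * \<eta> s \<partial>lborel\<bar> \<le> C * \<bar>\<beta> - \<alpha>\<bar>" by simp
qed

lemma step_difference_integral_const:
  fixes \<alpha> \<beta> c :: real
  shows "(\<integral>s. (indicator {..<\<beta>} s - indicator {..<\<alpha>} s) * c \<partial>lborel) = (\<beta> - \<alpha>) * c"
proof -
  have "(indicator {..<\<beta>} s - indicator {..<\<alpha>} s :: real) = (if \<alpha> \<le> \<beta> then indicator {\<alpha>..<\<beta>} s else - indicator {\<beta>..<\<alpha>} s)" for s
    by (auto simp: indicator_def)
  moreover have "- ((\<alpha> - \<beta>) * c) = (\<beta> - \<alpha>) * c" by (simp add: algebra_simps)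
  ultimately show ?thesis by (cases "\<alpha> \<le> \<beta>") auto
qed

text \<open>Freezing \<open>\<psi>\<close> at \<open>\<alpha>\<close> costs at most
  \<open>K * \<bar>\<beta> - \<alpha>\<bar>\<close> on an interval of length
  \<open>\<bar>\<beta> - \<alpha>\<bar>\<close>. The quadratic error survives division by a step
  width of the same order and still tends to 0.\<close>

lemma step_difference_integral_lipschitz:
  fixes \<alpha> \<beta> :: real and \<psi> :: "real \<Rightarrow> real"
  assumes \<psi>: "K-lipschitz_on UNIV \<psi>"
  shows "\<bar>(\<integral>s. (indicator {..<\<beta>} s - indicator {..<\<alpha>} s) * \<psi> s \<partial>lborel) - (\<beta> - \<alpha>) * \<psi> \<alpha>\<bar> \<le> K * (\<beta> - \<alpha>)\<^sup>2"
proof -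
  let ?w = "\<lambda>s. indicator {..<\<beta>} s - indicator {..<\<alpha>} s :: real"
  have [measurable]: "\<psi> \<in> borel_measurable borel"
    using \<psi> by (intro lipschitz_on_borel)
  have b: "\<bar>\<psi> s - \<psi> \<alpha>\<bar> \<le> K * \<bar>\<beta> - \<alpha>\<bar>" if "s \<in> {min \<alpha> \<beta>..max \<alpha> \<beta>}" for s
  proof -
    have "\<bar>\<psi> s - \<psi> \<alpha>\<bar> \<le> K * \<bar>s - \<alpha>\<bar>" using lipschitz_onD[OF \<psi>, of s \<alpha>] by (simp add: dist_real_def)
    also have "\<dots> \<le> K * \<bar>\<beta> - \<alpha>\<bar>"
      using that lipschitz_on_nonneg[OF \<psi>] by (intro mult_left_mono) (auto simp: min_def max_def split: if_splits)
    finally show ?thesis .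
  qed
  note 1 = step_difference_integral[of "\<lambda>s. \<psi> s - \<psi> \<alpha>" \<alpha> \<beta>, OF _ b]
  have i2: "integrable lborel (\<lambda>s. ?w s * \<psi> \<alpha>)" by (rule step_difference_integral) auto
  have "(\<integral>s. ?w s * \<psi> s \<partial>lborel) = (\<integral>s. ?w s * (\<psi> s - \<psi> \<alpha>) + ?w s * \<psi> \<alpha> \<partial>lborel)"
    by (simp add: right_diff_distrib)
  also have "\<dots> = (\<integral>s. ?w s * (\<psi> s - \<psi> \<alpha>) \<partial>lborel) + (\<integral>s. ?w s * \<psi> \<alpha> \<partial>lborel)"
    by (rule Bochner_Integration.integral_add) (use 1(1) i2 in auto)
  also have "(\<integral>s. ?w s * \<psi> \<alpha> \<partial>lborel) = (\<beta> - \<alpha>) * \<psi> \<alpha>" by (rule step_difference_integral_const)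
  finally have "(\<integral>s. ?w s * \<psi> s \<partial>lborel) - (\<beta> - \<alpha>) * \<psi> \<alpha> = (\<integral>s. ?w s * (\<psi> s - \<psi> \<alpha>) \<partial>lborel)" by simp
  also have "\<bar>\<dots>\<bar> \<le> K * \<bar>\<beta> - \<alpha>\<bar> * \<bar>\<beta> - \<alpha>\<bar>" by (rule 1(2)) auto
  also have "\<dots> = K * (\<beta> - \<alpha>)\<^sup>2" by (simp add: power2_eq_square)
  finally show ?thesis .
qed

text \<open>Removing the component along \<open>e\<close> does not increase the norm, and in the
  slab this component is at most 1. So slab points whose line meets the ball of radius
  \<open>R\<close> about 0 lie in that of radius \<open>R + 1\<close>, which bounds the integrals
  over the slab.\<close>

lemma norm_slab_le:
  fixes e x :: "'a::real_inner"
  assumes e: "norm e = 1" and x: "0 \<le> x \<bullet> e" "x \<bullet> e \<le> 1"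
  shows "norm x \<le> norm (x + s *\<^sub>R e) + 1"
proof -
  define y where "y = x + s *\<^sub>R e"
  have ee: "e \<bullet> e = 1" using e by (simp add: norm_eq_1)
  have 1: "norm (y - (y \<bullet> e) *\<^sub>R e) \<le> norm y"
    unfolding norm_le by (simp add: inner_diff_left inner_diff_right ee inner_commute[of e y])
  have "x = (y - (y \<bullet> e) *\<^sub>R e) + (x \<bullet> e) *\<^sub>R e" by (simp add: y_def inner_add_left ee scaleR_add_left)
  then have "norm x \<le> norm (y - (y \<bullet> e) *\<^sub>R e) + norm ((x \<bullet> e) *\<^sub>R e)" by (metis norm_triangle_ineq)
  then show ?thesis using 1 x e by (simp add: y_def)
qed

text \<open>After a translation, the difference quotients of the test function become those of the
  indicator function of the subgraph. On the line through x in direction e, the latter is a step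
  between g x - x \<bullet> e and its shifted counterpart, whose distance divided by the step width
  tends to v \<bullet> e minus the derivative of g.\<close>

lemma subgraph_integral_dir_deriv:
  fixes e v :: "'a::euclidean_space"
  assumes e: "norm e = 1" and g: "L-lipschitz_on UNIV g" and gc: "\<And>x t. g (x + t *\<^sub>R e) = g x"
    and \<phi>: "K-lipschitz_on UNIV \<phi>" and M: "\<And>x. \<bar>\<phi> x\<bar> \<le> M" and R: "\<And>x. x \<notin> ball 0 R \<Longrightarrow> \<phi> x = 0"
  defines "H \<equiv> \<lambda>x. indicator (unit_slab e) x * (\<phi> (x + (g x - x \<bullet> e) *\<^sub>R e) * (v \<bullet> e - dir_deriv g v x))"
  shows "integrable lborel H"
    and "(\<integral>x. indicator {x. x \<bullet> e < g x} x * dir_deriv \<phi> v x \<partial>lborel) = (\<integral>x. H x \<partial>lborel)"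
proof -
  have cg: "continuous_on UNIV g" and c\<phi>: "continuous_on UNIV \<phi>"
    using g \<phi> lipschitz_on_continuous_on by blast+
  have [measurable]: "g \<in> borel_measurable borel" "\<phi> \<in> borel_measurable borel"
    using cg c\<phi> by (auto intro: borel_measurable_continuous_onI)
  have ee: "e \<bullet> e = 1" using e by (simp add: norm_eq_1)
  have M0: "0 \<le> M" using M[of 0] by linarith
  have K0: "0 \<le> K" using lipschitz_on_nonneg[OF \<phi>] .
  have [measurable]: "H \<in> borel_measurable borel" unfolding H_def by measurable
  define A where "A = {x. x \<bullet> e < g x}"
  have [measurable]: "A \<in> sets borel" unfolding A_def by measurable
  define iA :: "'a \<Rightarrow> real" where "iA = indicator A"
  have [measurable]: "iA \<in> borel_measurable borel" unfolding iA_def by measurable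
  have iA1: "\<bar>iA x\<bar> \<le> 1" for x by (simp add: iA_def)
  define c where "c k = real (Suc k)" for k
  have c: "c k > 0" for k by (simp add: c_def)
  define a where "a k = (1 / c k) *\<^sub>R v" for k
  have av: "norm (a k) \<le> norm v" for k by (simp add: a_def c_def field_simps)
  have int: "integrable lborel f" if "f \<in> borel_measurable borel" "\<And>x. \<bar>f x\<bar> \<le> M" "\<And>x. x \<notin> ball 0 (R + norm v) \<Longrightarrow> f x = 0" for f :: "'a \<Rightarrow> real"
    using that by (rule integrable_bounded_support)
  have far: "\<phi> (x + z) = 0" if "x \<notin> ball 0 (R + norm v)" "norm z \<le> norm v" for x z
  proof -
    have "norm x \<le> norm (x + z) + norm z" using norm_triangle_ineq4[of "x + z" z] by simp
    then show ?thesis using that by (intro R) auto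
  qed
  have i1: "integrable lborel (\<lambda>x. iA x * \<phi> (x + a k))" for k
    using far[OF _ av] M by (intro int) (auto simp: iA_def indicator_def M0 simp del: mem_ball)
  have i2: "integrable lborel (\<lambda>x. iA x * \<phi> x)"
    using far[of _ 0] M by (intro int) (auto simp: iA_def indicator_def M0 simp del: mem_ball)
  have i3: "integrable lborel (\<lambda>x. iA (x - a k) * \<phi> x)" for k
    using far[of _ 0] M by (intro int) (auto simp: iA_def indicator_def M0 simp del: mem_ball)
  define F where "F k x = c k * ((iA (x - a k) - iA x) * \<phi> x)" for k x
  have iF: "integrable lborel (F k)" for k
    unfolding F_def using i2 i3[of k] by (auto simp: left_diff_distrib)
  have eqk: "(\<integral>x. iA x * (c k * (\<phi> (x + a k) - \<phi> x)) \<partial>lborel) = (\<integral>x. F k x \<partial>lborel)" for k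
  proof -
    have "(\<integral>x. iA x * (c k * (\<phi> (x + a k) - \<phi> x)) \<partial>lborel) = (\<integral>x. c k * (iA x * \<phi> (x + a k) - iA x * \<phi> x) \<partial>lborel)"
      by (intro Bochner_Integration.integral_cong) (auto simp: algebra_simps)
    also have "\<dots> = c k * ((\<integral>x. iA x * \<phi> (x + a k) \<partial>lborel) - (\<integral>x. iA x * \<phi> x \<partial>lborel))"
      using i1 i2 by simp
    also have "(\<integral>x. iA x * \<phi> (x + a k) \<partial>lborel) = (\<integral>x. iA (x - a k) * \<phi> x \<partial>lborel)"
      using lborel_integral_translate(1)[of "\<lambda>x. iA (x - a k) * \<phi> x" "a k"] by simp
    also have "c k * ((\<integral>x. iA (x - a k) * \<phi> x \<partial>lborel) - (\<integral>x. iA x * \<phi> x \<partial>lborel)) = (\<integral>x. F k x \<partial>lborel)"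
      using i2 i3[of k] by (simp add: F_def left_diff_distrib)
    finally show ?thesis .
  qed
  define J where "J k x = (\<integral>s. F k (x + s *\<^sub>R e) \<partial>lborel)" for k x
  define \<alpha> where "\<alpha> x = g x - x \<bullet> e" for x
  \<comment> \<open>Translation by \<open>a k\<close> turns the subgraph of \<open>g\<close> into
    that of \<open>g (x - a k) + a k \<bullet> e\<close>; the thresholds are heights along the line
    measured from \<open>x\<close>.\<close>
  define \<beta> where "\<beta> k x = g (x - a k) + a k \<bullet> e - x \<bullet> e" for k x
  have gc': "g (x + s *\<^sub>R e - z) = g (x - z)" for x s z
    using gc[of "x - z" s] by (simp add: algebra_simps)
  have J: "J k x = c k * (\<integral>s. (indicator {..<\<beta> k x} s - indicator {..<\<alpha> x} s) * \<phi> (x + s *\<^sub>R e) \<partial>lborel)" for k x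
  proof -
    have "F k (x + s *\<^sub>R e) = c k * ((indicator {..<\<beta> k x} s - indicator {..<\<alpha> x} s) * \<phi> (x + s *\<^sub>R e))" for s
      by (auto simp: F_def iA_def A_def indicator_def gc gc' \<alpha>_def \<beta>_def inner_add_left inner_diff_left ee)
    then show ?thesis by (simp add: J_def)
  qed
  have \<phi>line: "K-lipschitz_on UNIV (\<lambda>s. \<phi> (x + s *\<^sub>R e))" for x
  proof (rule lipschitz_onI)
    fix s t :: real
    have "dist (\<phi> (x + s *\<^sub>R e)) (\<phi> (x + t *\<^sub>R e)) \<le> K * dist (x + s *\<^sub>R e) (x + t *\<^sub>R e)"
      using lipschitz_onD[OF \<phi>] by blast
    also have "dist (x + s *\<^sub>R e) (x + t *\<^sub>R e) = dist s t"
      using e by (simp add: dist_norm flip: scaleR_diff_left)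
    finally show "dist (\<phi> (x + s *\<^sub>R e)) (\<phi> (x + t *\<^sub>R e)) \<le> K * dist s t" .
  qed (fact K0)
  have diff: "c k * (\<beta> k x - \<alpha> x) = v \<bullet> e - c k * (g x - g (x - a k))" for k x
    using c[of k] by (simp add: \<alpha>_def \<beta>_def a_def algebra_simps)
  define B where "B = norm v + L * norm v"
  have B: "\<bar>c k * (\<beta> k x - \<alpha> x)\<bar> \<le> B" for k x
  proof -
    have "\<bar>v \<bullet> e\<bar> \<le> norm v" using Cauchy_Schwarz_ineq2[of v e] e by simp
    moreover have "\<bar>c k * (g x - g (x - a k))\<bar> \<le> L * norm v"
      unfolding c_def a_def by (rule lipschitz_diff_quotient_Suc_bound(2)[OF g])
    ultimately show ?thesis unfolding diff B_def by linarith
  qed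
  have Jb: "\<bar>J k x\<bar> \<le> M * B" for k x
  proof -
    have "\<bar>J k x\<bar> \<le> c k * (M * \<bar>\<beta> k x - \<alpha> x\<bar>)"
      unfolding J abs_mult using c[of k] M by (auto intro!: mult_left_mono step_difference_integral)
    also have "\<dots> = M * \<bar>c k * (\<beta> k x - \<alpha> x)\<bar>" using c[of k] by (simp add: abs_mult)
    also have "\<dots> \<le> M * B" using B M0 by (intro mult_left_mono) auto
    finally show ?thesis .
  qed
  have J0: "J k x = 0" if "x \<in> unit_slab e" "x \<notin> ball 0 (R + 1)" for k x
  proof -
    have "\<phi> (x + s *\<^sub>R e) = 0" for s
      using norm_slab_le[OF e, of x s] that by (intro R) (auto simp: unit_slab_def)
    then show ?thesis by (simp add: J)
  qed
  have Jlim: "(\<lambda>k. J k x) \<longlonglongrightarrow> \<phi> (x + \<alpha> x *\<^sub>R e) * (v \<bullet> e - dir_deriv g v x)" if dd: "\<exists>d. has_dir_deriv g v x d" for x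
  proof -
    have "(\<lambda>k. c k * (\<beta> k x - \<alpha> x)) \<longlonglongrightarrow> v \<bullet> e - dir_deriv g v x"
      unfolding diff using dir_deriv_LIMSEQ(2)[OF dd] unfolding a_def c_def by (intro tendsto_intros)
    then have 1: "(\<lambda>k. \<phi> (x + \<alpha> x *\<^sub>R e) * (c k * (\<beta> k x - \<alpha> x))) \<longlonglongrightarrow> \<phi> (x + \<alpha> x *\<^sub>R e) * (v \<bullet> e - dir_deriv g v x)"
      by (intro tendsto_intros)
    \<comment> \<open>The error \<open>c k * K * (\<beta> k x - \<alpha> x)\<^sup>2\<close> equals
      \<open>K * (c k * (\<beta> k x - \<alpha> x))\<^sup>2 / c k\<close>, and the square is bounded
      by \<open>B\<^sup>2\<close>.\<close>
    have le: "\<bar>J k x - \<phi> (x + \<alpha> x *\<^sub>R e) * (c k * (\<beta> k x - \<alpha> x))\<bar> \<le> K * B\<^sup>2 * (1 / c k)" for k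
    proof -
      let ?I = "\<integral>s. (indicator {..<\<beta> k x} s - indicator {..<\<alpha> x} s) * \<phi> (x + s *\<^sub>R e) \<partial>lborel"
      have "J k x - \<phi> (x + \<alpha> x *\<^sub>R e) * (c k * (\<beta> k x - \<alpha> x)) = c k * (?I - (\<beta> k x - \<alpha> x) * \<phi> (x + \<alpha> x *\<^sub>R e))"
        by (simp add: J algebra_simps)
      then have "\<bar>J k x - \<phi> (x + \<alpha> x *\<^sub>R e) * (c k * (\<beta> k x - \<alpha> x))\<bar> = c k * \<bar>?I - (\<beta> k x - \<alpha> x) * \<phi> (x + \<alpha> x *\<^sub>R e)\<bar>"
        using c[of k] by (simp add: abs_mult)
      also have "\<dots> \<le> c k * (K * (\<beta> k x - \<alpha> x)\<^sup>2)"
        using c[of k] step_difference_integral_lipschitz[OF \<phi>line, of "\<beta> k x" "\<alpha> x" x] by (intro mult_left_mono) auto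
      also have "\<dots> = K * (c k * (\<beta> k x - \<alpha> x))\<^sup>2 * (1 / c k)"
        using c[of k] by (simp add: power2_eq_square)
      also have "\<dots> \<le> K * B\<^sup>2 * (1 / c k)"
        using c[of k] K0 power_mono[OF B, of k x 2] by (intro mult_right_mono mult_left_mono) auto
      finally show ?thesis .
    qed
    have "(\<lambda>k. K * B\<^sup>2 * (1 / c k)) \<longlonglongrightarrow> K * B\<^sup>2 * 0"
      unfolding c_def by (intro tendsto_intros LIMSEQ_Suc[OF lim_1_over_n])
    then have Z: "(\<lambda>k. K * B\<^sup>2 * (1 / c k)) \<longlonglongrightarrow> 0" by simp
    have "(\<lambda>k. J k x - \<phi> (x + \<alpha> x *\<^sub>R e) * (c k * (\<beta> k x - \<alpha> x))) \<longlonglongrightarrow> 0"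
      by (rule Lim_null_comparison[OF _ Z]) (use le in simp)
    from tendsto_add[OF this 1] show ?thesis by simp
  qed
  have [measurable]: "J k \<in> borel_measurable borel" for k
  proof -
    have [measurable]: "F k \<in> borel_measurable borel" unfolding F_def by measurable
    show ?thesis unfolding J_def by measurable
  qed
  let ?D = "\<lambda>x. (M * B) * indicator (ball 0 (R + 1)) x :: real"
  have iD: "integrable lborel ?D"
    by (rule integrable_indicator_ball)
  have limJ: "AE x in lborel. (\<lambda>k. indicator (unit_slab e) x * J k x) \<longlonglongrightarrow> H x"
    using lipschitz_AE_has_dir_deriv[OF g, of v]
  proof eventually_elim
    case (elim x)
    show ?case unfolding H_def \<alpha>_def[symmetric] by (intro tendsto_intros Jlim elim)
  qed
  have bndJ: "AE x in lborel. norm (indicator (unit_slab e) x * J k x) \<le> ?D x" for k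
  proof (rule AE_I2)
    fix x show "norm (indicator (unit_slab e) x * J k x) \<le> ?D x"
      using Jb[of k x] J0[of x k] M0 by (cases "x \<in> ball 0 (R + 1)"; cases "x \<in> unit_slab e") (auto simp del: mem_ball intro: order_trans[OF abs_ge_zero])
  qed
  show "integrable lborel H"
    by (rule integrable_dominated_convergence[OF _ _ iD limJ bndJ]) measurable
  have R1: "(\<lambda>k. \<integral>x. F k x \<partial>lborel) \<longlonglongrightarrow> (\<integral>x. H x \<partial>lborel)"
    unfolding integral_unit_slab[OF e iF] J_def[symmetric]
    by (rule integral_dominated_convergence[OF _ _ iD limJ bndJ]) measurable
  let ?D' = "\<lambda>x. (K * norm v) * indicator (ball 0 (R + norm v)) x :: real"
  have iD': "integrable lborel ?D'"
    by (rule integrable_indicator_ball)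
  have R2: "(\<lambda>k. \<integral>x. iA x * (c k * (\<phi> (x + a k) - \<phi> x)) \<partial>lborel) \<longlonglongrightarrow> (\<integral>x. iA x * dir_deriv \<phi> v x \<partial>lborel)"
  proof (rule integral_dominated_convergence[OF _ _ iD'])
    show "AE x in lborel. (\<lambda>k. iA x * (c k * (\<phi> (x + a k) - \<phi> x))) \<longlonglongrightarrow> iA x * dir_deriv \<phi> v x"
      using lipschitz_AE_has_dir_deriv[OF \<phi>, of v]
    proof eventually_elim
      case (elim x)
      show ?case using dir_deriv_LIMSEQ(1)[OF elim] unfolding a_def c_def by (intro tendsto_intros)
    qed
    fix k
    show "AE x in lborel. norm (iA x * (c k * (\<phi> (x + a k) - \<phi> x))) \<le> ?D' x"
    proof (rule AE_I2)
      fix x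
      have 1: "\<bar>c k * (\<phi> (x + a k) - \<phi> x)\<bar> \<le> K * norm v"
        unfolding c_def a_def by (rule lipschitz_diff_quotient_Suc_bound(1)[OF \<phi>])
      show "norm (iA x * (c k * (\<phi> (x + a k) - \<phi> x))) \<le> ?D' x"
      proof (cases "x \<in> ball 0 (R + norm v)")
        case True
        have "\<bar>iA x\<bar> * \<bar>c k * (\<phi> (x + a k) - \<phi> x)\<bar> \<le> 1 * (K * norm v)"
          using 1 iA1 by (intro mult_mono) auto
        then show ?thesis using True by (simp add: abs_mult)
      next
        case False
        then show ?thesis using far[of x "a k"] far[of x 0] av[of k] by simp
      qed
    qed
  qed measurable
  show "(\<integral>x. indicator {x. x \<bullet> e < g x} x * dir_deriv \<phi> v x \<partial>lborel) = (\<integral>x. H x \<partial>lborel)"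
    using LIMSEQ_unique[OF R2[unfolded eqk] R1] by (simp add: iA_def A_def)
qed

subsection \<open>The measure on a Lipschitz graph\<close>

lemma GDERIV_unique: "GDERIV f x :> D \<Longrightarrow> GDERIV f x :> E \<Longrightarrow> D = E"
  unfolding gderiv_def by (metis has_derivative_unique inner_commute vector_eq_ldot)

lemma gradient_eq: "GDERIV f x :> D \<Longrightarrow> gradient f x = D"
  unfolding gradient_def by (blast intro: GDERIV_unique)

definition graph_density :: "('a::euclidean_space \<Rightarrow> real) \<Rightarrow> 'a \<Rightarrow> real" where
  "graph_density g x = sqrt (1 + (norm (dgrad g x))\<^sup>2)"

definition graph_proj :: "'a::euclidean_space \<Rightarrow> ('a \<Rightarrow> real) \<Rightarrow> 'a \<Rightarrow> 'a" where
  "graph_proj e g x = x + (g x - x \<bullet> e) *\<^sub>R e"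

definition graph_normal :: "'a::euclidean_space \<Rightarrow> ('a \<Rightarrow> real) \<Rightarrow> 'a \<Rightarrow> 'a" where
  "graph_normal e g x = (1 / graph_density g x) *\<^sub>R (e - dgrad g x)"

lemma graph_density_pos: "graph_density g x > 0"
  unfolding graph_density_def by (simp add: add_pos_nonneg)

section \<open>Integration on a single Lipschitz graph\<close>

locale lipschitz_graph =
  fixes e :: "'a::euclidean_space" and g :: "'a \<Rightarrow> real" and L :: real
  assumes e: "norm e = 1" and g: "L-lipschitz_on UNIV g" and gc: "g (x + t *\<^sub>R e) = g x"
begin

abbreviation "\<mu> \<equiv> graph_measure e g"

lemma ee: "e \<bullet> e = 1" using e by (simp add: norm_eq_1)

lemma continuous_g: "continuous_on UNIV g"
  using g by (rule lipschitz_on_continuous_on)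

lemma g_borel[measurable]: "g \<in> borel_measurable borel"
  by (rule borel_measurable_continuous_onI[OF continuous_g])

lemma graph_density_borel[measurable]: "graph_density g \<in> borel_measurable borel"
  unfolding graph_density_def by measurable

lemma graph_proj_borel[measurable]: "graph_proj e g \<in> borel_measurable borel"
  unfolding graph_proj_def by measurable

lemma graph_normal_borel[measurable]: "graph_normal e g \<in> borel_measurable borel"
  unfolding graph_normal_def by measurable

lemma gc': "g (x + t *\<^sub>R e + h) = g (x + h)"
  using gc[of "x + h" t] by (simp add: algebra_simps)

lemma dgrad_line: "dgrad g (x + t *\<^sub>R e) = dgrad g x"
  by (simp add: dgrad_def dir_deriv_def gc gc')

lemma GDERIV_line: "GDERIV g (x + t *\<^sub>R e) :> D \<longleftrightarrow> GDERIV g x :> D"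
  by (simp add: gderiv_def has_derivative_at gc gc')

lemma graph_proj_simps:
  "graph_proj e g x \<bullet> e = g x" "g (graph_proj e g x) = g x" "dgrad g (graph_proj e g x) = dgrad g x"
  "graph_density g (graph_proj e g x) = graph_density g x" "graph_normal e g (graph_proj e g x) = graph_normal e g x"
  "GDERIV g (graph_proj e g x) :> D \<longleftrightarrow> GDERIV g x :> D"
  by (simp_all add: graph_proj_def graph_density_def graph_normal_def inner_add_left ee gc dgrad_line GDERIV_line)

lemma inner_e_GDERIV:
  assumes "GDERIV g x :> D" shows "e \<bullet> D = 0"
proof -
  have "has_dir_deriv g e x 0" by (simp add: has_dir_deriv_def gc)
  then show ?thesis using dir_deriv_eq GDERIV_has_dir_deriv[OF assms, of e] by metis
qed

lemma norm_normal: "GDERIV g x :> D \<Longrightarrow> norm (e - D) = sqrt (1 + (norm D)\<^sup>2)"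
  using inner_e_GDERIV[of x D] unfolding norm_eq_sqrt_inner power2_norm_eq_inner
  by (simp add: inner_diff_left inner_diff_right ee inner_commute)

lemma AE_GDERIV: "AE x in lborel. GDERIV g x :> dgrad g x"
  by (rule rademacher[OF g])

text \<open>By Rademacher's theorem the density written with \<open>gradient\<close> on
  \<open>lebesgue\<close> may be replaced by a Borel one on \<open>lborel\<close>, for which the
  usual integral formulas are available.\<close>

lemma graph_measure_eq:
  "\<mu> = distr (density lborel (\<lambda>x. indicator (unit_slab e) x * ennreal (graph_density g x))) borel (graph_proj e g)"
proof -
  let ?f = "\<lambda>x. indicator {x. 0 \<le> x \<bullet> e \<and> x \<bullet> e \<le> 1} x * ennreal (sqrt (1 + (norm (gradient g x))\<^sup>2))"
  let ?h = "\<lambda>x. indicator (unit_slab e) x * ennreal (graph_density g x)"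
  have "AE x in lebesgue. ?f x = ?h x"
    using AE_completion[OF AE_GDERIV]
    by eventually_elim (simp add: gradient_eq unit_slab_def graph_density_def)
  \<comment> \<open>Comparing integrals of almost equal functions asks for no measurability of
    \<open>?f\<close>, and \<open>density\<close> is built from just these integrals.\<close>
  then have "(\<integral>\<^sup>+x. ?f x * indicator A x \<partial>lebesgue) = (\<integral>\<^sup>+x. ?h x * indicator A x \<partial>lebesgue)" for A
    by (intro nn_integral_cong_AE) (auto elim: eventually_mono)
  then have 1: "density lebesgue ?f = density lebesgue ?h" by (simp add: density_def)
  have T: "graph_proj e g \<in> measurable lebesgue borel"
    using measurable_completion[of "graph_proj e g" lborel borel] by simp
  have "distr (density lebesgue ?h) borel (graph_proj e g) = distr (density lborel ?h) borel (graph_proj e g)"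
  proof (rule measure_eqI)
    fix A assume "A \<in> sets (distr (density lebesgue ?h) borel (graph_proj e g))"
    then have A[measurable]: "A \<in> sets borel" by simp
    let ?B = "graph_proj e g -` A"
    have B: "?B \<in> sets borel" using measurable_sets[OF graph_proj_borel A] by simp
    have h: "?h \<in> borel_measurable lborel" by measurable
    have "emeasure (distr (density lebesgue ?h) borel (graph_proj e g)) A = emeasure (density lebesgue ?h) ?B"
      using T by (subst emeasure_distr) auto
    also have "\<dots> = (\<integral>\<^sup>+x. ?h x * indicator ?B x \<partial>lebesgue)"
      using B measurable_completion[OF h] by (intro emeasure_density) auto
    also have "\<dots> = (\<integral>\<^sup>+x. ?h x * indicator ?B x \<partial>lborel)"
      by (rule nn_integral_completion)
    also have "\<dots> = emeasure (density lborel ?h) ?B"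
      using B h by (intro emeasure_density[symmetric]) auto
    also have "\<dots> = emeasure (distr (density lborel ?h) borel (graph_proj e g)) A"
      by (subst emeasure_distr) auto
    finally show "emeasure (distr (density lebesgue ?h) borel (graph_proj e g)) A = emeasure (distr (density lborel ?h) borel (graph_proj e g)) A" .
  qed simp
  then show ?thesis unfolding graph_measure_def 1 by (simp add: graph_proj_def[abs_def])
qed

lemma sets_graph_measure[simp, measurable_cong]: "sets \<mu> = sets borel"
  by (simp add: graph_measure_eq)

lemma space_graph_measure[simp]: "space \<mu> = UNIV"
  by (simp add: graph_measure_eq)

lemma nn_integral_graph_measure:
  assumes [measurable]: "u \<in> borel_measurable borel"
  shows "(\<integral>\<^sup>+y. u y \<partial>\<mu>) = (\<integral>\<^sup>+x. indicator (unit_slab e) x * ennreal (graph_density g x) * u (graph_proj e g x) \<partial>lborel)"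
  unfolding graph_measure_eq by (subst nn_integral_distr, simp, simp, subst nn_integral_density) auto

lemma integral_graph_measure:
  fixes u :: "'a \<Rightarrow> real"
  assumes [measurable]: "u \<in> borel_measurable borel"
  shows "integrable \<mu> u \<longleftrightarrow> integrable lborel (\<lambda>x. indicator (unit_slab e) x * graph_density g x * u (graph_proj e g x))"
    and "(\<integral>y. u y \<partial>\<mu>) = (\<integral>x. indicator (unit_slab e) x * graph_density g x * u (graph_proj e g x) \<partial>lborel)"
proof -
  have eq: "\<mu> = distr (density lborel (\<lambda>x. ennreal (indicator (unit_slab e) x * graph_density g x))) borel (graph_proj e g)"
    unfolding graph_measure_eq by (simp add: ennreal_mult' ennreal_indicator)
  have nn: "AE x in lborel. 0 \<le> indicator (unit_slab e) x * graph_density g x"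
    using graph_density_pos[of g] by (intro AE_I2) (simp add: less_imp_le)
  show "integrable \<mu> u \<longleftrightarrow> integrable lborel (\<lambda>x. indicator (unit_slab e) x * graph_density g x * u (graph_proj e g x))"
    unfolding eq using nn by (subst integrable_distr_eq, simp, simp, subst integrable_density) auto
  show "(\<integral>y. u y \<partial>\<mu>) = (\<integral>x. indicator (unit_slab e) x * graph_density g x * u (graph_proj e g x) \<partial>lborel)"
    unfolding eq using nn by (subst integral_distr, simp, simp, subst integral_density) auto
qed

lemma AE_graph_measure:
  assumes [measurable]: "Measurable.pred borel P" and P: "AE x in lborel. P (graph_proj e g x)"
  shows "AE y in \<mu>. P y"
proof -
  have "AE x in density lborel (\<lambda>x. indicator (unit_slab e) x * ennreal (graph_density g x)). P (graph_proj e g x)"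
    using P by (subst AE_density) auto
  then show ?thesis unfolding graph_measure_eq by (subst AE_distr_iff) auto
qed

lemma AE_graph_measure_GDERIV: "AE y in \<mu>. y \<bullet> e = g y \<and> GDERIV g y :> dgrad g y"
proof (rule AE_graph_measure)
  have [measurable]: "Measurable.pred borel (\<lambda>y. GDERIV g y :> dgrad g y)"
    by (rule sets_GDERIV[OF g]) measurable
  show "Measurable.pred borel (\<lambda>y. y \<bullet> e = g y \<and> GDERIV g y :> dgrad g y)" by measurable
  show "AE x in lborel. graph_proj e g x \<bullet> e = g (graph_proj e g x) \<and> GDERIV g (graph_proj e g x) :> dgrad g (graph_proj e g x)"
    using AE_GDERIV by (simp add: graph_proj_simps)
qed

text \<open>The bound on the directional derivative is applied in the direction of the gradient
  itself.\<close>

lemma norm_dgrad_le: "GDERIV g x :> dgrad g x \<Longrightarrow> norm (dgrad g x) \<le> L"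
proof -
  assume G: "GDERIV g x :> dgrad g x"
  have "\<bar>dir_deriv g (dgrad g x) x\<bar> \<le> L * norm (dgrad g x)"
    using GDERIV_has_dir_deriv[OF G] by (intro dir_deriv_bound[OF g]) auto
  then have "norm (dgrad g x) * norm (dgrad g x) \<le> L * norm (dgrad g x)"
    using dir_deriv_eq[OF GDERIV_has_dir_deriv[OF G], of "dgrad g x"] by (simp add: dot_square_norm power2_eq_square)
  then show ?thesis using lipschitz_on_nonneg[OF g] by (cases "dgrad g x = 0") auto
qed

text \<open>The density is at most \<open>sqrt (1 + L\<^sup>2)\<close> almost everywhere, and slab
  points projecting into the ball lie in the ball of radius \<open>R + 1\<close>.\<close>

lemma graph_measure_ball_finite: "emeasure \<mu> (ball 0 R) < \<infinity>"
proof -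
  let ?C = "ennreal (sqrt (1 + L\<^sup>2))"
  have "emeasure \<mu> (ball 0 R) = (\<integral>\<^sup>+y. indicator (ball 0 R) y \<partial>\<mu>)" by simp
  also have "\<dots> = (\<integral>\<^sup>+x. indicator (unit_slab e) x * ennreal (graph_density g x) * indicator (ball 0 R) (graph_proj e g x) \<partial>lborel)"
    by (rule nn_integral_graph_measure) (intro borel_measurable_indicator; simp)
  also have "\<dots> \<le> (\<integral>\<^sup>+x. ?C * indicator (ball (0::'a) (R + 1)) x \<partial>lborel)"
  proof (rule nn_integral_mono_AE)
    show "AE x in lborel. indicator (unit_slab e) x * ennreal (graph_density g x) * indicator (ball 0 R) (graph_proj e g x) \<le> ?C * indicator (ball 0 (R + 1)) x"
      using AE_GDERIV
    proof eventually_elim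
      case (elim x)
      show "indicator (unit_slab e) x * ennreal (graph_density g x) * indicator (ball 0 R) (graph_proj e g x) \<le> ?C * indicator (ball 0 (R + 1)) x"
      proof (cases "x \<in> unit_slab e \<and> graph_proj e g x \<in> ball 0 R")
        case True
        then have "norm x \<le> norm (graph_proj e g x) + 1"
          unfolding graph_proj_def by (intro norm_slab_le[OF e]) (auto simp: unit_slab_def)
        then have "x \<in> ball 0 (R + 1)" using True by auto
        moreover have "graph_density g x \<le> sqrt (1 + L\<^sup>2)"
          unfolding graph_density_def using norm_dgrad_le[OF elim] by (intro real_sqrt_le_mono add_mono power_mono) auto
        ultimately show ?thesis using True by (simp add: ennreal_leI del: mem_ball)
      qed (auto simp del: mem_ball)
    qed
  qed
  also have "\<dots> = ?C * emeasure lborel (ball (0::'a) (R + 1))" by (rule nn_integral_cmult_indicator) simp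
  also have "\<dots> < \<infinity>" using emeasure_bounded_finite[of "ball (0::'a) (R+1)"] by (simp add: ennreal_mult_less_top)
  finally show ?thesis .
qed

text \<open>The area factor \<open>graph_density\<close> cancels the normalization of the normal:
  their product paired with \<open>v\<close> is
  \<open>v \<bullet> e - v \<bullet> dgrad g x\<close>, the factor found along lines.\<close>

lemma subgraph_divergence:
  assumes \<phi>: "K-lipschitz_on UNIV \<phi>" and M: "\<And>x. \<bar>\<phi> x\<bar> \<le> M" and R: "\<And>x. x \<notin> ball 0 R \<Longrightarrow> \<phi> x = 0"
  shows "integrable \<mu> (\<lambda>y. \<phi> y * (v \<bullet> graph_normal e g y))"
    and "(\<integral>x. indicator {x. x \<bullet> e < g x} x * dir_deriv \<phi> v x \<partial>lborel) = (\<integral>y. \<phi> y * (v \<bullet> graph_normal e g y) \<partial>\<mu>)"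
proof -
  have [measurable]: "\<phi> \<in> borel_measurable borel"
    using \<phi> by (intro lipschitz_on_borel)
  let ?H = "\<lambda>x. indicator (unit_slab e) x * (\<phi> (x + (g x - x \<bullet> e) *\<^sub>R e) * (v \<bullet> e - dir_deriv g v x))"
  let ?u = "\<lambda>y. \<phi> y * (v \<bullet> graph_normal e g y)"
  let ?G = "\<lambda>x. indicator (unit_slab e) x * graph_density g x * ?u (graph_proj e g x)"
  have [measurable]: "?u \<in> borel_measurable borel" by measurable
  have HG: "AE x in lborel. ?H x = ?G x"
    using AE_GDERIV
  proof eventually_elim
    case (elim x)
    have "dir_deriv g v x = v \<bullet> dgrad g x" by (rule dir_deriv_eq[OF GDERIV_has_dir_deriv[OF elim]])
    moreover have "graph_density g x * (v \<bullet> graph_normal e g x) = v \<bullet> e - v \<bullet> dgrad g x"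
      using graph_density_pos[of g x] by (simp add: graph_normal_def inner_diff_right)
    ultimately show ?case by (simp add: graph_proj_simps) (simp add: graph_proj_def mult_ac)
  qed
  note sub = subgraph_integral_dir_deriv[OF e g gc \<phi> M R, where v=v]
  have [measurable]: "?H \<in> borel_measurable borel" by measurable
  have [measurable]: "?G \<in> borel_measurable borel" by measurable
  have "integrable lborel ?G" using sub(1) by (rule integrable_cong_AE_imp) (use HG in \<open>auto elim: eventually_mono\<close>)
  then show "integrable \<mu> ?u" by (subst integral_graph_measure) auto
  have "(\<integral>x. ?H x \<partial>lborel) = (\<integral>x. ?G x \<partial>lborel)" using HG by (intro integral_cong_AE) auto
  then show "(\<integral>x. indicator {x. x \<bullet> e < g x} x * dir_deriv \<phi> v x \<partial>lborel) = (\<integral>y. ?u y \<partial>\<mu>)"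
    using sub(2) by (subst integral_graph_measure) auto
qed

end

subsection \<open>Charts\<close>

text \<open>If the unit vectors \<open>u\<close> and \<open>v\<close> differ, then
  \<open>w = v - u\<close> satisfies \<open>w \<bullet> a < 0 < w \<bullet> b\<close>, by
  \<open>u \<bullet> v < 1\<close>.\<close>

lemma normalized_eq_if_same_halfspace:
  fixes a b :: "'a::real_inner"
  assumes "a \<noteq> 0" "b \<noteq> 0" and no: "\<And>w. w \<bullet> a < 0 \<Longrightarrow> w \<bullet> b > 0 \<Longrightarrow> False"
  shows "(1 / norm a) *\<^sub>R a = (1 / norm b) *\<^sub>R b"
proof (rule ccontr)
  define u v where "u = (1 / norm a) *\<^sub>R a" and "v = (1 / norm b) *\<^sub>R b"
  assume "(1 / norm a) *\<^sub>R a \<noteq> (1 / norm b) *\<^sub>R b"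
  then have ne: "u \<noteq> v" by (simp add: u_def v_def)
  have n: "norm u = 1" "norm v = 1" using assms by (auto simp: u_def v_def)
  then have uv: "u \<bullet> u = 1" "v \<bullet> v = 1" by (auto simp: norm_eq_1)
  have "(u - v) \<bullet> (u - v) > 0" using ne by simp
  then have lt: "u \<bullet> v < 1" by (simp add: inner_diff_left inner_diff_right uv inner_commute)
  have a: "a = norm a *\<^sub>R u" and b: "b = norm b *\<^sub>R v" using assms by (auto simp: u_def v_def)
  have "(v - u) \<bullet> a = norm a * (u \<bullet> v - 1)"
    by (subst a) (simp add: inner_diff_left uv inner_commute[of v u])
  then have "(v - u) \<bullet> a < 0" using lt assms by (simp add: mult_pos_neg)
  moreover have "(v - u) \<bullet> b = norm b * (1 - u \<bullet> v)"
    by (subst b) (simp add: inner_diff_left uv)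
  then have "(v - u) \<bullet> b > 0" using lt assms by simp
  ultimately show False by (rule no)
qed

lemma lipschitz_chartD:
  assumes "lipschitz_chart \<Omega> U e g"
  shows "open U" "norm e = 1" "\<exists>L. lipschitz_graph e g L" "\<And>x. x \<in> U \<Longrightarrow> x \<in> \<Omega> \<longleftrightarrow> x \<bullet> e < g x"
  using assms by (auto simp: lipschitz_chart_def lipschitz_graph_def)

text \<open>Points below the graph are interior; those strictly above have a neighbourhood disjoint
  from \<open>\<Omega>\<close>; a point on the graph is outside \<open>\<Omega>\<close> but a limit
  of points obtained by moving down along \<open>e\<close>.\<close>

lemma chart_frontier:
  assumes chart: "lipschitz_chart \<Omega> U e g" and x: "x \<in> U"
  shows "x \<in> frontier \<Omega> \<longleftrightarrow> x \<bullet> e = g x"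
proof -
  obtain L where "lipschitz_graph e g L" using lipschitz_chartD(3)[OF chart] by blast
  then interpret lipschitz_graph e g L .
  have U: "open U" and \<Omega>: "\<And>y. y \<in> U \<Longrightarrow> y \<in> \<Omega> \<longleftrightarrow> y \<bullet> e < g y" using lipschitz_chartD[OF chart] by auto
  have op1: "open {y. y \<bullet> e < g y}" and op2: "open {y. g y < y \<bullet> e}"
    by (intro open_Collect_less continuous_intros continuous_on_subset[OF continuous_g]; simp)+
  consider "x \<bullet> e < g x" | "x \<bullet> e = g x" | "x \<bullet> e > g x" by linarith
  then show ?thesis
  proof cases
    case 1
    have "x \<in> interior \<Omega>"
      by (rule interiorI[of "U \<inter> {y. y \<bullet> e < g y}"]) (use U op1 1 x \<Omega> in auto)
    then show ?thesis using 1 by (simp add: frontier_def)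
  next
    case 2
    have "x \<notin> \<Omega>" using \<Omega>[OF x] 2 by simp
    then have "x \<notin> interior \<Omega>" using interior_subset by blast
    moreover have "x \<in> closure \<Omega>"
      unfolding closure_approachable
    proof (intro allI impI)
      fix \<epsilon> :: real assume "\<epsilon> > 0"
      obtain d where d: "d > 0" "ball x d \<subseteq> U" using U x open_contains_ball by blast
      define t where "t = min d \<epsilon> / 2"
      have t: "t > 0" "t < d" "t < \<epsilon>" using d \<open>\<epsilon> > 0\<close> by (auto simp: t_def)
      let ?y = "x + (- t) *\<^sub>R e"
      have dist: "dist ?y x = t" using t e by (simp add: dist_norm)
      then have "?y \<in> U" using d t by (auto simp: dist_commute subset_eq)
      moreover have "?y \<bullet> e < g ?y" using t 2 unfolding gc by (simp add: inner_diff_left ee)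
      ultimately show "\<exists>y\<in>\<Omega>. dist y x < \<epsilon>" using \<Omega> dist t by (intro bexI[of _ ?y]) auto
    qed
    ultimately show ?thesis using 2 by (simp add: frontier_def)
  next
    case 3
    have "(U \<inter> {y. g y < y \<bullet> e}) \<inter> \<Omega> = {}" using \<Omega> by force
    moreover have "open (U \<inter> {y. g y < y \<bullet> e})" using U op2 by auto
    ultimately have "(U \<inter> {y. g y < y \<bullet> e}) \<inter> closure \<Omega> = {}" by (simp only: open_Int_closure_eq_empty)
    then have "x \<notin> closure \<Omega>" using 3 x by blast
    then show ?thesis using 3 by (simp add: frontier_def)
  qed
qed

text \<open>Along the ray in direction \<open>w\<close> the function
  \<open>y \<bullet> e - g y\<close> starts at 0 with slope \<open>w \<bullet> (e - D)\<close>. The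
  conclusions mention only \<open>\<Omega>\<close> and the ray, so different charts can be compared
  by them.\<close>

lemma chart_direction:
  assumes chart: "lipschitz_chart \<Omega> U e g" and x: "x \<in> U" "x \<bullet> e = g x" and D: "GDERIV g x :> D"
  shows "w \<bullet> (e - D) < 0 \<Longrightarrow> eventually (\<lambda>t. x + t *\<^sub>R w \<in> \<Omega>) (at_right 0)"
    and "w \<bullet> (e - D) > 0 \<Longrightarrow> eventually (\<lambda>t. x + t *\<^sub>R w \<notin> \<Omega>) (at_right 0)"
proof -
  have U: "open U" and \<Omega>: "\<And>y. y \<in> U \<Longrightarrow> y \<in> \<Omega> \<longleftrightarrow> y \<bullet> e < g y" using lipschitz_chartD[OF chart] by auto
  have "((\<lambda>t. x + t *\<^sub>R w) \<longlongrightarrow> x + 0 *\<^sub>R w) (at_right 0)" by (intro tendsto_intros)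
  then have inU: "eventually (\<lambda>t. x + t *\<^sub>R w \<in> U) (at_right 0)"
    using U x(1) by (auto dest: topological_tendstoD)
  have pos: "eventually (\<lambda>t::real. 0 < t) (at_right 0)" by (simp add: eventually_at_right_less)
  have "((\<lambda>t. (g (x + t *\<^sub>R w) - g x) / t) \<longlongrightarrow> w \<bullet> D) (at_right 0)"
    using GDERIV_has_dir_deriv[OF D, of w] unfolding has_dir_deriv_def
    by (rule tendsto_mono[rotated]) (simp add: at_le)
  then have lim: "((\<lambda>t. w \<bullet> e - (g (x + t *\<^sub>R w) - g x) / t) \<longlongrightarrow> w \<bullet> (e - D)) (at_right 0)"
    unfolding inner_diff_right by (intro tendsto_intros)
  have q: "w \<bullet> e - (g (x + t *\<^sub>R w) - g x) / t = ((x + t *\<^sub>R w) \<bullet> e - g (x + t *\<^sub>R w)) / t" if "t > 0" for t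
    using that x(2) by (simp add: inner_add_left field_simps)
  show "eventually (\<lambda>t. x + t *\<^sub>R w \<in> \<Omega>) (at_right 0)" if "w \<bullet> (e - D) < 0"
    using order_tendstoD(2)[OF lim that] pos inU
  proof eventually_elim
    case (elim t)
    then show ?case using q[of t] \<Omega> by (simp add: divide_less_0_iff)
  qed
  show "eventually (\<lambda>t. x + t *\<^sub>R w \<notin> \<Omega>) (at_right 0)" if "w \<bullet> (e - D) > 0"
    using order_tendstoD(1)[OF lim that] pos inU
  proof eventually_elim
    case (elim t)
    then show ?case using q[of t] \<Omega> by (simp add: zero_less_divide_iff)
  qed
qed

text \<open>If the normals differed, some ray would run into \<open>\<Omega>\<close> by one chart
  and out of it by the other.\<close>

lemma chart_normal_unique:
  assumes 1: "lipschitz_chart \<Omega> U e g" "x \<in> U" "GDERIV g x :> D"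
    and 2: "lipschitz_chart \<Omega> U' e' g'" "x \<in> U'" "GDERIV g' x :> D'" and x: "x \<in> frontier \<Omega>"
  shows "(1 / sqrt (1 + (norm D)\<^sup>2)) *\<^sub>R (e - D) = (1 / sqrt (1 + (norm D')\<^sup>2)) *\<^sub>R (e' - D')"
proof -
  obtain L where L: "lipschitz_graph e g L" using lipschitz_chartD(3)[OF 1(1)] by blast
  obtain L' where L': "lipschitz_graph e' g' L'" using lipschitz_chartD(3)[OF 2(1)] by blast
  have n: "norm (e - D) = sqrt (1 + (norm D)\<^sup>2)" "norm (e' - D') = sqrt (1 + (norm D')\<^sup>2)"
    using lipschitz_graph.norm_normal[OF L 1(3)] lipschitz_graph.norm_normal[OF L' 2(3)] by auto
  have p: "sqrt (1 + (norm z)\<^sup>2) > 0" for z :: 'a by (simp add: add_pos_nonneg)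
  have "norm (e - D) \<noteq> 0" "norm (e' - D') \<noteq> 0" unfolding n using p[of D] p[of D'] by auto
  then have nz: "e - D \<noteq> 0" "e' - D' \<noteq> 0" by auto
  have no: "False" if "w \<bullet> (e - D) < 0" "w \<bullet> (e' - D') > 0" for w
  proof -
    have "eventually (\<lambda>t. x + t *\<^sub>R w \<in> \<Omega>) (at_right 0)"
      using chart_direction(1)[OF 1(1,2) _ 1(3) that(1)] chart_frontier[OF 1(1,2)] x by auto
    moreover have "eventually (\<lambda>t. x + t *\<^sub>R w \<notin> \<Omega>) (at_right 0)"
      using chart_direction(2)[OF 2(1,2) _ 2(3) that(2)] chart_frontier[OF 2(1,2)] x by auto
    ultimately have "eventually (\<lambda>t::real. False) (at_right 0)" by eventually_elim simp
    then show False by simp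
  qed
  have "(1 / norm (e - D)) *\<^sub>R (e - D) = (1 / norm (e' - D')) *\<^sub>R (e' - D')"
    by (rule normalized_eq_if_same_halfspace[OF nz]) (rule no)
  then show ?thesis unfolding n .
qed

lemma outward_normal_eq:
  assumes "lipschitz_chart \<Omega> U e g" "x \<in> U" "GDERIV g x :> D" "x \<in> frontier \<Omega>"
  shows "outward_normal \<Omega> x = (1 / sqrt (1 + (norm D)\<^sup>2)) *\<^sub>R (e - D)"
  unfolding outward_normal_def
proof (rule the_equality)
  show "\<exists>U e' g D'. lipschitz_chart \<Omega> U e' g \<and> x \<in> frontier \<Omega> \<inter> U \<and> (GDERIV g x :> D') \<and>
      (1 / sqrt (1 + (norm D)\<^sup>2)) *\<^sub>R (e - D) = (1 / sqrt (1 + (norm D')\<^sup>2)) *\<^sub>R (e' - D')"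
    using assms by blast
next
  fix v assume "\<exists>U e g D. lipschitz_chart \<Omega> U e g \<and> x \<in> frontier \<Omega> \<inter> U \<and> (GDERIV g x :> D) \<and>
      v = (1 / sqrt (1 + (norm D)\<^sup>2)) *\<^sub>R (e - D)"
  then show "v = (1 / sqrt (1 + (norm D)\<^sup>2)) *\<^sub>R (e - D)"
    using chart_normal_unique[OF _ _ _ assms(1-3)] by blast
qed

text \<open>Moving from a boundary point along \<open>- e\<close> enters \<open>\<Omega>\<close>
  exactly, not just to first order, so \<open>- e\<close> cannot point strictly outward in the
  second chart. Differentiability enters for \<open>g'\<close> alone; this suits points known to be
  generic only for the second graph measure.\<close>

lemma chart_inner_normal_nonneg:
  assumes 1: "lipschitz_chart \<Omega> U e g" "x \<in> U" and 2: "lipschitz_chart \<Omega> U' e' g'" "x \<in> U'" "GDERIV g' x :> D'"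
    and x: "x \<in> frontier \<Omega>"
  shows "e \<bullet> (e' - D') \<ge> 0"
proof (rule ccontr)
  assume "\<not> ?thesis"
  then have "(- e) \<bullet> (e' - D') > 0" by simp
  moreover have xe: "x \<bullet> e' = g' x" using chart_frontier[OF 2(1,2)] x by blast
  ultimately have out: "eventually (\<lambda>t. x + t *\<^sub>R (- e) \<notin> \<Omega>) (at_right 0)"
    by (intro chart_direction(2)[OF 2(1,2) _ 2(3)])
  obtain L where "lipschitz_graph e g L" using lipschitz_chartD(3)[OF 1(1)] by blast
  then interpret lipschitz_graph e g L .
  have U: "open U" and \<Omega>: "\<And>y. y \<in> U \<Longrightarrow> y \<in> \<Omega> \<longleftrightarrow> y \<bullet> e < g y" using lipschitz_chartD[OF 1(1)] by auto
  have "((\<lambda>t. x + t *\<^sub>R (-e)) \<longlongrightarrow> x + 0 *\<^sub>R (-e)) (at_right 0)" by (intro tendsto_intros)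
  then have inU: "eventually (\<lambda>t. x + t *\<^sub>R (-e) \<in> U) (at_right 0)"
    using U 1(2) by (auto dest: topological_tendstoD)
  have pos: "eventually (\<lambda>t::real. 0 < t) (at_right 0)" by (simp add: eventually_at_right_less)
  have "eventually (\<lambda>t::real. False) (at_right 0)"
    using out inU pos
  proof eventually_elim
    case (elim t)
    have "x + t *\<^sub>R (- e) = x + (- t) *\<^sub>R e" by simp
    then have "g (x + t *\<^sub>R (- e)) = g x" by (simp only: gc)
    then show ?case using elim \<Omega> chart_frontier[OF 1] x by (simp add: inner_diff_left ee)
  qed
  then show False by simp
qed

text \<open>Forward difference quotients are nonnegative and backward ones nonpositive. This is why
  test functions are kept nonnegative: where they vanish, their derivatives do too.\<close>

lemma dir_deriv_zero_at_min:
  assumes "\<exists>d. has_dir_deriv \<phi> v x d" and "\<And>y. 0 \<le> \<phi> y" "\<phi> x = 0"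
  shows "dir_deriv \<phi> v x = 0"
proof (rule antisym)
  show "0 \<le> dir_deriv \<phi> v x"
    by (rule LIMSEQ_le_const[OF dir_deriv_LIMSEQ(1)[OF assms(1)]]) (use assms in auto)
  show "dir_deriv \<phi> v x \<le> 0"
    by (rule LIMSEQ_le_const2[OF dir_deriv_LIMSEQ(2)[OF assms(1)]]) (use assms in \<open>auto intro: mult_nonneg_nonpos\<close>)
qed

text \<open>Inside \<open>U\<close> the domain and the subgraph coincide; outside,
  \<open>\<phi>\<close> is at its minimum 0 and its derivative vanishes wherever it exists, so the
  subgraph identity carries over.\<close>

lemma chart_divergence:
  fixes \<phi> :: "'a::euclidean_space \<Rightarrow> real"
  assumes chart: "lipschitz_chart \<Omega> U e g" and \<Omega>: "\<Omega> \<in> sets borel"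
    and \<phi>: "K-lipschitz_on UNIV \<phi>" and M: "\<And>x. 0 \<le> \<phi> x \<and> \<phi> x \<le> M"
    and R: "\<And>x. x \<notin> ball 0 R \<Longrightarrow> \<phi> x = 0" and U: "\<And>x. x \<notin> U \<Longrightarrow> \<phi> x = 0"
  shows "integrable (graph_measure e g) (\<lambda>y. \<phi> y * (v \<bullet> graph_normal e g y))"
    and "(\<integral>x. indicator \<Omega> x * dir_deriv \<phi> v x \<partial>lborel) = (\<integral>y. \<phi> y * (v \<bullet> graph_normal e g y) \<partial>graph_measure e g)"
proof -
  obtain L where "lipschitz_graph e g L" using lipschitz_chartD(3)[OF chart] by blast
  then interpret lipschitz_graph e g L .
  have [measurable]: "\<phi> \<in> borel_measurable borel"
    using \<phi> by (intro lipschitz_on_borel)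
  note [measurable] = \<Omega>
  have M': "\<bar>\<phi> x\<bar> \<le> M" for x using M[of x] by simp
  show "integrable (graph_measure e g) (\<lambda>y. \<phi> y * (v \<bullet> graph_normal e g y))"
    by (rule subgraph_divergence[OF \<phi> M' R])
  have "AE x in lborel. indicator \<Omega> x * dir_deriv \<phi> v x = indicator {x. x \<bullet> e < g x} x * dir_deriv \<phi> v x"
    using lipschitz_AE_has_dir_deriv[OF \<phi>, of v]
  proof eventually_elim
    case (elim x)
    show ?case
    proof (cases "x \<in> U")
      case True then show ?thesis using lipschitz_chartD(4)[OF chart] by (simp add: indicator_def)
    next
      case False then show ?thesis using dir_deriv_zero_at_min[OF elim] M U by simp
    qed
  qed
  then have "(\<integral>x. indicator \<Omega> x * dir_deriv \<phi> v x \<partial>lborel) = (\<integral>x. indicator {x. x \<bullet> e < g x} x * dir_deriv \<phi> v x \<partial>lborel)"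
    by (intro integral_cong_AE) auto
  then show "(\<integral>x. indicator \<Omega> x * dir_deriv \<phi> v x \<partial>lborel) = (\<integral>y. \<phi> y * (v \<bullet> graph_normal e g y) \<partial>graph_measure e g)"
    using subgraph_divergence(2)[OF \<phi> M' R, where v=v] by simp
qed

lemma (in lipschitz_graph) graph_normal_GDERIV:
  assumes "GDERIV g y :> dgrad g y"
  shows "norm (graph_normal e g y) = 1" "e \<bullet> graph_normal e g y > 0"
  using norm_normal[OF assms] graph_density_pos[of g y] inner_e_GDERIV[OF assms]
  by (auto simp: graph_normal_def graph_density_def[symmetric] inner_diff_right ee)

abbreviation normal_measure :: "'a::euclidean_space \<Rightarrow> 'a \<Rightarrow> ('a \<Rightarrow> real) \<Rightarrow> 'a measure" where
  "normal_measure v e g \<equiv> density (graph_measure e g) (\<lambda>y. ennreal (v \<bullet> graph_normal e g y))"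

text \<open>Integrating a test function against either measure gives the integral over the domain of its
  derivative in direction e, which does not refer to a chart. Both measures are positive because
  the domain lies below the first graph in direction e.\<close>

lemma chart_normal_measure_eq:
  fixes \<Omega> :: "'a::euclidean_space set"
  assumes \<Omega>: "\<Omega> \<in> sets borel"
    and 1: "lipschitz_chart \<Omega> U e g" and 2: "lipschitz_chart \<Omega> U' e' g'"
    and W: "open W" "W \<subseteq> U \<inter> U'" "W \<subseteq> ball 0 R"
  shows "density (normal_measure e e g) (indicator W) =
         density (normal_measure e e' g') (indicator W)"
proof (rule measure_eqI_Lipschitz_tests)
  obtain L where "lipschitz_graph e g L" using lipschitz_chartD(3)[OF 1] by blast
  then interpret G: lipschitz_graph e g L .
  obtain L' where "lipschitz_graph e' g' L'" using lipschitz_chartD(3)[OF 2] by blast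
  then interpret G': lipschitz_graph e' g' L' .
  show "bounded W" using W(3) bounded_ball bounded_subset by blast
  show "open W" by fact
  have [measurable]: "W \<in> sets borel" using W by simp
  have "emeasure (normal_measure e e g) W
      = (\<integral>\<^sup>+y. ennreal (e \<bullet> graph_normal e g y) * indicator W y \<partial>graph_measure e g)"
    by (rule emeasure_density) auto
  also have "\<dots> \<le> (\<integral>\<^sup>+y. indicator (ball 0 R) y \<partial>graph_measure e g)"
  proof (rule nn_integral_mono_AE)
    show "AE y in graph_measure e g. ennreal (e \<bullet> graph_normal e g y) * indicator W y \<le> indicator (ball 0 R) y"
      using G.AE_graph_measure_GDERIV
    proof eventually_elim
      case (elim y)
      have "e \<bullet> graph_normal e g y \<le> 1"
        using norm_cauchy_schwarz[of e "graph_normal e g y"] G.e G.graph_normal_GDERIV(1) elim by simp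
      then show ?case using W(3) by (auto simp: indicator_def ennreal_le_1 simp del: mem_ball)
    qed
  qed
  also have "\<dots> = emeasure (graph_measure e g) (ball 0 R)" by simp
  also have "\<dots> < \<infinity>" by (rule G.graph_measure_ball_finite)
  finally show "emeasure (normal_measure e e g) W < \<infinity>" .
  fix \<phi> :: "'a \<Rightarrow> real" and K
  assume \<phi>: "K-lipschitz_on UNIV \<phi>" "\<And>x. 0 \<le> \<phi> x \<and> \<phi> x \<le> 1" "\<And>x. x \<notin> W \<Longrightarrow> \<phi> x = 0"
  have [measurable]: "\<phi> \<in> borel_measurable borel"
    using \<phi> by (intro lipschitz_on_borel)
  have z: "x \<notin> ball 0 R \<Longrightarrow> \<phi> x = 0" "x \<notin> U \<Longrightarrow> \<phi> x = 0" "x \<notin> U' \<Longrightarrow> \<phi> x = 0" for x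
    using \<phi>(3) W by blast+
  note d1 = chart_divergence[OF 1 \<Omega> \<phi>(1,2) z(1,2), where v=e]
  note d2 = chart_divergence[OF 2 \<Omega> \<phi>(1,2) z(1,3), where v=e]
  have "(\<integral>\<^sup>+y. ennreal (\<phi> y) \<partial>normal_measure e e g)
      = (\<integral>\<^sup>+y. ennreal (e \<bullet> graph_normal e g y) * ennreal (\<phi> y) \<partial>graph_measure e g)"
    by (rule nn_integral_density) auto
  also have "\<dots> = (\<integral>\<^sup>+y. ennreal (\<phi> y * (e \<bullet> graph_normal e g y)) \<partial>graph_measure e g)"
    using \<phi>(2) by (intro nn_integral_cong) (simp add: ennreal_mult' mult.commute)
  also have "\<dots> = ennreal (\<integral>y. \<phi> y * (e \<bullet> graph_normal e g y) \<partial>graph_measure e g)"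
  proof (rule nn_integral_eq_integral[OF d1(1)])
    show "AE y in graph_measure e g. 0 \<le> \<phi> y * (e \<bullet> graph_normal e g y)"
      using G.AE_graph_measure_GDERIV
      by eventually_elim (use \<phi>(2) G.graph_normal_GDERIV(2) in \<open>auto intro!: mult_nonneg_nonneg intro: less_imp_le\<close>)
  qed
  also have "(\<integral>y. \<phi> y * (e \<bullet> graph_normal e g y) \<partial>graph_measure e g) = (\<integral>y. \<phi> y * (e \<bullet> graph_normal e' g' y) \<partial>graph_measure e' g')"
    using d1(2) d2(2) by simp
  also have "ennreal \<dots> = (\<integral>\<^sup>+y. ennreal (\<phi> y * (e \<bullet> graph_normal e' g' y)) \<partial>graph_measure e' g')"
  proof (rule nn_integral_eq_integral[OF d2(1), symmetric])
    show "AE y in graph_measure e' g'. 0 \<le> \<phi> y * (e \<bullet> graph_normal e' g' y)"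
      using G'.AE_graph_measure_GDERIV
    proof eventually_elim
      case (elim y)
      show ?case
      proof (cases "y \<in> W")
        case True
        then have y: "y \<in> U" "y \<in> U'" using W by auto
        have "y \<in> frontier \<Omega>" using chart_frontier[OF 2 y(2)] elim by blast
        then have "e \<bullet> (e' - dgrad g' y) \<ge> 0" using chart_inner_normal_nonneg[OF 1 y(1) 2 y(2)] elim by blast
        then show ?thesis using \<phi>(2)[of y] graph_density_pos[of g' y] by (simp add: graph_normal_def)
      qed (simp add: \<phi>(3))
    qed
  qed
  also have "\<dots> = (\<integral>\<^sup>+y. ennreal (e \<bullet> graph_normal e' g' y) * ennreal (\<phi> y) \<partial>graph_measure e' g')"
    using \<phi>(2) by (intro nn_integral_cong) (simp add: ennreal_mult' mult.commute)
  also have "\<dots> = (\<integral>\<^sup>+y. ennreal (\<phi> y) \<partial>normal_measure e e' g')"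
    by (rule nn_integral_density[symmetric]) auto
  finally show "(\<integral>\<^sup>+y. ennreal (\<phi> y) \<partial>normal_measure e e g) =
     (\<integral>\<^sup>+y. ennreal (\<phi> y) \<partial>normal_measure e e' g')" .
next
  obtain L where "lipschitz_graph e g L" using lipschitz_chartD(3)[OF 1] by blast
  then interpret G: lipschitz_graph e g L .
  obtain L' where "lipschitz_graph e' g' L'" using lipschitz_chartD(3)[OF 2] by blast
  then interpret G': lipschitz_graph e' g' L' .
  show "sets (normal_measure e e g) = sets borel"
    "sets (normal_measure e e' g') = sets borel" by simp_all
qed

subsection \<open>Existence and uniqueness of the surface measure\<close>

text \<open>The bad set of \<open>g'\<close> is null for its own graph measure, hence has normal
  mass 0 there and, since the normal components in direction \<open>e\<close> agree, also on the
  first graph. On the first graph the component \<open>e \<bullet> graph_normal e g y\<close> is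
  positive almost everywhere, so the set itself is null.\<close>

lemma chart_null_nondifferentiable:
  fixes \<Omega> :: "'a::euclidean_space set"
  assumes \<Omega>: "\<Omega> \<in> sets borel"
    and 1: "lipschitz_chart \<Omega> U e g" and 2: "lipschitz_chart \<Omega> U' e' g'"
  shows "AE y in graph_measure e g. y \<in> U \<inter> U' \<inter> ball 0 R \<longrightarrow> GDERIV g' y :> dgrad g' y"
proof -
  obtain L where "lipschitz_graph e g L" using lipschitz_chartD(3)[OF 1] by blast
  then interpret G: lipschitz_graph e g L .
  obtain L' where "lipschitz_graph e' g' L'" using lipschitz_chartD(3)[OF 2] by blast
  then interpret G': lipschitz_graph e' g' L' .
  define W where "W = U \<inter> U' \<inter> ball 0 R"
  have W: "open W" "W \<subseteq> U \<inter> U'" "W \<subseteq> ball 0 R"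
    using lipschitz_chartD(1)[OF 1] lipschitz_chartD(1)[OF 2] by (auto simp: W_def)
  have [measurable]: "W \<in> sets borel" using W by simp
  have [measurable]: "Measurable.pred borel (\<lambda>y. GDERIV g' y :> dgrad g' y)"
    by (rule sets_GDERIV[OF G'.g]) measurable
  define X where "X = {y \<in> W. \<not> GDERIV g' y :> dgrad g' y}"
  have X[measurable]: "X \<in> sets borel" unfolding X_def by measurable
  have dens: "emeasure (density (normal_measure e a h) (indicator W)) X =
      (\<integral>\<^sup>+y. ennreal (e \<bullet> graph_normal a h y) * indicator X y \<partial>graph_measure a h)" if "lipschitz_graph a h C" for a h C
  proof -
    interpret lipschitz_graph a h C by fact
    have "emeasure (density (normal_measure e a h) (indicator W)) X =
       (\<integral>\<^sup>+y. indicator W y * indicator X y \<partial>normal_measure e a h)"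
      by (rule emeasure_density) (auto intro!: borel_measurable_indicator)
    also have "\<dots> = (\<integral>\<^sup>+y. indicator X y \<partial>normal_measure e a h)"
      by (intro nn_integral_cong) (auto simp: X_def indicator_def)
    also have "\<dots> = (\<integral>\<^sup>+y. ennreal (e \<bullet> graph_normal a h y) * indicator X y \<partial>graph_measure a h)"
      by (rule nn_integral_density) (auto intro!: borel_measurable_indicator)
    finally show ?thesis .
  qed
  have "(\<integral>\<^sup>+y. ennreal (e \<bullet> graph_normal e g y) * indicator X y \<partial>graph_measure e g) =
        (\<integral>\<^sup>+y. ennreal (e \<bullet> graph_normal e' g' y) * indicator X y \<partial>graph_measure e' g')"
    using chart_normal_measure_eq[OF \<Omega> 1 2 W] dens[OF G.lipschitz_graph_axioms] dens[OF G'.lipschitz_graph_axioms] by simp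
  also have "\<dots> = (\<integral>\<^sup>+y. 0 \<partial>graph_measure e' g')"
  proof (rule nn_integral_cong_AE)
    show "AE y in graph_measure e' g'. ennreal (e \<bullet> graph_normal e' g' y) * indicator X y = 0"
      using G'.AE_graph_measure_GDERIV by eventually_elim (simp add: X_def)
  qed
  finally have "(\<integral>\<^sup>+y. ennreal (e \<bullet> graph_normal e g y) * indicator X y \<partial>graph_measure e g) = 0" by simp
  then have "AE y in graph_measure e g. ennreal (e \<bullet> graph_normal e g y) * indicator X y = 0"
    by (subst (asm) nn_integral_0_iff_AE) auto
  then show ?thesis using G.AE_graph_measure_GDERIV
  proof eventually_elim
    case (elim y)
    then show ?case using G.graph_normal_GDERIV(2)[of y] by (auto simp: X_def W_def indicator_def split: if_splits)
  qed
qed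

text \<open>Where both functions are differentiable, the normals agree, so both graph measures are
  recovered from the common normal measure by dividing by the same positive weight. What is left of
  \<open>A\<close> is null for either measure, by the preceding result used in both orders.\<close>

lemma chart_graph_measure_eq:
  fixes \<Omega> :: "'a::euclidean_space set"
  assumes \<Omega>: "\<Omega> \<in> sets borel"
    and 1: "lipschitz_chart \<Omega> U e g" and 2: "lipschitz_chart \<Omega> U' e' g'"
    and A[measurable]: "A \<in> sets borel" and AU: "A \<subseteq> U \<inter> U' \<inter> ball 0 R"
  shows "emeasure (graph_measure e g) A = emeasure (graph_measure e' g') A"
proof -
  obtain L where "lipschitz_graph e g L" using lipschitz_chartD(3)[OF 1] by blast
  then interpret G: lipschitz_graph e g L .
  obtain L' where "lipschitz_graph e' g' L'" using lipschitz_chartD(3)[OF 2] by blast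
  then interpret G': lipschitz_graph e' g' L' .
  define W where "W = U \<inter> U' \<inter> ball 0 R"
  have W: "open W" "W \<subseteq> U \<inter> U'" "W \<subseteq> ball 0 R"
    using lipschitz_chartD(1)[OF 1] lipschitz_chartD(1)[OF 2] by (auto simp: W_def)
  have [measurable]: "W \<in> sets borel" using W by simp
  have [measurable]: "Measurable.pred borel (\<lambda>y. GDERIV g' y :> dgrad g' y)"
    by (rule sets_GDERIV[OF G'.g]) measurable
  have [measurable]: "Measurable.pred borel (\<lambda>y. GDERIV g y :> dgrad g y)"
    by (rule sets_GDERIV[OF G.g]) measurable
  define B where "B = {y \<in> A. y \<bullet> e = g y \<and> GDERIV g y :> dgrad g y \<and> GDERIV g' y :> dgrad g' y}"
  have B[measurable]: "B \<in> sets borel" unfolding B_def by measurable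
  have N: "graph_normal e g y = graph_normal e' g' y" "e \<bullet> graph_normal e g y > 0" "y \<in> W" if "y \<in> B" for y
  proof -
    have y: "y \<in> U" "y \<in> U'" "y \<in> W" using that AU by (auto simp: B_def W_def)
    moreover have "y \<in> frontier \<Omega>" using that chart_frontier[OF 1 y(1)] by (auto simp: B_def)
    ultimately show "graph_normal e g y = graph_normal e' g' y"
      using chart_normal_unique[OF 1 y(1) _ 2 y(2), of "dgrad g y" "dgrad g' y"] that
      by (simp add: B_def graph_normal_def graph_density_def)
    show "e \<bullet> graph_normal e g y > 0" using that G.graph_normal_GDERIV(2) by (auto simp: B_def)
    show "y \<in> W" by fact
  qed
  \<comment> \<open>One weight for both graphs: on \<open>B\<close> it is also the normal component
    of the second graph.\<close>
  define w where "w y = ennreal (e \<bullet> graph_normal e g y)" for y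
  have [measurable]: "w \<in> borel_measurable borel" unfolding w_def by measurable
  have int: "(\<integral>\<^sup>+y. indicator B y / w y \<partial>density (normal_measure e a h) (indicator W)) =
      emeasure (graph_measure a h) B"
    if "lipschitz_graph a h C" and eq: "\<And>y. y \<in> B \<Longrightarrow> graph_normal a h y = graph_normal e g y" for a h C
  proof -
    interpret lipschitz_graph a h C by fact
    have "(\<integral>\<^sup>+y. indicator B y / w y \<partial>density (normal_measure e a h) (indicator W)) =
      (\<integral>\<^sup>+y. indicator W y * (indicator B y / w y) \<partial>normal_measure e a h)"
      by (rule nn_integral_density) (auto intro!: borel_measurable_indicator)
    also have "\<dots> = (\<integral>\<^sup>+y. ennreal (e \<bullet> graph_normal a h y) * (indicator W y * (indicator B y / w y)) \<partial>graph_measure a h)"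
      by (rule nn_integral_density) (auto intro!: borel_measurable_indicator borel_measurable_times_ennreal)
    also have "\<dots> = (\<integral>\<^sup>+y. indicator B y \<partial>graph_measure a h)"
    proof (rule nn_integral_cong)
      fix y
      show "ennreal (e \<bullet> graph_normal a h y) * (indicator W y * (indicator B y / w y)) = indicator B y"
      proof (cases "y \<in> B")
        case True
        then have "w y \<noteq> 0" "w y < top" using N(2)[OF True] by (auto simp: w_def ennreal_eq_0_iff)
        then show ?thesis using True eq[OF True] N(3)[OF True]
          by (simp add: w_def[symmetric] ennreal_times_divide ennreal_divide_self)
      qed simp
    qed
    finally show ?thesis by simp
  qed
  have BB: "emeasure (graph_measure e g) B = emeasure (graph_measure e' g') B"
    using int[OF G.lipschitz_graph_axioms] int[OF G'.lipschitz_graph_axioms N(1)[symmetric]]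
    unfolding chart_normal_measure_eq[OF \<Omega> 1 2 W] by simp
  have "emeasure (graph_measure e g) A = emeasure (graph_measure e g) B"
  proof (rule emeasure_eq_AE)
    show "AE y in graph_measure e g. y \<in> A \<longleftrightarrow> y \<in> B"
      using chart_null_nondifferentiable[OF \<Omega> 1 2, of R] G.AE_graph_measure_GDERIV
      by eventually_elim (use AU in \<open>auto simp: B_def\<close>)
  qed auto
  moreover have "emeasure (graph_measure e' g') A = emeasure (graph_measure e' g') B"
  proof (rule emeasure_eq_AE)
    show "AE y in graph_measure e' g'. y \<in> A \<longleftrightarrow> y \<in> B"
      using chart_null_nondifferentiable[OF \<Omega> 2 1, of R] G'.AE_graph_measure_GDERIV
    proof eventually_elim
      case (elim y)
      \<comment> \<open>A point of the second graph in \<open>U'\<close> is a frontier point, hence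
        lies on the first graph as well.\<close>
      have "y \<bullet> e = g y" if "y \<in> A"
        using that AU elim chart_frontier[OF 1, of y] chart_frontier[OF 2, of y] by blast
      then show ?case using elim AU by (auto simp: B_def)
    qed
  qed auto
  ultimately show ?thesis using BB by simp
qed

text \<open>Compactness of the frontier gives finitely many charts; subtracting the earlier ones
  makes the pieces disjoint. Borel pieces suffice for measures and normals; the divergence identity
  will need a Lipschitz partition instead.\<close>

lemma finite_chart_partition:
  fixes \<Omega> :: "'a::euclidean_space set"
  assumes "bounded \<Omega>" "lipschitz_boundary \<Omega>"
  obtains n and U D :: "nat \<Rightarrow> 'a set" and e g where
    "\<And>k. k < n \<Longrightarrow> lipschitz_chart \<Omega> (U k) (e k) (g k)" "\<And>k. k < n \<Longrightarrow> D k \<in> sets borel" "\<And>k. D k \<subseteq> U k"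
    "disjoint_family_on D {..<n}" "(\<Union>k<n. D k) = frontier \<Omega>"
proof -
  have cpt: "compact (frontier \<Omega>)" using assms(1) by (rule compact_frontier_bounded)
  have "\<forall>q\<in>frontier \<Omega>. \<exists>c. q \<in> fst c \<and> lipschitz_chart \<Omega> (fst c) (fst (snd c)) (snd (snd c))"
    using assms(2) unfolding lipschitz_boundary_def by force
  then obtain c where c: "\<And>q. q \<in> frontier \<Omega> \<Longrightarrow> q \<in> fst (c q) \<and> lipschitz_chart \<Omega> (fst (c q)) (fst (snd (c q))) (snd (snd (c q)))"
    by metis
  obtain F where F: "F \<subseteq> frontier \<Omega>" "finite F" "frontier \<Omega> \<subseteq> (\<Union>q\<in>F. fst (c q))"
  proof (rule compactE_image[OF cpt])
    show "open (fst (c q))" if "q \<in> frontier \<Omega>" for q using c[OF that] lipschitz_chartD(1) by blast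
    show "frontier \<Omega> \<subseteq> (\<Union>q\<in>frontier \<Omega>. fst (c q))" using c by blast
  qed blast
  obtain f and n :: nat where f: "F = f ` {..<n}" using finite_imp_nat_seg_image_inj_on[OF F(2)] lessThan_def by metis
  define U where "U k = fst (c (f k))" for k
  have ch: "lipschitz_chart \<Omega> (U k) (fst (snd (c (f k)))) (snd (snd (c (f k))))" if "k < n" for k
    using c[of "f k"] F(1) f that by (auto simp: U_def)
  have cov: "frontier \<Omega> \<subseteq> (\<Union>k<n. U k)" using F(3) f by (auto simp: U_def)
  have Ub: "U k \<in> sets borel" if "k < n" for k using lipschitz_chartD(1)[OF ch[OF that]] by simp
  define D where "D k = (U k - (\<Union>j<k. U j)) \<inter> frontier \<Omega>" for k
  show thesis
  proof (rule that[of n U _ _ D, OF ch])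
    show "D k \<in> sets borel" if "k < n" for k
      unfolding D_def using that Ub by (intro sets.Int sets.Diff sets.finite_UN) (auto simp: borel_closed)
    show "disjoint_family_on D {..<n}"
      unfolding disjoint_family_on_def
    proof (intro ballI impI)
      fix i j :: nat assume "i \<noteq> j"
      then have "i < j \<or> j < i" by linarith
      then show "D i \<inter> D j = {}" unfolding D_def by blast
    qed
    show "(\<Union>k<n. D k) = frontier \<Omega>"
    proof
      show "frontier \<Omega> \<subseteq> (\<Union>k<n. D k)"
      proof
        fix x assume x: "x \<in> frontier \<Omega>"
        then obtain k where k: "k < n" "x \<in> U k" using cov by auto
        define i where "i = (LEAST i. x \<in> U i)"
        have "x \<in> U i" "i \<le> k" unfolding i_def using k by (auto intro: LeastI Least_le)
        moreover have "x \<notin> U j" if "j < i" for j using that not_less_Least unfolding i_def by blast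
        ultimately show "x \<in> (\<Union>k<n. D k)" using x k by (auto simp: D_def intro!: bexI[of _ i])
      qed
    qed (auto simp: D_def)
  qed (auto simp: D_def)
qed

locale lipschitz_domain =
  fixes \<Omega> :: "'a::euclidean_space set"
  assumes open_\<Omega>: "open \<Omega>" and bounded_\<Omega>: "bounded \<Omega>" and boundary: "lipschitz_boundary \<Omega>"
begin

lemma \<Omega>_borel[measurable]: "\<Omega> \<in> sets borel" using open_\<Omega> by simp

lemma frontier_borel[measurable]: "frontier \<Omega> \<in> sets borel" by (simp add: borel_closed)

lemma closure_bound: obtains R where "closure \<Omega> \<subseteq> ball 0 R" "frontier \<Omega> \<subseteq> ball 0 R"
proof -
  obtain R where "closure \<Omega> \<subseteq> ball 0 R" using bounded_closure[OF bounded_\<Omega>] bounded_subset_ballD by blast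
  then show thesis by (intro that) (auto simp: frontier_def)
qed

text \<open>The chart condition on the pieces \<open>D k\<close>, together with the null complement
  of the frontier, leaves only the sum of the graph measures on the pieces. That this sum satisfies
  the condition for every other chart is the agreement of graph measures on overlaps. Bounded pieces
  make it finite.\<close>

lemma ex1_surface_measure: "\<exists>!\<sigma>. is_surface_measure \<Omega> \<sigma>"
  and surface_measure_finite: "is_surface_measure \<Omega> \<sigma> \<Longrightarrow> emeasure \<sigma> UNIV < \<infinity>"
proof -
  obtain n and U D :: "nat \<Rightarrow> 'a set" and e g where
    ch: "\<And>k. k < n \<Longrightarrow> lipschitz_chart \<Omega> (U k) (e k) (g k)" and Db: "\<And>k. k < n \<Longrightarrow> D k \<in> sets borel"
    and D: "\<And>k. D k \<subseteq> U k" "disjoint_family_on D {..<n}" and Dcov: "(\<Union>k<n. D k) = frontier \<Omega>"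
    by (rule finite_chart_partition[OF bounded_\<Omega> boundary]) (rule that)
  obtain R where R: "frontier \<Omega> \<subseteq> ball 0 R" by (rule closure_bound)
  let ?m = "\<lambda>k. graph_measure (e k) (g k)"
  have DU: "D k \<subseteq> U k" "D k \<subseteq> ball 0 R" if "k < n" for k
    using R Dcov D(1) that by blast+
  note Ddis = D(2)
  \<comment> \<open>Any surface measure has this form, which gives both uniqueness and
    finiteness.\<close>
  have repr: "emeasure \<sigma> A = (\<Sum>k<n. emeasure (?m k) (A \<inter> D k))"
    if \<sigma>: "is_surface_measure \<Omega> \<sigma>" and A: "A \<in> sets borel" for \<sigma> A
  proof -
    have s: "sets \<sigma> = sets borel" and z: "emeasure \<sigma> (- frontier \<Omega>) = 0"
      and loc: "\<And>U e g A. lipschitz_chart \<Omega> U e g \<Longrightarrow> A \<in> sets borel \<Longrightarrow> A \<subseteq> U \<Longrightarrow> emeasure \<sigma> A = emeasure (graph_measure e g) A"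
      using \<sigma> by (auto simp: is_surface_measure_def)
    have nf: "- frontier \<Omega> \<in> null_sets \<sigma>" using z s frontier_borel by (auto simp: null_sets_def intro: sets.compl_sets)
    have "emeasure \<sigma> A = emeasure \<sigma> (A \<inter> frontier \<Omega>)"
    proof (rule emeasure_eq_AE)
      show "AE x in \<sigma>. x \<in> A \<longleftrightarrow> x \<in> A \<inter> frontier \<Omega>" using AE_not_in[OF nf] by eventually_elim auto
    qed (use A s in auto)
    also have "A \<inter> frontier \<Omega> = (\<Union>k<n. A \<inter> D k)" using Dcov by blast
    also have "emeasure \<sigma> \<dots> = (\<Sum>k<n. emeasure \<sigma> (A \<inter> D k))"
    proof (rule sum_emeasure[symmetric])
      show "(\<lambda>k. A \<inter> D k) ` {..<n} \<subseteq> sets \<sigma>" using A Db s by auto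
      show "disjoint_family_on (\<lambda>k. A \<inter> D k) {..<n}" using Ddis unfolding disjoint_family_on_def by blast
    qed simp
    also have "\<dots> = (\<Sum>k<n. emeasure (?m k) (A \<inter> D k))"
    proof (rule sum.cong[OF refl])
      fix k assume "k \<in> {..<n}"
      then show "emeasure \<sigma> (A \<inter> D k) = emeasure (?m k) (A \<inter> D k)"
        using A Db D(1) by (intro loc[OF ch]) auto
    qed
    finally show ?thesis .
  qed
  have sm: "sets (?m k) = sets borel" if "k < n" for k
    using lipschitz_chartD(3)[OF ch[OF that]] lipschitz_graph.sets_graph_measure by blast
  define S where "S A = (\<Sum>k<n. emeasure (?m k) (A \<inter> D k))" for A
  define \<sigma> where "\<sigma> = measure_of UNIV (sets borel) S"
  have s\<sigma>: "sets \<sigma> = sets borel" unfolding \<sigma>_def using sets.sigma_sets_eq[of borel] by simp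
  have e\<sigma>: "emeasure \<sigma> A = S A" if "A \<in> sets borel" for A
  proof (rule emeasure_measure_of[OF \<sigma>_def])
    show "countably_additive (sets \<sigma>) S"
      unfolding countably_additive_def s\<sigma>
    proof (intro allI impI)
      fix A :: "nat \<Rightarrow> 'a set" assume A: "range A \<subseteq> sets borel" "disjoint_family A" "\<Union> (range A) \<in> sets borel"
      have "(\<Sum>i. S (A i)) = (\<Sum>k<n. \<Sum>i. emeasure (?m k) (A i \<inter> D k))"
        unfolding S_def by (rule suminf_sum) auto
      also have "\<dots> = (\<Sum>k<n. emeasure (?m k) (\<Union> (range A) \<inter> D k))"
      proof (rule sum.cong[OF refl])
        fix k assume k: "k \<in> {..<n}"
        have "(\<Sum>i. emeasure (?m k) (A i \<inter> D k)) = emeasure (?m k) (\<Union>i. A i \<inter> D k)"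
        proof (rule suminf_emeasure)
          show "range (\<lambda>i. A i \<inter> D k) \<subseteq> sets (?m k)" using A Db k sm by auto
          show "disjoint_family (\<lambda>i. A i \<inter> D k)" using A(2) unfolding disjoint_family_on_def by blast
        qed
        then show "(\<Sum>i. emeasure (?m k) (A i \<inter> D k)) = emeasure (?m k) (\<Union> (range A) \<inter> D k)" by simp
      qed
      finally show "(\<Sum>i. S (A i)) = S (\<Union> (range A))" by (simp add: S_def)
    qed
  qed (use that s\<sigma> in \<open>auto simp: positive_def S_def\<close>)
  have ism: "is_surface_measure \<Omega> \<sigma>"
    unfolding is_surface_measure_def
  proof (intro conjI allI impI ballI)
    have "- frontier \<Omega> \<inter> D k = {}" if "k < n" for k using Dcov that by blast
    moreover have "- frontier \<Omega> \<in> sets borel" by auto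
    ultimately show "emeasure \<sigma> (- frontier \<Omega>) = 0" by (simp add: e\<sigma> S_def)
    fix V a h A assume V: "lipschitz_chart \<Omega> V a h" and A: "A \<in> sets borel" "A \<subseteq> V"
    obtain L where "lipschitz_graph a h L" using lipschitz_chartD(3)[OF V] by blast
    then interpret lipschitz_graph a h L .
    have "emeasure \<sigma> A = (\<Sum>k<n. emeasure (?m k) (A \<inter> D k))" using A by (simp add: e\<sigma> S_def)
    also have "\<dots> = (\<Sum>k<n. emeasure (graph_measure a h) (A \<inter> D k))"
    proof (rule sum.cong[OF refl])
      fix k assume "k \<in> {..<n}"
      then show "emeasure (?m k) (A \<inter> D k) = emeasure (graph_measure a h) (A \<inter> D k)"
        using A Db DU by (intro chart_graph_measure_eq[OF \<Omega>_borel ch V, where R=R]) (auto simp del: mem_ball dest: subsetD[OF D(1)] subsetD[OF DU(2)])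
    qed
    also have "\<dots> = emeasure (graph_measure a h) (\<Union>k<n. A \<inter> D k)"
    proof (rule sum_emeasure)
      show "(\<lambda>k. A \<inter> D k) ` {..<n} \<subseteq> sets (graph_measure a h)" using A Db by auto
      show "disjoint_family_on (\<lambda>k. A \<inter> D k) {..<n}" using Ddis unfolding disjoint_family_on_def by blast
    qed simp
    also have "(\<Union>k<n. A \<inter> D k) = A \<inter> frontier \<Omega>" using Dcov by blast
    \<comment> \<open>The graph measure is carried by the graph, and inside \<open>V\<close> the
      graph is the frontier.\<close>
    also have "emeasure (graph_measure a h) (A \<inter> frontier \<Omega>) = emeasure (graph_measure a h) A"
    proof (rule emeasure_eq_AE)
      show "AE x in graph_measure a h. x \<in> A \<inter> frontier \<Omega> \<longleftrightarrow> x \<in> A"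
        using AE_graph_measure_GDERIV
        by eventually_elim (use A chart_frontier[OF V] in blast)
    qed (use A in auto)
    finally show "emeasure \<sigma> A = emeasure (graph_measure a h) A" .
  qed (fact s\<sigma>)
  moreover have "\<sigma>' = \<sigma>" if "is_surface_measure \<Omega> \<sigma>'" for \<sigma>'
  proof (rule measure_eqI)
    show "sets \<sigma>' = sets \<sigma>" using that s\<sigma> by (simp add: is_surface_measure_def)
    fix A assume "A \<in> sets \<sigma>'"
    then have "A \<in> sets borel" using that by (simp add: is_surface_measure_def)
    then show "emeasure \<sigma>' A = emeasure \<sigma> A" using repr that ism by simp
  qed
  ultimately show "\<exists>!\<sigma>. is_surface_measure \<Omega> \<sigma>" by blast
  show "emeasure \<sigma>' UNIV < \<infinity>" if "is_surface_measure \<Omega> \<sigma>'" for \<sigma>'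
  proof -
    have "emeasure (?m k) (UNIV \<inter> D k) < \<infinity>" if k: "k < n" for k
    proof -
      obtain L where "lipschitz_graph (e k) (g k) L" using lipschitz_chartD(3)[OF ch[OF k]] by blast
      then interpret lipschitz_graph "e k" "g k" L .
      have "emeasure (?m k) (D k) \<le> emeasure (?m k) (ball 0 R)" by (rule emeasure_mono[OF DU(2)[OF k]]) simp
      then show ?thesis using graph_measure_ball_finite[of R] by simp
    qed
    then show ?thesis using repr[OF that, of UNIV] by simp
  qed
qed

end

subsection \<open>The divergence theorem\<close>

lemma lipschitz_on_mult_bounded:
  fixes f g :: "'a::metric_space \<Rightarrow> real"
  assumes f: "K-lipschitz_on UNIV f" "\<And>x. \<bar>f x\<bar> \<le> A" and g: "L-lipschitz_on UNIV g" "\<And>x. \<bar>g x\<bar> \<le> B"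
  shows "(A * L + B * K)-lipschitz_on UNIV (\<lambda>x. f x * g x)"
proof (rule lipschitz_onI)
  have A: "0 \<le> A" using f(2) abs_ge_zero order_trans by blast
  have B: "0 \<le> B" using g(2) abs_ge_zero order_trans by blast
  show "0 \<le> A * L + B * K" using A B lipschitz_on_nonneg[OF f(1)] lipschitz_on_nonneg[OF g(1)] by simp
  fix x y
  have "f x * g x - f y * g y = f x * (g x - g y) + g y * (f x - f y)" by (simp add: algebra_simps)
  then have "\<bar>f x * g x - f y * g y\<bar> \<le> \<bar>f x\<bar> * \<bar>g x - g y\<bar> + \<bar>g y\<bar> * \<bar>f x - f y\<bar>"
    by (metis abs_mult abs_triangle_ineq)
  also have "\<dots> \<le> A * (L * dist x y) + B * (K * dist x y)"
    using lipschitz_onD[OF f(1), of x y] lipschitz_onD[OF g(1), of x y] A B f(2) g(2)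
    by (intro add_mono mult_mono) (auto simp: dist_real_def)
  finally show "dist (f x * g x) (f y * g y) \<le> (A * L + B * K) * dist x y"
    by (simp add: dist_real_def algebra_simps)
qed

lemma lipschitz_on_inverse_real:
  fixes f :: "'a::metric_space \<Rightarrow> real"
  assumes f: "K-lipschitz_on UNIV f" and c: "c > 0" "\<And>x. c \<le> f x"
  shows "(K / c\<^sup>2)-lipschitz_on UNIV (\<lambda>x. 1 / f x)"
proof (rule lipschitz_onI)
  show "0 \<le> K / c\<^sup>2" using lipschitz_on_nonneg[OF f] by simp
  fix x y
  have pos: "f x > 0" "f y > 0" using c less_le_trans by blast+
  have "1 / f x - 1 / f y = (f y - f x) / (f x * f y)" using pos by (simp add: field_simps)
  then have "\<bar>1 / f x - 1 / f y\<bar> = \<bar>f x - f y\<bar> / (f x * f y)"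
    using pos by (simp add: abs_mult abs_minus_commute)
  also have "\<dots> \<le> (K * dist x y) / c\<^sup>2"
    using lipschitz_onD[OF f, of x y] pos c lipschitz_on_nonneg[OF f] unfolding power2_eq_square
    by (intro frac_le mult_mono) (auto simp: dist_real_def)
  finally show "dist (1 / f x) (1 / f y) \<le> K / c\<^sup>2 * dist x y" by (simp add: dist_real_def)
qed

lemma lipschitz_on_sum_real:
  fixes f :: "'i \<Rightarrow> 'a::metric_space \<Rightarrow> real"
  assumes "finite F" "\<And>i. i \<in> F \<Longrightarrow> \<exists>K. K-lipschitz_on UNIV (f i)"
  shows "\<exists>K. K-lipschitz_on UNIV (\<lambda>x. \<Sum>i\<in>F. f i x)"
  using assms
proof induction
  case empty
  show ?case by (intro exI[of _ 0]) (simp add: lipschitz_on_constant)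
next
  case (insert i F)
  then obtain K L where "K-lipschitz_on UNIV (f i)" "L-lipschitz_on UNIV (\<lambda>x. \<Sum>i\<in>F. f i x)" by (meson insertI1 insertI2)
  then have "(K + L)-lipschitz_on UNIV (\<lambda>x. f i x + (\<Sum>i\<in>F. f i x))" by (rule lipschitz_on_add)
  then show ?case using insert.hyps by auto
qed

text \<open>The subgraph identity for the constant function \<open>R\<close>: this hyperplane lies
  beyond the support of \<open>\<phi>\<close>, so the half-space below it carries the whole integral
  and the boundary term is 0.\<close>

lemma integral_dir_deriv_eq_0:
  fixes \<phi> :: "'a::euclidean_space \<Rightarrow> real"
  assumes \<phi>: "K-lipschitz_on UNIV \<phi>" and M: "\<And>x. 0 \<le> \<phi> x \<and> \<phi> x \<le> M" and R: "\<And>x. x \<notin> ball 0 R \<Longrightarrow> \<phi> x = 0"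
  shows "(\<integral>x. dir_deriv \<phi> v x \<partial>lborel) = 0"
proof -
  obtain e :: 'a where e: "e \<in> Basis" using nonempty_Basis by blast
  then have e1: "norm e = 1" and ee: "e \<bullet> e = 1" by simp_all
  have [measurable]: "\<phi> \<in> borel_measurable borel"
    using \<phi> by (intro lipschitz_on_borel)
  have M': "\<bar>\<phi> x\<bar> \<le> M" for x using M[of x] by simp
  have far: "\<phi> x = 0" if "x \<bullet> e \<ge> R" for x
    using that Basis_le_norm[OF e, of x] by (intro R) auto
  have "AE x in lborel. dir_deriv \<phi> v x = indicator {x. x \<bullet> e < R} x * dir_deriv \<phi> v x"
    using lipschitz_AE_has_dir_deriv[OF \<phi>, of v]
  proof eventually_elim
    case (elim x)
    show ?case using dir_deriv_zero_at_min[OF elim] M far[of x] by (cases "x \<bullet> e < R") auto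
  qed
  then have "(\<integral>x. dir_deriv \<phi> v x \<partial>lborel) = (\<integral>x. indicator {x. x \<bullet> e < R} x * dir_deriv \<phi> v x \<partial>lborel)"
    by (intro integral_cong_AE) auto
  also have "\<dots> = (\<integral>x. indicator (unit_slab e) x * (\<phi> (x + (R - x \<bullet> e) *\<^sub>R e) * (v \<bullet> e - dir_deriv (\<lambda>_. R) v x)) \<partial>lborel)"
    by (rule subgraph_integral_dir_deriv(2)[OF e1 lipschitz_on_constant _ \<phi> M' R]) auto
  also have "\<dots> = 0"
    by (simp add: far inner_add_left ee)
  finally show ?thesis .
qed

section \<open>Surface measure with a Borel unit normal\<close>

context lipschitz_domain
begin

text \<open>The Borel surface measure before completion. Integrals are computed here and passed to
  the completion only at the end.\<close>

definition surf :: "'a measure" where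
  "surf = (THE \<sigma>. is_surface_measure \<Omega> \<sigma>)"

lemma is_surface_measure_surf: "is_surface_measure \<Omega> surf"
  unfolding surf_def by (rule theI'[OF ex1_surface_measure])

lemma surface_measure_surf: "surface_measure \<Omega> = completion surf"
  by (simp add: surface_measure_def surf_def)

lemma sets_surf[simp, measurable_cong]: "sets surf = sets borel"
  using is_surface_measure_surf by (simp add: is_surface_measure_def)

lemma space_surf[simp]: "space surf = UNIV"
  using sets_eq_imp_space_eq[OF sets_surf] by simp

sublocale surf: finite_measure surf
  using surface_measure_finite[OF is_surface_measure_surf] by (intro finite_measureI) auto

lemma AE_surf_frontier: "AE x in surf. x \<in> frontier \<Omega>"
proof -
  have "- frontier \<Omega> \<in> null_sets surf"
    using is_surface_measure_surf frontier_borel by (auto simp: is_surface_measure_def null_sets_def)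
  from AE_not_in[OF this] show ?thesis by eventually_elim auto
qed

lemma emeasure_surf_chart:
  "lipschitz_chart \<Omega> U e g \<Longrightarrow> A \<in> sets borel \<Longrightarrow> A \<subseteq> U \<Longrightarrow> emeasure surf A = emeasure (graph_measure e g) A"
  using is_surface_measure_surf by (auto simp: is_surface_measure_def)

text \<open>Agreement on Borel subsets of \<open>U\<close> stated as an equality of measures, so
  that integrals of functions vanishing off \<open>U\<close> carry over.\<close>

lemma density_surf_chart:
  assumes ch: "lipschitz_chart \<Omega> U e g"
  shows "density surf (indicator U) = density (graph_measure e g) (indicator U)"
proof (rule measure_eqI)
  obtain L where "lipschitz_graph e g L" using lipschitz_chartD(3)[OF ch] by blast
  then interpret lipschitz_graph e g L .
  have U[measurable]: "U \<in> sets borel" using lipschitz_chartD(1)[OF ch] by simp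
  show "sets (density surf (indicator U)) = sets (density (graph_measure e g) (indicator U))" by simp
  fix A assume "A \<in> sets (density surf (indicator U))"
  then have A[measurable]: "A \<in> sets borel" by simp
  have d: "emeasure (density Q (indicator U)) A = emeasure Q (U \<inter> A)" if "sets Q = sets borel" for Q
    using that by (subst emeasure_density) (auto simp: measurable_cong_sets[OF that refl] simp flip: indicator_inter_arith)
  show "emeasure (density surf (indicator U)) A = emeasure (density (graph_measure e g) (indicator U)) A"
    using emeasure_surf_chart[OF ch, of "U \<inter> A"] by (simp add: d)
qed

lemma AE_surf_chart_normal:
  assumes ch: "lipschitz_chart \<Omega> U e g"
  shows "AE x in surf. x \<in> U \<longrightarrow> outward_normal \<Omega> x = graph_normal e g x \<and> norm (graph_normal e g x) = 1"
proof -
  obtain L where "lipschitz_graph e g L" using lipschitz_chartD(3)[OF ch] by blast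
  then interpret lipschitz_graph e g L .
  have U[measurable]: "U \<in> sets borel" using lipschitz_chartD(1)[OF ch] by simp
  have [measurable]: "Measurable.pred borel (\<lambda>y. GDERIV g y :> dgrad g y)"
    by (rule sets_GDERIV[OF g]) measurable
  define X where "X = {y \<in> U. \<not> GDERIV g y :> dgrad g y}"
  have X[measurable]: "X \<in> sets borel" unfolding X_def by measurable
  have "AE y in graph_measure e g. y \<notin> X"
    using AE_graph_measure_GDERIV by eventually_elim (simp add: X_def)
  then have "X \<in> null_sets (graph_measure e g)" by (simp add: AE_iff_null_sets)
  then have "X \<in> null_sets surf"
    using emeasure_surf_chart[OF ch X] by (auto simp: null_sets_def X_def)
  from AE_not_in[OF this] AE_surf_frontier show ?thesis
  proof eventually_elim
    case (elim x)
    show ?case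
    proof
      assume x: "x \<in> U"
      then have G: "GDERIV g x :> dgrad g x" using elim by (auto simp: X_def)
      show "outward_normal \<Omega> x = graph_normal e g x \<and> norm (graph_normal e g x) = 1"
        using outward_normal_eq[OF ch x G elim(2), folded graph_density_def, folded graph_normal_def] graph_normal_GDERIV(1)[OF G]
        by blast
    qed
  qed
qed

text \<open>\<open>outward_normal\<close> is a definite description with unspecified values on a
  null set. Gluing the graph normals over disjoint Borel pieces gives a Borel function equal to it
  almost everywhere.\<close>

lemma ex_borel_normal:
  "\<exists>\<nu>\<in>borel_measurable borel. AE x in surf. outward_normal \<Omega> x = \<nu> x \<and> norm (\<nu> x) = 1"
proof -
  obtain n and U D :: "nat \<Rightarrow> 'a set" and e g where
    ch: "\<And>k. k < n \<Longrightarrow> lipschitz_chart \<Omega> (U k) (e k) (g k)" and Db: "\<And>k. k < n \<Longrightarrow> D k \<in> sets borel"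
    and D: "\<And>k. D k \<subseteq> U k" "disjoint_family_on D {..<n}" and Dcov: "(\<Union>k<n. D k) = frontier \<Omega>"
    by (rule finite_chart_partition[OF bounded_\<Omega> boundary]) (rule that)
  define \<nu> where "\<nu> x = (\<Sum>k<n. indicator (D k) x *\<^sub>R graph_normal (e k) (g k) x)" for x
  have "\<nu> \<in> borel_measurable borel"
    unfolding \<nu>_def
  proof (intro borel_measurable_sum borel_measurable_scaleR borel_measurable_indicator)
    fix k assume "k \<in> {..<n}"
    then have k: "k < n" by simp
    show "D k \<in> sets borel" by (rule Db[OF k])
    show "graph_normal (e k) (g k) \<in> borel_measurable borel"
      using lipschitz_chartD(3)[OF ch[OF k]] lipschitz_graph.graph_normal_borel by blast
  qed
  moreover have "AE x in surf. outward_normal \<Omega> x = \<nu> x \<and> norm (\<nu> x) = 1"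
  proof -
    have "AE x in surf. \<forall>k\<in>{..<n}. x \<in> U k \<longrightarrow> outward_normal \<Omega> x = graph_normal (e k) (g k) x \<and> norm (graph_normal (e k) (g k) x) = 1"
      using AE_surf_chart_normal[OF ch] by (intro AE_finite_allI) auto
    then show ?thesis using AE_surf_frontier
    proof eventually_elim
      case (elim x)
      then obtain i where i: "i < n" "x \<in> D i" using Dcov by auto
      then have "indicator (D j) x = (if j = i then 1 else 0 :: real)" if "j < n" for j
        using D(2) that unfolding disjoint_family_on_def by (auto simp: indicator_def)
      then have "\<nu> x = (\<Sum>j<n. if j = i then graph_normal (e j) (g j) x else 0)"
        unfolding \<nu>_def by (intro sum.cong) auto
      also have "\<dots> = graph_normal (e i) (g i) x" using i by simp
      finally have "\<nu> x = graph_normal (e i) (g i) x" .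
      moreover have "i \<in> {..<n}" "x \<in> U i" using i D(1) by auto
      ultimately show ?case using elim(1) by metis
    qed
  qed
  ultimately show ?thesis by blast
qed

definition bnormal :: "'a \<Rightarrow> 'a" where
  "bnormal = (SOME \<nu>. \<nu> \<in> borel_measurable borel \<and> (AE x in surf. outward_normal \<Omega> x = \<nu> x \<and> norm (\<nu> x) = 1))"

lemma bnormal_borel[measurable]: "bnormal \<in> borel_measurable borel"
  and AE_bnormal: "AE x in surf. outward_normal \<Omega> x = bnormal x \<and> norm (bnormal x) = 1"
proof -
  have "\<exists>\<nu>. \<nu> \<in> borel_measurable borel \<and> (AE x in surf. outward_normal \<Omega> x = \<nu> x \<and> norm (\<nu> x) = 1)"
    using ex_borel_normal by blast
  from someI_ex[OF this]
  have "bnormal \<in> borel_measurable borel \<and> (AE x in surf. outward_normal \<Omega> x = bnormal x \<and> norm (bnormal x) = 1)"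
    unfolding bnormal_def .
  then show "bnormal \<in> borel_measurable borel" "AE x in surf. outward_normal \<Omega> x = bnormal x \<and> norm (bnormal x) = 1"
    by auto
qed

lemma integrable_surf:
  fixes \<phi> :: "'a \<Rightarrow> real"
  assumes [measurable]: "\<phi> \<in> borel_measurable borel" and M: "\<And>x. \<bar>\<phi> x\<bar> \<le> M"
  shows "integrable surf (\<lambda>x. \<phi> x * (v \<bullet> bnormal x))"
proof (rule surf.integrable_const_bound[where B="M * norm v"])
  show "AE x in surf. norm (\<phi> x * (v \<bullet> bnormal x)) \<le> M * norm v"
    using AE_bnormal
  proof eventually_elim
    case (elim x)
    have "\<bar>v \<bullet> bnormal x\<bar> \<le> norm v" using Cauchy_Schwarz_ineq2[of v "bnormal x"] elim by simp
    then have "\<bar>\<phi> x\<bar> * \<bar>v \<bullet> bnormal x\<bar> \<le> M * norm v"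
      using M[of x] by (intro mult_mono) auto
    then show ?case by (simp add: abs_mult)
  qed
qed measurable

lemma integrable_dir_deriv:
  fixes \<phi> :: "'a \<Rightarrow> real"
  assumes \<phi>: "K-lipschitz_on UNIV \<phi>"
  shows "integrable lborel (\<lambda>x. indicator \<Omega> x * dir_deriv \<phi> v x)"
proof -
  have [measurable]: "\<phi> \<in> borel_measurable borel"
    using \<phi> by (intro lipschitz_on_borel)
  show ?thesis
  proof (rule Bochner_Integration.integrable_bound[where f="\<lambda>x. (K * norm v) * indicator \<Omega> x"])
    show "integrable lborel (\<lambda>x. (K * norm v) * indicator \<Omega> x :: real)"
      using emeasure_bounded_finite[OF bounded_\<Omega>] by (intro integrable_mult_right integrable_real_indicator) auto
    show "AE x in lborel. norm (indicator \<Omega> x * dir_deriv \<phi> v x) \<le> norm ((K * norm v) * indicator \<Omega> x)"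
      using lipschitz_AE_has_dir_deriv[OF \<phi>, of v]
    proof eventually_elim
      case (elim x)
      show ?case using dir_deriv_bound[OF \<phi> elim] by (auto simp: indicator_def intro: order_trans[OF _ abs_ge_self])
    qed
  qed measurable
qed

section \<open>Localization and gluing of the divergence identity\<close>

abbreviation divergence_identity :: "('a \<Rightarrow> real) \<Rightarrow> 'a \<Rightarrow> bool" where
  "divergence_identity \<phi> v \<equiv> (\<integral>x. indicator \<Omega> x * dir_deriv \<phi> v x \<partial>lborel) = (\<integral>x. \<phi> x * (v \<bullet> bnormal x) \<partial>surf)"

definition divergence_set :: "'a set \<Rightarrow> bool" where
  "divergence_set V \<longleftrightarrow> open V \<and> (\<forall>\<phi> K M R v. K-lipschitz_on UNIV \<phi> \<longrightarrow> (\<forall>x. 0 \<le> \<phi> x \<and> \<phi> x \<le> M) \<longrightarrow>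
     (\<forall>x. x \<notin> ball 0 R \<longrightarrow> \<phi> x = 0) \<longrightarrow> (\<forall>x. x \<notin> V \<longrightarrow> \<phi> x = 0) \<longrightarrow>
     divergence_identity \<phi> v)"

lemma divergence_set_subset:
  assumes V: "divergence_set V" and W: "open W" "W \<subseteq> V"
  shows "divergence_set W"
  unfolding divergence_set_def
proof (intro conjI allI impI)
  fix \<phi> :: "'a \<Rightarrow> real" and K M R v
  assume h: "K-lipschitz_on UNIV \<phi>" "\<forall>x. 0 \<le> \<phi> x \<and> \<phi> x \<le> M" "\<forall>x. x \<notin> ball 0 R \<longrightarrow> \<phi> x = 0"
    and "\<forall>x. x \<notin> W \<longrightarrow> \<phi> x = 0"
  then have "\<forall>x. x \<notin> V \<longrightarrow> \<phi> x = 0" using W by blast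
  with V h show "divergence_identity \<phi> v"
    unfolding divergence_set_def by blast
qed (fact W)

lemma divergence_set_chart:
  assumes ch: "lipschitz_chart \<Omega> U e g"
  shows "divergence_set U"
  unfolding divergence_set_def
proof (intro conjI allI impI)
  show "open U" using lipschitz_chartD(1)[OF ch] .
  then have [measurable]: "U \<in> sets borel" by simp
  obtain L where "lipschitz_graph e g L" using lipschitz_chartD(3)[OF ch] by blast
  then interpret lipschitz_graph e g L .
  fix \<phi> :: "'a \<Rightarrow> real" and K M R v
  assume \<phi>: "K-lipschitz_on UNIV \<phi>" and M: "\<forall>x. 0 \<le> \<phi> x \<and> \<phi> x \<le> M" and R: "\<forall>x. x \<notin> ball 0 R \<longrightarrow> \<phi> x = 0"
    and U: "\<forall>x. x \<notin> U \<longrightarrow> \<phi> x = 0"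
  have [measurable]: "\<phi> \<in> borel_measurable borel"
    using \<phi> by (intro lipschitz_on_borel)
  let ?u = "\<lambda>y. \<phi> y * (v \<bullet> graph_normal e g y)"
  have D: "(\<integral>y. ?u y \<partial>density Q (indicator U)) = (\<integral>y. ?u y \<partial>Q)" if "sets Q = sets borel" for Q
  proof -
    have m: "?u \<in> borel_measurable Q" "(\<lambda>x. indicator U x :: real) \<in> borel_measurable Q"
      by (subst measurable_cong_sets[OF that refl], measurable)+
    have "(\<integral>y. ?u y \<partial>density Q (indicator U)) = (\<integral>y. ?u y \<partial>density Q (\<lambda>x. ennreal (indicator U x)))"
      by (simp add: ennreal_indicator)
    also have "\<dots> = (\<integral>y. indicator U y *\<^sub>R ?u y \<partial>Q)"
      using m by (intro integral_density) auto
    also have "\<dots> = (\<integral>y. ?u y \<partial>Q)"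
      using U by (intro Bochner_Integration.integral_cong) (auto simp: indicator_def)
    finally show ?thesis .
  qed
  have "(\<integral>x. indicator \<Omega> x * dir_deriv \<phi> v x \<partial>lborel) = (\<integral>y. ?u y \<partial>graph_measure e g)"
    by (rule chart_divergence(2)[OF ch \<Omega>_borel \<phi>]) (use M R U in blast)+
  also have "\<dots> = (\<integral>y. ?u y \<partial>surf)"
    using D[of surf] D[of "graph_measure e g"] by (simp add: density_surf_chart[OF ch])
  also have "\<dots> = (\<integral>x. \<phi> x * (v \<bullet> bnormal x) \<partial>surf)"
  proof (rule integral_cong_AE)
    show "AE x in surf. ?u x = \<phi> x * (v \<bullet> bnormal x)"
      using AE_surf_chart_normal[OF ch] AE_bnormal
      by eventually_elim (use U in force)
  qed measurable
  finally show "divergence_identity \<phi> v" .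
qed

text \<open>Both sides are 0: the integral of the derivative over the whole space vanishes, and
  \<open>\<phi>\<close> is 0 on the frontier, which is disjoint from the open
  \<open>\<Omega>\<close>.\<close>

lemma divergence_set_interior: "divergence_set \<Omega>"
  unfolding divergence_set_def
proof (intro conjI allI impI)
  show "open \<Omega>" by (rule open_\<Omega>)
  fix \<phi> :: "'a \<Rightarrow> real" and K M R v
  assume \<phi>: "K-lipschitz_on UNIV \<phi>" and M: "\<forall>x. 0 \<le> \<phi> x \<and> \<phi> x \<le> M" and R: "\<forall>x. x \<notin> ball 0 R \<longrightarrow> \<phi> x = 0"
    and U: "\<forall>x. x \<notin> \<Omega> \<longrightarrow> \<phi> x = 0"
  have [measurable]: "\<phi> \<in> borel_measurable borel"
    using \<phi> by (intro lipschitz_on_borel)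
  have "(\<integral>x. indicator \<Omega> x * dir_deriv \<phi> v x \<partial>lborel) = (\<integral>x. dir_deriv \<phi> v x \<partial>lborel)"
  proof (rule integral_cong_AE)
    show "AE x in lborel. indicator \<Omega> x * dir_deriv \<phi> v x = dir_deriv \<phi> v x"
      using lipschitz_AE_has_dir_deriv[OF \<phi>, of v]
    proof eventually_elim
      case (elim x)
      show ?case using dir_deriv_zero_at_min[OF elim] M U by (cases "x \<in> \<Omega>") auto
    qed
  qed measurable
  also have "\<dots> = 0" by (rule integral_dir_deriv_eq_0[OF \<phi>]) (use M R in blast)+
  also have "0 = (\<integral>x. 0 \<partial>surf)" by simp
  also have "\<dots> = (\<integral>x. \<phi> x * (v \<bullet> bnormal x) \<partial>surf)"
  proof (rule integral_cong_AE)
    show "AE x in surf. 0 = \<phi> x * (v \<bullet> bnormal x)"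
      using AE_surf_frontier
      by eventually_elim (use U open_\<Omega> in \<open>auto simp: frontier_def interior_open\<close>)
  qed measurable
  finally show "divergence_identity \<phi> v" .
qed

text \<open>A Lipschitz partition of unity on \<open>closure \<Omega>\<close> splits
  \<open>\<phi>\<close> into nonnegative pieces supported in balls, each inside a chart or inside
  \<open>\<Omega>\<close>. The values of \<open>\<phi>\<close> elsewhere do not enter either
  side.\<close>

lemma divergence_nonneg:
  fixes \<phi> :: "'a \<Rightarrow> real"
  assumes ne: "\<Omega> \<noteq> {}" and \<phi>: "K-lipschitz_on UNIV \<phi>" and M: "\<And>x. 0 \<le> \<phi> x \<and> \<phi> x \<le> M"
  shows "divergence_identity \<phi> v"
proof -
  have "\<exists>\<rho>>0. divergence_set (ball q \<rho>)" if "q \<in> closure \<Omega>" for q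
  proof -
    obtain V where V: "divergence_set V" "q \<in> V"
    proof (cases "q \<in> \<Omega>")
      case True then show ?thesis using that divergence_set_interior by blast
    next
      case False
      then have "q \<in> frontier \<Omega>" using \<open>q \<in> closure \<Omega>\<close> open_\<Omega> by (simp add: frontier_def interior_open)
      then show ?thesis using that boundary divergence_set_chart unfolding lipschitz_boundary_def by blast
    qed
    have "open V" using V(1) by (simp add: divergence_set_def)
    then obtain \<rho> where \<rho>: "\<rho> > 0" "ball q \<rho> \<subseteq> V" using V(2) openE by blast
    then have "divergence_set (ball q \<rho>)" using divergence_set_subset[OF V(1)] by blast
    then show ?thesis using \<rho> by blast
  qed
  then obtain \<rho> where \<rho>: "\<And>q. q \<in> closure \<Omega> \<Longrightarrow> \<rho> q > 0 \<and> divergence_set (ball q (\<rho> q))" by metis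
  have cpt: "compact (closure \<Omega>)" using bounded_\<Omega> by simp
  obtain F where F: "F \<subseteq> closure \<Omega>" "finite F" "closure \<Omega> \<subseteq> (\<Union>q\<in>F. ball q (\<rho> q))"
  proof (rule compactE_image[OF cpt])
    show "closure \<Omega> \<subseteq> (\<Union>q\<in>closure \<Omega>. ball q (\<rho> q))" using \<rho> by force
  qed auto
  \<comment> \<open>Tents that are positive exactly on the balls of the cover.\<close>
  define \<tau> where "\<tau> q x = max 0 (\<rho> q - dist x q)" for q x
  have \<tau>0: "0 \<le> \<tau> q x" for q x by (simp add: \<tau>_def)
  have \<tau>pos: "\<tau> q x > 0 \<longleftrightarrow> x \<in> ball q (\<rho> q)" for q x by (auto simp: \<tau>_def dist_commute)
  have \<tau>b: "\<bar>\<tau> q x\<bar> \<le> \<bar>\<rho> q\<bar>" for q x using zero_le_dist[of x q] unfolding \<tau>_def by linarith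
  have \<tau>lip: "1-lipschitz_on UNIV (\<tau> q)" for q
  proof (rule lipschitz_onI)
    fix x y
    have "\<bar>dist x q - dist y q\<bar> \<le> dist x y" using abs_dist_diff_le[of x q y] by (simp add: dist_commute)
    then show "dist (\<tau> q x) (\<tau> q y) \<le> 1 * dist x y" unfolding \<tau>_def dist_real_def by linarith
  qed simp
  define T where "T x = (\<Sum>q\<in>F. \<tau> q x)" for x
  obtain KT where KT: "KT-lipschitz_on UNIV T"
    unfolding T_def using lipschitz_on_sum_real[OF F(2), of \<tau>] \<tau>lip by blast
  have Tpos: "T x > 0" if x: "x \<in> closure \<Omega>" for x
  proof -
    obtain q where q: "q \<in> F" "x \<in> ball q (\<rho> q)" using F(3) x by blast
    then show ?thesis unfolding T_def using F(2) \<tau>0 \<tau>pos by (intro sum_pos2[of _ q]) auto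
  qed
  obtain c where c: "c > 0" "\<And>x. x \<in> closure \<Omega> \<Longrightarrow> c \<le> T x"
  proof -
    have "continuous_on (closure \<Omega>) T"
      using lipschitz_on_continuous_on[OF KT] continuous_on_subset by blast
    from continuous_attains_inf[OF cpt _ this] ne
    obtain z where "z \<in> closure \<Omega>" "\<forall>y\<in>closure \<Omega>. T z \<le> T y" by auto
    then show thesis using that[of "T z"] Tpos by blast
  qed
  \<comment> \<open>On \<open>closure \<Omega>\<close> this is \<open>T\<close>; elsewhere
    \<open>T\<close> may vanish, and the lower bound \<open>c\<close> keeps the reciprocal Lipschitz
    on the whole space.\<close>
  define m where "m x = max c (T x)" for x
  have m: "c \<le> m x" for x by (simp add: m_def)
  have mpos: "m x > 0" for x using c(1) m[of x] by linarith
  have mlip: "KT-lipschitz_on UNIV m"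
  proof (rule lipschitz_onI)
    fix x y
    have "\<bar>T x - T y\<bar> \<le> KT * dist x y" using lipschitz_onD[OF KT, of x y] by (simp add: dist_real_def)
    then show "dist (m x) (m y) \<le> KT * dist x y" unfolding m_def dist_real_def by linarith
  qed (use lipschitz_on_nonneg[OF KT] in simp)
  have milip: "(KT / c\<^sup>2)-lipschitz_on UNIV (\<lambda>x. 1 / m x)" by (rule lipschitz_on_inverse_real[OF mlip c(1) m])
  have mib: "\<bar>1 / m x\<bar> \<le> 1 / c" for x using mpos[of x] m[of x] c(1) by (simp add: frac_le)
  have \<phi>b: "\<bar>\<phi> x\<bar> \<le> M" for x using M[of x] by simp
  define \<zeta> where "\<zeta> q x = (\<tau> q x * \<phi> x) * (1 / m x)" for q x
  have pb: "\<bar>\<tau> q x * \<phi> x\<bar> \<le> \<bar>\<rho> q\<bar> * M" for q x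
    unfolding abs_mult using \<tau>b \<phi>b by (intro mult_mono) auto
  have \<zeta>lip: "\<exists>K. K-lipschitz_on UNIV (\<zeta> q)" for q
    unfolding \<zeta>_def using lipschitz_on_mult_bounded[OF lipschitz_on_mult_bounded[OF \<tau>lip \<tau>b \<phi> \<phi>b] pb milip mib] by blast
  have \<zeta>0: "0 \<le> \<zeta> q x" for q x unfolding \<zeta>_def using \<tau>0 M mpos by (simp add: less_imp_le)
  have \<zeta>b: "\<bar>\<zeta> q x\<bar> \<le> \<bar>\<rho> q\<bar> * M * (1 / c)" for q x
    unfolding \<zeta>_def abs_mult[of "\<tau> q x * \<phi> x"] using pb mib by (intro mult_mono) (auto intro: order_trans[OF abs_ge_zero])
  have \<zeta>z: "\<zeta> q x = 0" if "x \<notin> ball q (\<rho> q)" for q x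
    using that \<tau>pos[of q x] \<tau>0[of q x] by (auto simp: \<zeta>_def)
  have \<zeta>sum: "(\<Sum>q\<in>F. \<zeta> q x) = \<phi> x" if "x \<in> closure \<Omega>" for x
  proof -
    have "m x = T x" using c(2)[OF that] by (simp add: m_def)
    moreover have "(\<Sum>q\<in>F. \<zeta> q x) = T x * \<phi> x * (1 / m x)"
      unfolding \<zeta>_def T_def sum_distrib_right by simp
    ultimately show ?thesis using mpos[of x] by simp
  qed
  have meas[measurable]: "\<zeta> q \<in> borel_measurable borel" for q
    using \<zeta>lip[of q] lipschitz_on_continuous_on borel_measurable_continuous_onI by blast
  have [measurable]: "\<phi> \<in> borel_measurable borel"
    using \<phi> by (intro lipschitz_on_borel)
  have each: "divergence_identity (\<zeta> q) v" if "q \<in> F" for q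
  proof -
    have ds: "divergence_set (ball q (\<rho> q))" using \<rho> F(1) that by blast
    obtain K where K: "K-lipschitz_on UNIV (\<zeta> q)" using \<zeta>lip by blast
    have bd: "\<forall>x. 0 \<le> \<zeta> q x \<and> \<zeta> q x \<le> \<bar>\<rho> q\<bar> * M * (1 / c)" using \<zeta>0 \<zeta>b[of q] abs_ge_self order_trans by blast
    obtain R where "ball q (\<rho> q) \<subseteq> ball 0 R" using bounded_subset_ballD[OF bounded_ball] by blast
    then have R: "\<forall>x. x \<notin> ball 0 R \<longrightarrow> \<zeta> q x = 0" using \<zeta>z by blast
    show ?thesis using ds K bd R \<zeta>z unfolding divergence_set_def by blast
  qed
  have "(\<integral>x. indicator \<Omega> x * dir_deriv \<phi> v x \<partial>lborel) = (\<integral>x. (\<Sum>q\<in>F. indicator \<Omega> x * dir_deriv (\<zeta> q) v x) \<partial>lborel)"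
  proof (rule integral_cong_AE)
    have "AE x in lborel. \<forall>q\<in>F. \<exists>d. has_dir_deriv (\<zeta> q) v x d"
      using \<zeta>lip lipschitz_AE_has_dir_deriv F(2) by (intro AE_finite_allI) blast+
    then show "AE x in lborel. indicator \<Omega> x * dir_deriv \<phi> v x = (\<Sum>q\<in>F. indicator \<Omega> x * dir_deriv (\<zeta> q) v x)"
    proof eventually_elim
      case (elim x)
      show ?case
      proof (cases "x \<in> \<Omega>")
        case True
        have "((\<lambda>t. \<Sum>q\<in>F. (\<zeta> q (x + t *\<^sub>R v) - \<zeta> q x) / t) \<longlongrightarrow> (\<Sum>q\<in>F. dir_deriv (\<zeta> q) v x)) (at 0)"
        proof (rule tendsto_sum)
          fix q assume "q \<in> F"
          then have "has_dir_deriv (\<zeta> q) v x (dir_deriv (\<zeta> q) v x)"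
            using elim has_dir_deriv_dir_deriv by blast
          then show "((\<lambda>t. (\<zeta> q (x + t *\<^sub>R v) - \<zeta> q x) / t) \<longlongrightarrow> dir_deriv (\<zeta> q) v x) (at 0)"
            by (simp add: has_dir_deriv_def)
        qed
        \<comment> \<open>The pieces add up to \<open>\<phi>\<close> only on
          \<open>closure \<Omega>\<close>, so \<open>t\<close> must be small enough to keep
          \<open>x + t *\<^sub>R v\<close> in \<open>\<Omega>\<close>.\<close>
        moreover have "eventually (\<lambda>t. (\<Sum>q\<in>F. (\<zeta> q (x + t *\<^sub>R v) - \<zeta> q x) / t) = (\<phi> (x + t *\<^sub>R v) - \<phi> x) / t) (at 0)"
        proof -
          have "((\<lambda>t. x + t *\<^sub>R v) \<longlongrightarrow> x + 0 *\<^sub>R v) (at 0)" by (intro tendsto_intros)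
          then have "eventually (\<lambda>t. x + t *\<^sub>R v \<in> \<Omega>) (at 0)"
            using open_\<Omega> True by (auto dest: topological_tendstoD)
          then show ?thesis
          proof eventually_elim
            case (elim t)
            then have "x + t *\<^sub>R v \<in> closure \<Omega>" "x \<in> closure \<Omega>" using True closure_subset by blast+
            then show ?case by (simp add: sum_subtractf \<zeta>sum flip: sum_divide_distrib)
          qed
        qed
        ultimately have "has_dir_deriv \<phi> v x (\<Sum>q\<in>F. dir_deriv (\<zeta> q) v x)"
          unfolding has_dir_deriv_def by (rule Lim_transform_eventually)
        then show ?thesis using dir_deriv_eq True by simp
      qed simp
    qed
  qed measurable
  also have "\<dots> = (\<Sum>q\<in>F. \<integral>x. indicator \<Omega> x * dir_deriv (\<zeta> q) v x \<partial>lborel)"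
    using \<zeta>lip integrable_dir_deriv by (intro Bochner_Integration.integral_sum) blast
  also have "\<dots> = (\<Sum>q\<in>F. \<integral>x. \<zeta> q x * (v \<bullet> bnormal x) \<partial>surf)"
    using each by (rule sum.cong[OF refl])
  also have "\<dots> = (\<integral>x. (\<Sum>q\<in>F. \<zeta> q x * (v \<bullet> bnormal x)) \<partial>surf)"
    using integrable_surf[OF meas \<zeta>b] by (intro Bochner_Integration.integral_sum[symmetric]) blast
  also have "\<dots> = (\<integral>x. \<phi> x * (v \<bullet> bnormal x) \<partial>surf)"
  proof (rule integral_cong_AE)
    show "AE x in surf. (\<Sum>q\<in>F. \<zeta> q x * (v \<bullet> bnormal x)) = \<phi> x * (v \<bullet> bnormal x)"
      using AE_surf_frontier
      by eventually_elim (simp add: \<zeta>sum frontier_def flip: sum_distrib_right)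
  qed measurable
  finally show ?thesis .
qed

text \<open>Adding \<open>M\<close> makes the function nonnegative. The nonnegative case for the
  constant \<open>M\<close> itself shows that its flux is 0, so the added term drops out.\<close>

theorem divergence_theorem:
  fixes \<phi> :: "'a \<Rightarrow> real"
  assumes ne: "\<Omega> \<noteq> {}" and \<phi>: "K-lipschitz_on UNIV \<phi>" and M: "\<And>x. \<bar>\<phi> x\<bar> \<le> M"
  shows "divergence_identity \<phi> v"
proof -
  have [measurable]: "\<phi> \<in> borel_measurable borel"
    using \<phi> by (intro lipschitz_on_borel)
  have M0: "0 \<le> M" using M[of 0] by linarith
  have b: "0 \<le> \<phi> x + M \<and> \<phi> x + M \<le> 2 * M" for x using M[of x] by linarith
  have lip: "(K + 0)-lipschitz_on UNIV (\<lambda>x. \<phi> x + M)" by (intro lipschitz_on_add \<phi> lipschitz_on_constant)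
  have "(\<integral>x. M * (v \<bullet> bnormal x) \<partial>surf) = (\<integral>x. indicator \<Omega> x * dir_deriv (\<lambda>_. M) v x \<partial>lborel)"
    using divergence_nonneg[OF ne lipschitz_on_constant[where c=M], of M v] M0 by simp
  also have "\<dots> = 0" by (simp add: dir_deriv_def)
  finally have z: "(\<integral>x. M * (v \<bullet> bnormal x) \<partial>surf) = 0" .
  have "(\<integral>x. indicator \<Omega> x * dir_deriv \<phi> v x \<partial>lborel) = (\<integral>x. indicator \<Omega> x * dir_deriv (\<lambda>x. \<phi> x + M) v x \<partial>lborel)"
    by (simp add: dir_deriv_def)
  also have "\<dots> = (\<integral>x. (\<phi> x + M) * (v \<bullet> bnormal x) \<partial>surf)"
    by (rule divergence_nonneg[OF ne lip b])
  also have "\<dots> = (\<integral>x. \<phi> x * (v \<bullet> bnormal x) \<partial>surf) + (\<integral>x. M * (v \<bullet> bnormal x) \<partial>surf)"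
    unfolding distrib_right
    by (intro Bochner_Integration.integral_add integrable_surf[of \<phi> M] integrable_surf[of "\<lambda>_. M" M]) (use M M0 in auto)
  finally show ?thesis using z by simp
qed

end

subsection \<open>Vector fields tangential to a sphere\<close>

text \<open>Boundedness is included because products of Lipschitz functions need it; the class is
  then closed under polynomial operations and membership is found by introduction rules.\<close>

definition bounded_lipschitz :: "('a::metric_space \<Rightarrow> real) \<Rightarrow> bool" where
  "bounded_lipschitz f \<longleftrightarrow> (\<exists>K M. K-lipschitz_on UNIV f \<and> (\<forall>x. \<bar>f x\<bar> \<le> M))"

named_theorems bounded_lipschitz_intros

lemma bounded_lipschitz_const[bounded_lipschitz_intros]: "bounded_lipschitz (\<lambda>x. c)"
  unfolding bounded_lipschitz_def using lipschitz_on_constant by blast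

lemma bounded_lipschitz_mult[bounded_lipschitz_intros]:
  assumes "bounded_lipschitz f" "bounded_lipschitz g"
  shows "bounded_lipschitz (\<lambda>x. f x * g x)"
proof -
  obtain K A L B where f: "K-lipschitz_on UNIV f" "\<And>x. \<bar>f x\<bar> \<le> A" and g: "L-lipschitz_on UNIV g" "\<And>x. \<bar>g x\<bar> \<le> B"
    using assms unfolding bounded_lipschitz_def by metis
  have "\<bar>f x * g x\<bar> \<le> A * B" for x
    unfolding abs_mult using f(2)[of x] g(2)[of x] by (intro mult_mono) auto
  then show ?thesis unfolding bounded_lipschitz_def using lipschitz_on_mult_bounded[OF f g] by blast
qed

lemma bounded_lipschitz_add[bounded_lipschitz_intros]:
  assumes "bounded_lipschitz f" "bounded_lipschitz g"
  shows "bounded_lipschitz (\<lambda>x. f x + g x)"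
proof -
  obtain K A L B where f: "K-lipschitz_on UNIV f" "\<And>x. \<bar>f x\<bar> \<le> A" and g: "L-lipschitz_on UNIV g" "\<And>x. \<bar>g x\<bar> \<le> B"
    using assms unfolding bounded_lipschitz_def by metis
  have "\<bar>f x + g x\<bar> \<le> A + B" for x using f(2)[of x] g(2)[of x] by linarith
  then show ?thesis unfolding bounded_lipschitz_def using lipschitz_on_add[OF f(1) g(1)] by blast
qed

lemma bounded_lipschitz_diff[bounded_lipschitz_intros]:
  assumes "bounded_lipschitz f" "bounded_lipschitz g"
  shows "bounded_lipschitz (\<lambda>x. f x - g x)"
  using bounded_lipschitz_add[OF assms(1) bounded_lipschitz_mult[OF bounded_lipschitz_const assms(2)], of "-1"] by simp

lemma bounded_lipschitz_power[bounded_lipschitz_intros]: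
  assumes "bounded_lipschitz f" shows "bounded_lipschitz (\<lambda>x. f x ^ k)"
  using assms by (induction k) (auto intro: bounded_lipschitz_intros)

text \<open>A polynomial that vanishes on the sphere, composed with the retraction onto the ball, is its
  extension by zero, and this is Lipschitz.\<close>

definition ball_retract :: "'a::euclidean_space \<Rightarrow> real \<Rightarrow> 'a \<Rightarrow> 'a" where
  "ball_retract p r = closest_point (cball p r)"

lemma ball_retract_self: "x \<in> cball p r \<Longrightarrow> ball_retract p r x = x"
  unfolding ball_retract_def by (rule closest_point_self)

lemma ball_retract_cball: "r > 0 \<Longrightarrow> ball_retract p r x \<in> cball p r"
  unfolding ball_retract_def by (rule closest_point_in_set) auto

lemma ball_retract_outside:
  assumes r: "r > 0" and x: "x \<notin> ball p r" shows "norm (ball_retract p r x - p) = r"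
proof -
  have ne: "interior (cball p r) \<noteq> {}" using r by simp
  have "affine hull (cball p r) = UNIV" by (rule affine_hull_nonempty_interior[OF ne])
  moreover have "rel_interior (cball p r) = ball p r" using rel_interior_nonempty_interior[OF ne] by simp
  ultimately have "closest_point (cball p r) x \<notin> ball p r"
    using closest_point_in_rel_interior[of "cball p r" x] r x by auto
  then show ?thesis using ball_retract_cball[OF r, of p x] unfolding ball_retract_def
    by (auto simp: dist_norm norm_minus_commute)
qed

lemma bounded_lipschitz_ball_retract[bounded_lipschitz_intros]:
  assumes r: "r > 0"
  shows "bounded_lipschitz (\<lambda>x. (ball_retract p r x - p) \<bullet> u)" and "bounded_lipschitz (\<lambda>x. norm (ball_retract p r x - p))"
proof -
  let ?P = "ball_retract p r"
  have lip: "norm (?P x - ?P y) \<le> dist x y" for x y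
    unfolding ball_retract_def using closest_point_lipschitz[of "cball p r" x y] r by (simp add: dist_norm)
  have b: "norm (?P x - p) \<le> r" for x
    using ball_retract_cball[OF r, of p x] by (simp add: dist_norm norm_minus_commute)
  have "(norm u)-lipschitz_on UNIV (\<lambda>x. (?P x - p) \<bullet> u)"
  proof (rule lipschitz_onI)
    fix x y
    have "\<bar>(?P x - p) \<bullet> u - (?P y - p) \<bullet> u\<bar> = \<bar>(?P x - ?P y) \<bullet> u\<bar>" by (simp add: inner_diff_left)
    also have "\<dots> \<le> norm (?P x - ?P y) * norm u" by (rule Cauchy_Schwarz_ineq2)
    also have "\<dots> \<le> dist x y * norm u" by (intro mult_right_mono lip) simp
    finally show "dist ((?P x - p) \<bullet> u) ((?P y - p) \<bullet> u) \<le> norm u * dist x y"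
      by (simp add: dist_real_def mult.commute)
  qed simp
  moreover have "\<bar>(?P x - p) \<bullet> u\<bar> \<le> r * norm u" for x
    using Cauchy_Schwarz_ineq2[of "?P x - p" u] mult_right_mono[OF b norm_ge_zero, of x u] by linarith
  ultimately show "bounded_lipschitz (\<lambda>x. (?P x - p) \<bullet> u)" unfolding bounded_lipschitz_def by blast
  have "1-lipschitz_on UNIV (\<lambda>x. norm (?P x - p))"
  proof (rule lipschitz_onI)
    fix x y
    have "\<bar>norm (?P x - p) - norm (?P y - p)\<bar> \<le> norm ((?P x - p) - (?P y - p))" by (rule norm_triangle_ineq3)
    then show "dist (norm (?P x - p)) (norm (?P y - p)) \<le> 1 * dist x y"
      using lip[of x y] by (simp add: dist_real_def)
  qed simp
  then show "bounded_lipschitz (\<lambda>x. norm (?P x - p))"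
    unfolding bounded_lipschitz_def using b by (intro exI[of _ 1] exI[of _ r]) simp
qed

text \<open>Each of the \<open>k + 1\<close> terms of \<open>1 + s + ... + s ^ k\<close> is at least
  \<open>s ^ k\<close>, and the sum times \<open>1 - s\<close> is \<open>1 - s ^ Suc k\<close>. The
  expression is the growing factor of the cutoff gradient times the factor gained from
  tangentiality.\<close>

lemma Suc_power_one_minus:
  fixes s :: real
  assumes "0 \<le> s" "s < 1"
  shows "real (Suc k) * s ^ k * (1 - s) \<le> 1" and "0 \<le> real (Suc k) * s ^ k * (1 - s)"
    and "(\<lambda>k. real (Suc k) * s ^ k * (1 - s)) \<longlonglongrightarrow> 0"
proof -
  have "real (Suc k) * s ^ k = (\<Sum>i<Suc k. s ^ k)" by simp
  also have "\<dots> \<le> (\<Sum>i<Suc k. s ^ i)" using assms by (intro sum_mono power_decreasing) auto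
  finally have "real (Suc k) * s ^ k * (1 - s) \<le> (\<Sum>i<Suc k. s ^ i) * (1 - s)"
    using assms by (intro mult_right_mono) auto
  also have "\<dots> = 1 - s ^ Suc k" by (simp only: one_diff_power_eq mult.commute)
  also have "\<dots> \<le> 1" using assms by simp
  finally show "real (Suc k) * s ^ k * (1 - s) \<le> 1" .
  show "0 \<le> real (Suc k) * s ^ k * (1 - s)" using assms by simp
  have "(\<lambda>k. (real k * s ^ k + s ^ k) * (1 - s)) \<longlonglongrightarrow> (0 + 0) * (1 - s)"
    using assms by (intro tendsto_intros powser_times_n_limit_0[of s, simplified] LIMSEQ_realpow_zero) auto
  then show "(\<lambda>k. real (Suc k) * s ^ k * (1 - s)) \<longlonglongrightarrow> 0" by (simp add: algebra_simps)
qed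

text \<open>The cutoff is 1 - s^(k+1) with s = |x - p|^2 / r^2. Its gradient paired with F is
  2 (k+1) s^k (1 - s) \<beta>, which is bounded in the ball and tends to 0.\<close>

lemma (in lipschitz_domain) divergence_theorem_tangential_ball:
  fixes F :: "'a \<Rightarrow> 'a" and dF :: "'a \<Rightarrow> 'a \<Rightarrow> 'a" and \<beta> :: "'a \<Rightarrow> real"
  assumes ne: "\<Omega> \<noteq> {}" and r: "r > 0"
    and dF: "\<And>x. (F has_derivative dF x) (at x)"
    and cdiv: "continuous_on UNIV (\<lambda>x. \<Sum>b\<in>Basis. dF x b \<bullet> b)"
    and c\<beta>: "continuous_on UNIV \<beta>"
    and tang: "\<And>x. F x \<bullet> (x - p) = ((norm (x - p))\<^sup>2 - r\<^sup>2) * \<beta> x"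
    and lip: "\<And>b. b \<in> Basis \<Longrightarrow> bounded_lipschitz (\<lambda>x. F (ball_retract p r x) \<bullet> b)"
  shows "(\<integral>x. indicator (\<Omega> \<inter> ball p r) x * (\<Sum>b\<in>Basis. dF x b \<bullet> b) \<partial>lborel) =
     (\<integral>x. indicator (ball p r) x * (F x \<bullet> bnormal x) \<partial>surf)"
proof -
  define dv where "dv x = (\<Sum>b\<in>Basis. dF x b \<bullet> b)" for x
  have cdv: "continuous_on UNIV dv" using cdiv by (simp add: dv_def[abs_def])
  have cF: "continuous_on UNIV F"
    using dF by (intro continuous_at_imp_continuous_on) (auto intro: has_derivative_continuous)
  have [measurable]: "dv \<in> borel_measurable borel" "\<beta> \<in> borel_measurable borel" "F \<in> borel_measurable borel"
    using cdv c\<beta> cF by (auto intro: borel_measurable_continuous_onI)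
  define B where "B = ball p r"
  have B[measurable]: "B \<in> sets borel" by (simp add: B_def)
  have bound: "\<exists>C\<ge>0. \<forall>x\<in>B. \<bar>f x\<bar> \<le> C" if f: "continuous_on UNIV f" for f :: "'a \<Rightarrow> real"
  proof -
    have "compact (f ` cball p r)" using f by (intro compact_continuous_image continuous_on_subset[OF f]) auto
    then obtain C where C: "\<forall>y\<in>f ` cball p r. norm y \<le> C" using compact_imp_bounded bounded_iff by blast
    show ?thesis
    proof (intro exI[of _ "max 0 C"] conjI ballI)
      fix x assume "x \<in> B"
      then have "f x \<in> f ` cball p r" using ball_subset_cball by (auto simp: B_def)
      then have "norm (f x) \<le> C" using C by blast
      then show "\<bar>f x\<bar> \<le> max 0 C" by simp
    qed simp
  qed
  obtain Cd where Cd: "Cd \<ge> 0" "\<And>x. x \<in> B \<Longrightarrow> \<bar>dv x\<bar> \<le> Cd" using bound[OF cdv] by auto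
  obtain Cb where Cb: "Cb \<ge> 0" "\<And>x. x \<in> B \<Longrightarrow> \<bar>\<beta> x\<bar> \<le> Cb" using bound[OF c\<beta>] by auto
  obtain CF where CF: "CF \<ge> 0" "\<And>x. x \<in> B \<Longrightarrow> norm (F x) \<le> CF" using bound[OF continuous_on_norm[OF cF]] by auto
  define s where "s x = (norm (x - p))\<^sup>2 / r\<^sup>2" for x
  have [measurable]: "s \<in> borel_measurable borel" unfolding s_def by measurable
  have s: "0 \<le> s x" "s x < 1" if "x \<in> B" for x
  proof -
    show "0 \<le> s x" by (simp add: s_def)
    have "norm (x - p) < r" using that by (simp add: B_def dist_norm norm_minus_commute)
    then have "(norm (x - p))\<^sup>2 < r\<^sup>2" by (intro power_strict_mono) auto
    then show "s x < 1" using r by (simp add: s_def)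
  qed
  \<comment> \<open>\<open>q\<close> is differentiable everywhere and 0 where
    \<open>s x = 1\<close>; \<open>\<phi>\<close> is its restriction to the ball extended by zero,
    possibly with kinks on the sphere.\<close>
  define q where "q k b x = (1 - s x ^ Suc k) * (F x \<bullet> b)" for k b x
  define \<phi> where "\<phi> k b x = q k b (ball_retract p r x)" for k b x
  have \<phi>in: "\<phi> k b x = q k b x" if "x \<in> B" for k b x
    using that ball_subset_cball[of p r] by (auto simp: \<phi>_def B_def ball_retract_self)
  have \<phi>out: "\<phi> k b x = 0" if "x \<notin> B" for k b x
    using ball_retract_outside[OF r, of x p] that r by (simp add: \<phi>_def q_def s_def B_def)
  have \<phi>eq: "\<phi> k b x = indicator B x * q k b x" for k b x
    using \<phi>in \<phi>out by (simp add: indicator_def)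
  have \<phi>bl: "bounded_lipschitz (\<phi> k b)" if "b \<in> Basis" for k b
    unfolding \<phi>_def q_def s_def divide_inverse
    by (intro bounded_lipschitz_intros lip[OF that] r)
  have qd: "(q k b has_derivative (\<lambda>h. (1 - s x ^ Suc k) * (dF x h \<bullet> b) -
       (real (Suc k) * s x ^ k * (2 * ((x - p) \<bullet> h) / r\<^sup>2)) * (F x \<bullet> b))) (at x)" for k b x
  proof -
    have "(s has_derivative (\<lambda>h. 2 * ((x - p) \<bullet> h) / r\<^sup>2)) (at x)"
      unfolding s_def power2_norm_eq_inner divide_inverse
      by (auto intro!: derivative_eq_intros simp: inner_commute)
    note [derivative_intros] = this dF
    show ?thesis unfolding q_def
      by (auto intro!: derivative_eq_intros simp del: power_Suc of_nat_Suc)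
  qed
  define w where "w k x = (1 - s x ^ Suc k) * dv x + 2 * (real (Suc k) * s x ^ k * (1 - s x)) * \<beta> x" for k x
  have dd_in: "(\<Sum>b\<in>Basis. dir_deriv (\<phi> k b) b x) = w k x" if x: "x \<in> B" for k x
  proof -
    have op: "open B" by (simp add: B_def)
    have each: "dir_deriv (\<phi> k b) b x = (1 - s x ^ Suc k) * (dF x b \<bullet> b) -
       (real (Suc k) * s x ^ k * (2 * ((x - p) \<bullet> b) / r\<^sup>2)) * (F x \<bullet> b)" for b
      by (intro dir_deriv_eq has_derivative_has_dir_deriv has_derivative_transform_within_open[OF qd op x]) (simp add: \<phi>in)
    have "(\<Sum>b\<in>Basis. dir_deriv (\<phi> k b) b x) = (\<Sum>b\<in>Basis. (1 - s x ^ Suc k) * (dF x b \<bullet> b)) -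
        (\<Sum>b\<in>Basis. (real (Suc k) * s x ^ k * 2 / r\<^sup>2) * ((F x \<bullet> b) * ((x - p) \<bullet> b)))"
      unfolding each sum_subtractf[symmetric] by (intro sum.cong refl) (simp add: algebra_simps del: of_nat_Suc power_Suc)
    also have "\<dots> = (1 - s x ^ Suc k) * dv x - (real (Suc k) * s x ^ k * 2 / r\<^sup>2) * (F x \<bullet> (x - p))"
      by (simp only: sum_distrib_left[symmetric] dv_def euclidean_inner[of "F x" "x - p"])
    \<comment> \<open>Tangentiality supplies the factor \<open>1 - s x\<close>, which compensates
      the growth of \<open>real (Suc k) * s x ^ k\<close>.\<close>
    also have "F x \<bullet> (x - p) = - (r\<^sup>2 * (1 - s x)) * \<beta> x"
      using r by (simp add: tang s_def field_simps)
    also have "(1 - s x ^ Suc k) * dv x - (real (Suc k) * s x ^ k * 2 / r\<^sup>2) * (- (r\<^sup>2 * (1 - s x)) * \<beta> x) = w k x"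
      using r unfolding w_def by (simp del: of_nat_Suc power_Suc)
    finally show ?thesis .
  qed
  have dd_out: "dir_deriv (\<phi> k b) b x = 0" if x: "x \<notin> cball p r" for k b x
  proof -
    have op: "open (- cball p r)" by auto
    have "(\<phi> k b has_derivative (\<lambda>h. 0)) (at x)"
    proof (rule has_derivative_transform_within_open[OF _ op])
      show "((\<lambda>x. 0) has_derivative (\<lambda>h. 0)) (at x)" by simp
      show "0 = \<phi> k b y" if "y \<in> - cball p r" for y
        using that ball_subset_cball[of p r] by (intro \<phi>out[symmetric]) (auto simp: B_def)
    qed (use x in simp)
    then show ?thesis using dir_deriv_eq has_derivative_has_dir_deriv by blast
  qed
  \<comment> \<open>The derivatives of \<open>\<phi>\<close> are known only off the sphere, and
    Lebesgue measure ignores the sphere. \<open>surf\<close> may charge it, but there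
    \<open>\<phi>\<close> itself enters, and it is 0 on the sphere.\<close>
  have nosphere: "AE x in lborel. x \<notin> sphere p r"
  proof -
    have "sphere p r \<in> null_sets lebesgue" using negligible_sphere negligible_iff_null_sets by blast
    then have "sphere p r \<in> null_sets lborel" by (simp add: null_sets_def borel_closed)
    then show ?thesis by (rule AE_not_in)
  qed
  have \<phi>m[measurable]: "\<phi> k b \<in> borel_measurable borel" for k b
    unfolding \<phi>eq[abs_def] q_def by measurable
  have L: "(\<Sum>b\<in>Basis. \<integral>x. indicator \<Omega> x * dir_deriv (\<phi> k b) b x \<partial>lborel) = (\<integral>x. indicator (\<Omega> \<inter> B) x * w k x \<partial>lborel)" for k
  proof -
    have "(\<Sum>b\<in>Basis. \<integral>x. indicator \<Omega> x * dir_deriv (\<phi> k b) b x \<partial>lborel) =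
       (\<integral>x. (\<Sum>b\<in>Basis. indicator \<Omega> x * dir_deriv (\<phi> k b) b x) \<partial>lborel)"
    proof (rule Bochner_Integration.integral_sum[symmetric])
      fix b :: 'a assume "b \<in> Basis"
      then show "integrable lborel (\<lambda>x. indicator \<Omega> x * dir_deriv (\<phi> k b) b x)"
        using \<phi>bl[of b k] integrable_dir_deriv unfolding bounded_lipschitz_def by blast
    qed
    also have "\<dots> = (\<integral>x. indicator (\<Omega> \<inter> B) x * w k x \<partial>lborel)"
    proof (rule integral_cong_AE)
      show "(\<lambda>x. indicator (\<Omega> \<inter> B) x * w k x) \<in> borel_measurable lborel" unfolding w_def by measurable
      show "AE x in lborel. (\<Sum>b\<in>Basis. indicator \<Omega> x * dir_deriv (\<phi> k b) b x) = indicator (\<Omega> \<inter> B) x * w k x"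
        using nosphere
      proof eventually_elim
        case (elim x)
        then consider "x \<in> B" | "x \<notin> B" "x \<notin> cball p r" by (force simp: B_def)
        then show ?case
        proof cases
          case 1 then show ?thesis using dd_in[OF 1, of k] by (simp add: indicator_def flip: sum_distrib_left)
        next
          case 2 then show ?thesis using dd_out by simp
        qed
      qed
    qed measurable
    finally show ?thesis .
  qed
  have R: "(\<Sum>b\<in>Basis. \<integral>x. \<phi> k b x * (b \<bullet> bnormal x) \<partial>surf) = (\<integral>x. indicator B x * ((1 - s x ^ Suc k) * (F x \<bullet> bnormal x)) \<partial>surf)" for k
  proof -
    have "(\<Sum>b\<in>Basis. \<integral>x. \<phi> k b x * (b \<bullet> bnormal x) \<partial>surf) = (\<integral>x. (\<Sum>b\<in>Basis. \<phi> k b x * (b \<bullet> bnormal x)) \<partial>surf)"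
    proof (rule Bochner_Integration.integral_sum[symmetric])
      fix b :: 'a assume "b \<in> Basis"
      then obtain M where "\<forall>x. \<bar>\<phi> k b x\<bar> \<le> M" using \<phi>bl[of b k] unfolding bounded_lipschitz_def by blast
      then show "integrable surf (\<lambda>x. \<phi> k b x * (b \<bullet> bnormal x))"
        using integrable_surf[OF \<phi>m] by blast
    qed
    also have "\<dots> = (\<integral>x. indicator B x * ((1 - s x ^ Suc k) * (F x \<bullet> bnormal x)) \<partial>surf)"
    proof (rule Bochner_Integration.integral_cong[OF refl])
      fix x
      have "(\<Sum>b\<in>Basis. \<phi> k b x * (b \<bullet> bnormal x)) = (\<Sum>b\<in>Basis. (indicator B x * (1 - s x ^ Suc k)) * ((F x \<bullet> b) * (bnormal x \<bullet> b)))"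
        unfolding \<phi>eq q_def by (intro sum.cong refl) (simp add: mult_ac inner_commute)
      then show "(\<Sum>b\<in>Basis. \<phi> k b x * (b \<bullet> bnormal x)) = indicator B x * ((1 - s x ^ Suc k) * (F x \<bullet> bnormal x))"
        by (simp only: sum_distrib_left[symmetric] euclidean_inner[of "F x" "bnormal x", symmetric] mult.assoc)
    qed
    finally show ?thesis .
  qed
  have eqk: "(\<integral>x. indicator (\<Omega> \<inter> B) x * w k x \<partial>lborel) = (\<integral>x. indicator B x * ((1 - s x ^ Suc k) * (F x \<bullet> bnormal x)) \<partial>surf)" for k
    unfolding L[symmetric] R[symmetric]
  proof (rule sum.cong[OF refl])
    fix b :: 'a assume "b \<in> Basis"
    then obtain K M where "K-lipschitz_on UNIV (\<phi> k b)" "\<And>x. \<bar>\<phi> k b x\<bar> \<le> M"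
      using \<phi>bl[of b k] unfolding bounded_lipschitz_def by blast
    then show "(\<integral>x. indicator \<Omega> x * dir_deriv (\<phi> k b) b x \<partial>lborel) = (\<integral>x. \<phi> k b x * (b \<bullet> bnormal x) \<partial>surf)"
      by (rule divergence_theorem[OF ne])
  qed
  have pow: "(\<lambda>k. s x ^ Suc k) \<longlonglongrightarrow> 0" if "x \<in> B" for x
    using s[OF that] by (intro LIMSEQ_Suc LIMSEQ_realpow_zero) auto
  have pow01: "0 \<le> 1 - s x ^ Suc k" "1 - s x ^ Suc k \<le> 1" if "x \<in> B" for x k
    using s[OF that] by (auto simp: power_le_one simp del: power_Suc)
  have "(\<lambda>k. \<integral>x. indicator (\<Omega> \<inter> B) x * w k x \<partial>lborel) \<longlonglongrightarrow> (\<integral>x. indicator (\<Omega> \<inter> B) x * dv x \<partial>lborel)"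
  proof (rule integral_dominated_convergence[where w="\<lambda>x. (Cd + 2 * Cb) * indicator B x"])
    show "(\<lambda>x. indicator (\<Omega> \<inter> B) x * w k x) \<in> borel_measurable lborel" for k unfolding w_def by measurable
    show "integrable lborel (\<lambda>x. (Cd + 2 * Cb) * indicator B x :: real)"
      unfolding B_def by (rule integrable_indicator_ball)
    show "AE x in lborel. (\<lambda>k. indicator (\<Omega> \<inter> B) x * w k x) \<longlonglongrightarrow> indicator (\<Omega> \<inter> B) x * dv x"
    proof (rule AE_I2)
      fix x
      show "(\<lambda>k. indicator (\<Omega> \<inter> B) x * w k x) \<longlonglongrightarrow> indicator (\<Omega> \<inter> B) x * dv x"
      proof (cases "x \<in> B")
        case True
        have "(\<lambda>k. w k x) \<longlonglongrightarrow> (1 - 0) * dv x + 2 * 0 * \<beta> x"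
          unfolding w_def by (intro tendsto_intros pow[OF True] Suc_power_one_minus(3)[OF s[OF True]])
        then show ?thesis by (intro tendsto_intros) simp
      qed simp
    qed
    show "AE x in lborel. norm (indicator (\<Omega> \<inter> B) x * w k x) \<le> (Cd + 2 * Cb) * indicator B x" for k
    proof (rule AE_I2)
      fix x
      show "norm (indicator (\<Omega> \<inter> B) x * w k x) \<le> (Cd + 2 * Cb) * indicator B x"
      proof (cases "x \<in> B")
        case True
        have 1: "\<bar>(1 - s x ^ Suc k) * dv x\<bar> \<le> 1 * Cd"
          unfolding abs_mult using pow01[OF True, of k] Cd(2)[OF True] by (intro mult_mono) (auto simp del: power_Suc)
        have 2: "\<bar>(real (Suc k) * s x ^ k * (1 - s x)) * \<beta> x\<bar> \<le> 1 * Cb"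
          unfolding abs_mult[of _ "\<beta> x"] using Suc_power_one_minus(1,2)[OF s[OF True], of k] Cb(2)[OF True]
          by (intro mult_mono) (auto simp del: of_nat_Suc)
        have "\<bar>w k x\<bar> \<le> Cd + 2 * Cb"
          using 1 2 unfolding w_def mult.assoc[of 2] by linarith
        then show ?thesis using True Cd(1) Cb(1) by (auto simp: indicator_def)
      qed simp
    qed
  qed measurable
  moreover have "(\<lambda>k. \<integral>x. indicator B x * ((1 - s x ^ Suc k) * (F x \<bullet> bnormal x)) \<partial>surf) \<longlonglongrightarrow> (\<integral>x. indicator B x * (F x \<bullet> bnormal x) \<partial>surf)"
  proof (rule integral_dominated_convergence[where w="\<lambda>x. CF"])
    show "AE x in surf. (\<lambda>k. indicator B x * ((1 - s x ^ Suc k) * (F x \<bullet> bnormal x))) \<longlonglongrightarrow> indicator B x * (F x \<bullet> bnormal x)"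
    proof (rule AE_I2)
      fix x
      show "(\<lambda>k. indicator B x * ((1 - s x ^ Suc k) * (F x \<bullet> bnormal x))) \<longlonglongrightarrow> indicator B x * (F x \<bullet> bnormal x)"
      proof (cases "x \<in> B")
        case True
        have "(\<lambda>k. (1 - s x ^ Suc k) * (F x \<bullet> bnormal x)) \<longlonglongrightarrow> (1 - 0) * (F x \<bullet> bnormal x)"
          by (intro tendsto_intros pow[OF True])
        then show ?thesis by (intro tendsto_intros) simp
      qed simp
    qed
    show "AE x in surf. norm (indicator B x * ((1 - s x ^ Suc k) * (F x \<bullet> bnormal x))) \<le> CF" for k
      using AE_bnormal
    proof eventually_elim
      case (elim x)
      show ?case
      proof (cases "x \<in> B")
        case True
        have "\<bar>F x \<bullet> bnormal x\<bar> \<le> CF" using Cauchy_Schwarz_ineq2[of "F x" "bnormal x"] elim CF(2)[OF True] by simp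
        then have "\<bar>(1 - s x ^ Suc k) * (F x \<bullet> bnormal x)\<bar> \<le> 1 * CF"
          unfolding abs_mult using pow01[OF True, of k] by (intro mult_mono) (auto simp del: power_Suc)
        then show ?thesis using True by simp
      qed (simp add: CF(1))
    qed
  qed measurable
  ultimately show ?thesis
    unfolding eqk dv_def[symmetric] B_def[symmetric] using LIMSEQ_unique by blast
qed

text \<open>Outside a null set \<open>f\<close> may be replaced by \<open>g\<close>, and in the
  completion every subset of a null set is measurable. This admits the integrand with
  \<open>outward_normal\<close>.\<close>

lemma borel_measurable_completion_AE_eq:
  fixes f g :: "'a \<Rightarrow> 'b::topological_space"
  assumes g: "g \<in> borel_measurable M" and eq: "AE x in M. f x = g x"
  shows "f \<in> borel_measurable (completion M)"
proof (rule measurableI)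
  fix A :: "'b set" assume A: "A \<in> sets borel"
  have g': "g \<in> borel_measurable (completion M)" using g by (rule measurable_completion)
  have 1: "Measurable.pred (completion M) (\<lambda>x. f x \<noteq> g x)"
    using eq by (intro sets_completion_AE) simp
  have 2: "Measurable.pred (completion M) (\<lambda>x. f x \<noteq> g x \<and> f x \<in> A)"
    using eq by (intro sets_completion_AE) (auto elim: eventually_mono)
  have 3: "Measurable.pred (completion M) (\<lambda>x. g x \<in> A)"
    using g' A by measurable
  have "f -` A \<inter> space (completion M) = {x \<in> space (completion M). (g x \<in> A \<and> \<not> f x \<noteq> g x) \<or> (f x \<noteq> g x \<and> f x \<in> A)}"
    by auto
  also have "\<dots> \<in> sets (completion M)" using 1 2 3 by measurable
  finally show "f -` A \<inter> space (completion M) \<in> sets (completion M)" .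
qed simp

lemma (in lipschitz_domain) surface_integral_eq:
  fixes F :: "'a \<Rightarrow> 'a"
  assumes [measurable]: "F \<in> borel_measurable borel" "B \<in> sets borel"
  shows "(LINT x:(frontier \<Omega> \<inter> B)|surface_measure \<Omega>. F x \<bullet> outward_normal \<Omega> x) =
     (\<integral>x. indicator B x * (F x \<bullet> bnormal x) \<partial>surf)"
proof -
  have g: "(\<lambda>x. indicator B x * (F x \<bullet> bnormal x)) \<in> borel_measurable surf" by measurable
  have ae: "AE x in surf. indicator (frontier \<Omega> \<inter> B) x *\<^sub>R (F x \<bullet> outward_normal \<Omega> x) = indicator B x * (F x \<bullet> bnormal x)"
    using AE_bnormal AE_surf_frontier by eventually_elim (simp add: indicator_def)
  have "(LINT x:(frontier \<Omega> \<inter> B)|surface_measure \<Omega>. F x \<bullet> outward_normal \<Omega> x) =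
      (\<integral>x. indicator B x * (F x \<bullet> bnormal x) \<partial>completion surf)"
    unfolding set_lebesgue_integral_def surface_measure_surf
    by (rule integral_cong_AE[OF borel_measurable_completion_AE_eq[OF g ae] measurable_completion[OF g] AE_completion[OF ae]])
  also have "\<dots> = (\<integral>x. indicator B x * (F x \<bullet> bnormal x) \<partial>surf)" by (rule integral_completion[OF g])
  finally show ?thesis .
qed

subsection \<open>Moments\<close>

lemma sum_Basis_inner_mult: "(\<Sum>b\<in>Basis. (b \<bullet> u) * (y \<bullet> b)) = y \<bullet> u" for y u :: "'a::euclidean_space"
  by (subst euclidean_inner[of y u]) (auto intro!: sum.cong simp: inner_commute mult.commute)

lemma inner_linear_combination:
  "(a *\<^sub>R v - c *\<^sub>R w) \<bullet> b = a * (v \<bullet> b) - c * (w \<bullet> b)"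
  "(a *\<^sub>R v + c *\<^sub>R w) \<bullet> b = a * (v \<bullet> b) + c * (w \<bullet> b)"
  by (simp_all add: inner_diff_left inner_add_left)

text \<open>A vector \<open>u\<close> stands for the coordinate direction, which makes the field a
  polynomial in inner products. In the factor, the dimension is the divergence of
  \<open>x - p\<close>, and 1 comes from differentiating the coefficient
  \<open>(x - p) \<bullet> u\<close>.\<close>

lemma (in lipschitz_domain) ball_first_moment:
  fixes p u :: 'a
  assumes ne: "\<Omega> \<noteq> {}" and r: "r > 0"
  shows "(real DIM('a) + 1) * (\<integral>x. indicator (\<Omega> \<inter> ball p r) x * ((x - p) \<bullet> u) \<partial>lborel) =
      (LINT x:(frontier \<Omega> \<inter> ball p r)|surface_measure \<Omega>.
         (((x - p) \<bullet> u) *\<^sub>R (x - p) - r\<^sup>2 *\<^sub>R u) \<bullet> outward_normal \<Omega> x)"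
proof -
  let ?F = "\<lambda>x. ((x - p) \<bullet> u) *\<^sub>R (x - p) - r\<^sup>2 *\<^sub>R u"
  let ?dF = "\<lambda>x h. (h \<bullet> u) *\<^sub>R (x - p) + ((x - p) \<bullet> u) *\<^sub>R h"
  have div: "(\<Sum>b\<in>Basis. ?dF x b \<bullet> b) = (real DIM('a) + 1) * ((x - p) \<bullet> u)" for x
  proof -
    have "(\<Sum>b\<in>Basis. ?dF x b \<bullet> b) = (\<Sum>b\<in>Basis. (b \<bullet> u) * ((x - p) \<bullet> b)) + (\<Sum>b\<in>(Basis::'a set). (x - p) \<bullet> u)"
      unfolding sum.distrib[symmetric] by (intro sum.cong refl) (simp add: inner_linear_combination)
    then show ?thesis by (simp only: sum_Basis_inner_mult) (simp add: algebra_simps)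
  qed
  have "(\<integral>x. indicator (\<Omega> \<inter> ball p r) x * (\<Sum>b\<in>Basis. ?dF x b \<bullet> b) \<partial>lborel) =
     (\<integral>x. indicator (ball p r) x * (?F x \<bullet> bnormal x) \<partial>surf)"
  proof (rule divergence_theorem_tangential_ball[OF ne r, where \<beta>="\<lambda>x. (x - p) \<bullet> u"])
    show "(?F has_derivative ?dF x) (at x)" for x
      by (auto intro!: derivative_eq_intros)
    show "?F x \<bullet> (x - p) = ((norm (x - p))\<^sup>2 - r\<^sup>2) * ((x - p) \<bullet> u)" for x
    proof -
      define y where "y = x - p"
      show ?thesis
        unfolding y_def[symmetric] inner_linear_combination power2_norm_eq_inner
        by (simp add: inner_commute[of u] algebra_simps)
    qed
    show "bounded_lipschitz (\<lambda>x. ?F (ball_retract p r x) \<bullet> b)" for b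
      unfolding inner_linear_combination by (intro bounded_lipschitz_intros r)
    show "continuous_on UNIV (\<lambda>x. \<Sum>b\<in>Basis. ?dF x b \<bullet> b)" "continuous_on UNIV (\<lambda>x. (x - p) \<bullet> u)"
      by (intro continuous_intros)+
  qed
  also have "(\<integral>x. indicator (\<Omega> \<inter> ball p r) x * (\<Sum>b\<in>Basis. ?dF x b \<bullet> b) \<partial>lborel) =
      (real DIM('a) + 1) * (\<integral>x. indicator (\<Omega> \<inter> ball p r) x * ((x - p) \<bullet> u) \<partial>lborel)"
    unfolding div mult.left_commute[of _ "real DIM('a) + 1"] by (rule integral_mult_right_zero)
  also have "(\<integral>x. indicator (ball p r) x * (?F x \<bullet> bnormal x) \<partial>surf) =
      (LINT x:(frontier \<Omega> \<inter> ball p r)|surface_measure \<Omega>. ?F x \<bullet> outward_normal \<Omega> x)"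
    by (rule surface_integral_eq[symmetric]) auto
  finally show ?thesis .
qed

text \<open>The coefficient is homogeneous of degree 2, so the divergence of the cubic part is
  \<open>DIM('a) + 2\<close> times it. The two linear terms each contribute
  \<open>r\<^sup>2 * (u \<bullet> z)\<close>, whose integral is the volume term.\<close>

lemma (in lipschitz_domain) ball_second_moment:
  fixes p u z :: 'a
  assumes ne: "\<Omega> \<noteq> {}" and r: "r > 0"
  shows "(2 * real DIM('a) + 4) * (\<integral>x. indicator (\<Omega> \<inter> ball p r) x * (((x - p) \<bullet> u) * ((x - p) \<bullet> z)) \<partial>lborel)
        - 2 * r\<^sup>2 * (u \<bullet> z) * measure lborel (\<Omega> \<inter> ball p r) =
      (LINT x:(frontier \<Omega> \<inter> ball p r)|surface_measure \<Omega>.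
         ((2 * ((x - p) \<bullet> u) * ((x - p) \<bullet> z)) *\<^sub>R (x - p)
            - r\<^sup>2 *\<^sub>R (((x - p) \<bullet> z) *\<^sub>R u + ((x - p) \<bullet> u) *\<^sub>R z)) \<bullet> outward_normal \<Omega> x)"
proof -
  let ?F = "\<lambda>x. (2 * ((x - p) \<bullet> u) * ((x - p) \<bullet> z)) *\<^sub>R (x - p)
            - r\<^sup>2 *\<^sub>R (((x - p) \<bullet> z) *\<^sub>R u + ((x - p) \<bullet> u) *\<^sub>R z)"
  let ?dF = "\<lambda>x h. ((2 * ((h \<bullet> u) * ((x - p) \<bullet> z) + ((x - p) \<bullet> u) * (h \<bullet> z))) *\<^sub>R (x - p)
            + (2 * ((x - p) \<bullet> u) * ((x - p) \<bullet> z)) *\<^sub>R h) - r\<^sup>2 *\<^sub>R ((h \<bullet> z) *\<^sub>R u + (h \<bullet> u) *\<^sub>R z)"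
  let ?n = "real DIM('a)"
  have div: "(\<Sum>b\<in>Basis. ?dF x b \<bullet> b) = (2 * ?n + 4) * (((x - p) \<bullet> u) * ((x - p) \<bullet> z)) - 2 * r\<^sup>2 * (u \<bullet> z)" for x
  proof -
    define y where "y = x - p"
    have "(\<Sum>b\<in>Basis. ?dF x b \<bullet> b) = (\<Sum>b\<in>Basis. (2 * (y \<bullet> z)) * ((b \<bullet> u) * (y \<bullet> b)) + (2 * (y \<bullet> u)) * ((b \<bullet> z) * (y \<bullet> b))
        + 2 * (y \<bullet> u) * (y \<bullet> z) - r\<^sup>2 * ((b \<bullet> z) * (u \<bullet> b) + (b \<bullet> u) * (z \<bullet> b)))"
      unfolding y_def[symmetric]
      by (intro sum.cong refl) (simp add: inner_diff_left inner_add_left algebra_simps)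
    also have "\<dots> = (2 * (y \<bullet> z)) * (y \<bullet> u) + (2 * (y \<bullet> u)) * (y \<bullet> z) + ?n * (2 * (y \<bullet> u) * (y \<bullet> z)) - r\<^sup>2 * (u \<bullet> z + z \<bullet> u)"
      by (simp only: sum.distrib sum_subtractf sum_distrib_left[symmetric] sum_Basis_inner_mult sum_constant)
        (simp add: algebra_simps)
    finally show ?thesis by (simp add: y_def[symmetric] inner_commute[of z u] algebra_simps)
  qed
  let ?A = "\<Omega> \<inter> ball p r"
  have A[measurable]: "?A \<in> sets borel" by measurable
  have finA: "emeasure lborel ?A < \<infinity>" by (rule emeasure_bounded_finite) (auto intro: bounded_Int)
  have i1: "integrable lborel (\<lambda>x. indicator ?A x :: real)" using finA by (intro integrable_real_indicator) auto
  have i2: "integrable lborel (\<lambda>x. indicator ?A x * (((x - p) \<bullet> u) * ((x - p) \<bullet> z)))"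
  proof (rule Bochner_Integration.integrable_bound)
    show "integrable lborel (\<lambda>x. indicator (cball p r) x *\<^sub>R (((x - p) \<bullet> u) * ((x - p) \<bullet> z)))"
      by (intro borel_integrable_compact continuous_intros) auto
  qed (auto simp: indicator_def)
  have "(\<integral>x. indicator ?A x * (\<Sum>b\<in>Basis. ?dF x b \<bullet> b) \<partial>lborel) =
     (\<integral>x. indicator (ball p r) x * (?F x \<bullet> bnormal x) \<partial>surf)"
  proof (rule divergence_theorem_tangential_ball[OF ne r, where \<beta>="\<lambda>x. 2 * ((x - p) \<bullet> u) * ((x - p) \<bullet> z)"])
    show "(?F has_derivative ?dF x) (at x)" for x
      by (auto intro!: derivative_eq_intros simp: algebra_simps)
    show "?F x \<bullet> (x - p) = ((norm (x - p))\<^sup>2 - r\<^sup>2) * (2 * ((x - p) \<bullet> u) * ((x - p) \<bullet> z))" for x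
    proof -
      define y where "y = x - p"
      show ?thesis
        unfolding y_def[symmetric] inner_linear_combination power2_norm_eq_inner
        by (simp add: inner_commute[of u] inner_commute[of z] algebra_simps)
    qed
    show "bounded_lipschitz (\<lambda>x. ?F (ball_retract p r x) \<bullet> b)" for b
      unfolding inner_linear_combination by (intro bounded_lipschitz_intros r)
    show "continuous_on UNIV (\<lambda>x. \<Sum>b\<in>Basis. ?dF x b \<bullet> b)"
      "continuous_on UNIV (\<lambda>x. 2 * ((x - p) \<bullet> u) * ((x - p) \<bullet> z))"
      by (intro continuous_intros)+
  qed
  also have "(\<integral>x. indicator ?A x * (\<Sum>b\<in>Basis. ?dF x b \<bullet> b) \<partial>lborel) =
      (\<integral>x. (2 * ?n + 4) * (indicator ?A x * (((x - p) \<bullet> u) * ((x - p) \<bullet> z))) - 2 * r\<^sup>2 * (u \<bullet> z) * indicator ?A x \<partial>lborel)"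
    unfolding div by (intro Bochner_Integration.integral_cong refl) (simp add: right_diff_distrib mult_ac)
  also have "\<dots> = (2 * ?n + 4) * (\<integral>x. indicator ?A x * (((x - p) \<bullet> u) * ((x - p) \<bullet> z)) \<partial>lborel)
        - 2 * r\<^sup>2 * (u \<bullet> z) * measure lborel ?A"
    using i1 i2 by (subst Bochner_Integration.integral_diff) auto
  also have "(\<integral>x. indicator (ball p r) x * (?F x \<bullet> bnormal x) \<partial>surf) =
      (LINT x:(frontier \<Omega> \<inter> ball p r)|surface_measure \<Omega>. ?F x \<bullet> outward_normal \<Omega> x)"
    by (rule surface_integral_eq[symmetric]) auto
  finally show ?thesis .
qed

text \<open>With \<open>u = axis i 1\<close> and \<open>z = axis j 1\<close> the two identities for
  balls are solved for the moments. The integrands and sets are Borel, so \<open>lebesgue\<close>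
  may be replaced by \<open>lborel\<close>.\<close>

theorem lemma7:
  fixes \<Omega> :: "(real^'n) set" and p :: "real^'n" and r :: real and i j :: 'n
  assumes "CARD('n) \<ge> 2"
    and "open \<Omega>" and "bounded \<Omega>" and "lipschitz_boundary \<Omega>"
    and "p \<in> frontier \<Omega>" and "r > 0"
  shows "(first_moment \<Omega> r i p =
      1 / (real CARD('n) + 1) *
      (LINT x:(frontier \<Omega> \<inter> ball p r)|surface_measure \<Omega>.
         (((x - p) $ i) *\<^sub>R (x - p) - r\<^sup>2 *\<^sub>R axis i 1) \<bullet> outward_normal \<Omega> x)) \<and>
    (second_moment \<Omega> r i j p =
      r\<^sup>2 / (real CARD('n) + 2) * ball_volume \<Omega> r p * (if i = j then 1 else 0) +
      1 / (2 * real CARD('n) + 4) *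
      (LINT x:(frontier \<Omega> \<inter> ball p r)|surface_measure \<Omega>.
         ((2 * (x - p) $ i * (x - p) $ j) *\<^sub>R (x - p)
            - r\<^sup>2 *\<^sub>R (((x - p) $ j) *\<^sub>R axis i 1 + ((x - p) $ i) *\<^sub>R axis j 1)) \<bullet> outward_normal \<Omega> x))"
proof -
  interpret lipschitz_domain \<Omega> using assms by unfold_locales
  \<comment> \<open>The frontier of the empty set is empty, but it contains
    \<open>p\<close>.\<close>
  have ne: "\<Omega> \<noteq> {}" using assms(5) by auto
  let ?A = "\<Omega> \<inter> ball p r"
  have A[measurable]: "?A \<in> sets borel" by measurable
  have comp: "y $ k = y \<bullet> axis k 1" for y :: "real^'n" and k by (simp add: inner_axis)
  have m1: "first_moment \<Omega> r i p = (\<integral>x. indicator ?A x * ((x - p) \<bullet> axis i 1) \<partial>lborel)"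
    unfolding first_moment_def set_lebesgue_integral_def comp real_scaleR_def
    by (rule integral_completion) measurable
  have m2: "second_moment \<Omega> r i j p = (\<integral>x. indicator ?A x * (((x - p) \<bullet> axis i 1) * ((x - p) \<bullet> axis j 1)) \<partial>lborel)"
    unfolding second_moment_def set_lebesgue_integral_def comp real_scaleR_def
    by (rule integral_completion) measurable
  have vol: "ball_volume \<Omega> r p = measure lborel ?A"
    unfolding ball_volume_def by (rule measure_completion) simp
  have d: "axis i 1 \<bullet> (axis j 1 :: real^'n) = (if i = j then 1 else 0)" by (simp add: inner_axis_axis)
  have n: "real DIM(real^'n) = real CARD('n)" by simp
  have n0: "real CARD('n) + 1 > 0" "2 * real CARD('n) + 4 > 0" "real CARD('n) + 2 > 0" by simp_all
  note M1 = ball_first_moment[OF ne assms(6), of p "axis i 1", folded m1 comp, unfolded n]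
  note M2 = ball_second_moment[OF ne assms(6), of p "axis i 1" "axis j 1", folded m2 vol, unfolded d n, folded comp]
  have alg1: "m = 1 / c * I" if "c > 0" "c * m = I" for c m I :: real
    using that by (simp add: field_simps)
  \<comment> \<open>Dividing by \<open>2 * c + 4\<close> leaves \<open>R / (c + 2)\<close> in front
    of the volume, as the factor 2 cancels.\<close>
  have alg2: "m = R / (c + 2) * V * \<delta> + 1 / (2 * c + 4) * I" if c: "c \<ge> 0" and eq: "(2 * c + 4) * m - 2 * R * \<delta> * V = I"
    for c m I R V \<delta> :: real
  proof -
    have "m = (2 * R * \<delta> * V + I) / (2 * (c + 2))" using c eq by (simp add: field_simps)
    also have "\<dots> = (2 * (R * V * \<delta>)) / (2 * (c + 2)) + I / (2 * (c + 2))" by (simp add: add_divide_distrib mult_ac)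
    also have "(2 * (R * V * \<delta>)) / (2 * (c + 2)) = (R * V * \<delta>) / (c + 2)"
      by (rule mult_divide_mult_cancel_left) simp
    also have "2 * (c + 2) = 2 * c + 4" by simp
    finally show ?thesis by simp
  qed
  show ?thesis
    using alg1[OF n0(1) M1] alg2[OF _ M2] by simp
qed

end
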